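(* Let $\mathcal{C}$ be a hereditary graph class. The following are equivalent: (i) There exists a positive integer $c_1$ such that for every $G \in \mathcal{C}$ on at least $3$ vertices we have $\mathrm{tw}_\alpha(G) \leq (\log |V(G)|)^{c_1}$. (ii) There exists a positive integer $c_2$ such that for every $G \in \mathcal{C}$ on at least $3$ vertices we have $\mathrm{tw}_\alpha(G) \leq (\omega(G) \log |V(G)|)^{c_2}$. (iii) There exists a positive integer $c_3$ such that for every $G \in \mathcal{C}$ on at least $3$ vertices we have $\mathrm{tw}(G) \leq (\omega(G) \log |V(G)|)^{c_3}$.
   Context: Graphs are finite and simple. Logarithms are base $2$. A class of graphs is hereditary if it is closed under taking induced subgraphs. $\omega(G)$ is the largest size of a clique (set of pairwise adjacent vertices) in $G$; $\alpha(G)$ is the largest size of an independent set in $G$, and $\alpha(X)=\alpha(G[X])$ for $X\subseteq V(G)$. A tree decomposition $(T,\chi)$ of $G$ consists of a tree $T$ and a map $\chi:V(T)\to 2^{V(G)}$ such that for every edge $v_1v_2\in E(G)$ there is $t\in V(T)$ with $\{v_1,v_2\}\subseteq \chi(t)$, and for every $v\in V(G)$ the subgraph of $T$ induced by $\{t\in V(T) : v\in\chi(t)\}$ is non-empty and connected. Its width is $\max_{t\in V(T)}|\chi(t)|-1$, and the treewidth $\mathrm{tw}(G)$ is the minimum width of a tree decomposition of $G$. The independence number of $(T,\chi)$ is $\max_{t\in V(T)}\alpha(\chi(t))$, and the tree-independence number $\mathrm{tw}_\alpha(G)$ is the minimum independence number of a tree decomposition of $G$. *)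

theory Defs
  imports Complex_Main "Graph_Theory.Digraph_Component"
begin

text \<open>
  A finite simple graph is a digraph satisfying the library locale \<^locale>\<open>graph\<close>: finite,
  loop-free, without parallel arcs and symmetric, so that an edge is a pair of opposite arcs.
  The adjacency relation of \<open>G\<close> is \<open>u \<rightarrow>\<^bsub>G\<^esub> v\<close>, and \<open>G \<restriction> X\<close> is \<open>G[X]\<close>.
\<close>

definition hereditary :: "('a, 'b) pre_digraph set \<Rightarrow> bool" where
  "hereditary \<C> \<longleftrightarrow> (\<forall>G\<in>\<C>. \<forall>H. induced_subgraph H G \<longrightarrow> H \<in> \<C>)"

definition clique :: "('a, 'b) pre_digraph \<Rightarrow> 'a set \<Rightarrow> bool" where
  "clique G K \<longleftrightarrow> K \<subseteq> verts G \<and> (\<forall>u\<in>K. \<forall>v\<in>K. u \<noteq> v \<longrightarrow> u \<rightarrow>\<^bsub>G\<^esub> v)"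

definition independent_set :: "('a, 'b) pre_digraph \<Rightarrow> 'a set \<Rightarrow> bool" where
  "independent_set G S \<longleftrightarrow> S \<subseteq> verts G \<and> (\<forall>u\<in>S. \<forall>v\<in>S. u \<noteq> v \<longrightarrow> \<not> u \<rightarrow>\<^bsub>G\<^esub> v)"

definition clique_number :: "('a, 'b) pre_digraph \<Rightarrow> nat" where
  "clique_number G = Max {card K | K. clique G K}"

definition independence_number :: "('a, 'b) pre_digraph \<Rightarrow> nat" where
  "independence_number G = Max {card S | S. independent_set G S}"

text \<open>
  The library predicate \<^const>\<open>tree\<close> is about orientations: it counts the arcs of an edge
  traversed back and forth as a cycle, so a symmetric digraph with an edge never satisfies it.
  For undirected graphs only cycles of length at least 3 are relevant.
\<close>

definition undirected_tree :: "('a, 'b) pre_digraph \<Rightarrow> bool" where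
  "undirected_tree T \<longleftrightarrow>
     graph T \<and> Digraph_Component.connected T \<and> \<not> (\<exists>p. pre_digraph.cycle T p \<and> length p \<ge> 3)"

text \<open>The library notion of connectedness includes that the vertex set is non-empty.\<close>

definition tree_decomposition ::
    "('a, 'b) pre_digraph \<Rightarrow> ('t, 's) pre_digraph \<Rightarrow> ('t \<Rightarrow> 'a set) \<Rightarrow> bool" where
  "tree_decomposition G T \<chi> \<longleftrightarrow>
     undirected_tree T \<and>
     (\<forall>t\<in>verts T. \<chi> t \<subseteq> verts G) \<and>
     (\<forall>u v. u \<rightarrow>\<^bsub>G\<^esub> v \<longrightarrow> (\<exists>t\<in>verts T. {u, v} \<subseteq> \<chi> t)) \<and>
     (\<forall>v\<in>verts G. Digraph_Component.connected (T \<restriction> {t \<in> verts T. v \<in> \<chi> t}))"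

text \<open>
  Truncated subtraction is harmless as soon as \<open>G\<close> has a vertex, because then some bag of a
  tree decomposition is non-empty.
\<close>

definition width :: "('t, 's) pre_digraph \<Rightarrow> ('t \<Rightarrow> 'a set) \<Rightarrow> nat" where
  "width T \<chi> = Max ((\<lambda>t. card (\<chi> t)) ` verts T) - 1"

definition decomposition_independence_number ::
    "('a, 'b) pre_digraph \<Rightarrow> ('t, 's) pre_digraph \<Rightarrow> ('t \<Rightarrow> 'a set) \<Rightarrow> nat" where
  "decomposition_independence_number G T \<chi> =
     Max ((\<lambda>t. independence_number (G \<restriction> \<chi> t)) ` verts T)"

text \<open>
  Every finite tree is isomorphic to one whose vertices are natural numbers and whose arcs are
  pairs of vertices, so the minima below may range over such trees only.
\<close>

definition treewidth :: "('a, 'b) pre_digraph \<Rightarrow> nat" where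
  "treewidth G =
     (LEAST k. \<exists>(T :: nat pair_pre_digraph) \<chi>.
        tree_decomposition G (with_proj T) \<chi> \<and> width (with_proj T) \<chi> = k)"

definition tree_independence_number :: "('a, 'b) pre_digraph \<Rightarrow> nat" where
  "tree_independence_number G =
     (LEAST k. \<exists>(T :: nat pair_pre_digraph) \<chi>.
        tree_decomposition G (with_proj T) \<chi> \<and>
        decomposition_independence_number G (with_proj T) \<chi> = k)"

end

theory Submission
  imports Defs "HOL-Library.FuncSet"
begin

text \<open>
  Passing from (i) to (ii) is immediate. A biclique with sides of size \<open>t\<close> has clique number 2 and
  tree-independence number at least \<open>t\<close>, so (ii) excludes some induced biclique. Without it, the
  number of vertices of a graph is polynomial in its clique and independence numbers; applied to the
  bags of a decomposition, this gives (iii).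

  From (iii) to (i), it suffices to separate every connected induced subgraph, say with \<open>n\<close> vertices,
  into two sides of size at most \<open>(1 - 1/K) n\<close> by a set of polylogarithmic independence number, where
  \<open>K\<close> is polylogarithmic. Suppose this fails. Given vertex weights for which no independent set is
  heavy, region growing shows that a ball of small radius contains almost all vertices, since
  otherwise boundaries of balls would provide the separator. So the average distance to the
  centre of the ball is small. By multiplicative weights, there is a distribution on systems of paths
  such that the average number of paths through a vertex is small compared to the probability that the
  vertex lies in a random independent set. The union of \<open>s\<close> independent sets has clique number at most
  \<open>s\<close>, so by (iii) it is degenerate and has few cliques of size \<open>s\<close>. Hence, if a random vertex is
  chosen for each vertex of a grid, and random paths for its edges, then with positive probability the
  chosen paths induce a subgraph of small clique number in which each vertex lies on few paths. The
  crosses of the grid form a bramble showing that the treewidth of this subgraph violates (iii).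
\<close>

section \<open>Connected sets and trees\<close>

text \<open>The obstacle is that (iii) says little about dense parts: it is useful only for
  subgraphs of small clique number. Such subgraphs are produced by sampling, and comparing
  congestion with random independent sets keeps them sparse. For \<open>s\<close> fixed disjoint
  edges of the grid, the expected number of cliques met by their segments is at most
  \<open>(2 \<kappa>)^s\<close> times the number expected in \<open>s\<close> random independent
  sets, and degeneracy bounds the latter by \<open>n s D^(s - 1)\<close>, where \<open>D\<close> is
  the bound from (iii). A union bound over at most \<open>M^s\<close> choices of edges gives about
  \<open>(2 \<kappa> M D)^s n s\<close>. So \<open>s\<close> is about \<open>log n\<close>, to beat
  the factor \<open>n\<close>, and \<open>\<kappa>\<close> is \<open>1 / (8 M D)\<close>. A bag of
  \<open>D\<close> vertices meets fewer than \<open>4 s D\<close> segments, which fixes the side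
  \<open>q = 4 s D\<close> of the grid and \<open>M = q^2\<close>. As \<open>\<kappa>\<close> is
  about \<open>(log n) / K\<close>, also \<open>K\<close> is fixed, and it is polylogarithmic
  because \<open>D\<close> is. The clique number \<open>16 s\<close> arises from fewer than
  \<open>s\<close> segments in each of four matchings, each with at most 4 clique vertices. The weak
  balance \<open>1 - 1/K\<close> is affordable since about \<open>K log n\<close> rounds of
  separation suffice.\<close>

definition conn :: "('a \<times> 'a) set \<Rightarrow> 'a set \<Rightarrow> bool" where
  "conn R S \<longleftrightarrow> S \<noteq> {} \<and> (\<forall>u\<in>S. \<forall>v\<in>S. (u, v) \<in> rtrancl_on S R)"

definition touching :: "('a \<times> 'a) set \<Rightarrow> 'a set \<Rightarrow> 'a set \<Rightarrow> bool" where
  "touching R A B \<longleftrightarrow> (\<exists>a\<in>A. \<exists>b\<in>B. a = b \<or> (a, b) \<in> R)"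

text \<open>
  Graphs are treated below as symmetric irreflexive relations \<open>R\<close>, and induced subgraphs as vertex
  sets. Note that a set containing a loop of \<open>R\<close> is never independent.
\<close>

definition indep :: "('a \<times> 'a) set \<Rightarrow> 'a set \<Rightarrow> bool" where
  "indep R J \<longleftrightarrow> (\<forall>u\<in>J. \<forall>v\<in>J. (u, v) \<notin> R)"

definition cliq :: "('a \<times> 'a) set \<Rightarrow> 'a set \<Rightarrow> bool" where
  "cliq R K \<longleftrightarrow> (\<forall>u\<in>K. \<forall>v\<in>K. u \<noteq> v \<longrightarrow> (u, v) \<in> R)"

definition alpha_le :: "('a \<times> 'a) set \<Rightarrow> nat \<Rightarrow> 'a set \<Rightarrow> bool" where
  "alpha_le R k X \<longleftrightarrow> (\<forall>J\<subseteq>X. indep R J \<longrightarrow> card J \<le> k)"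

lemma indep_insertI:
  assumes "sym R" "(v, v) \<notin> R" "indep R J" "\<And>u. u \<in> J \<Longrightarrow> (v, u) \<notin> R"
  shows "indep R (insert v J)"
proof -
  have "(u, v) \<notin> R" if "u \<in> J" for u using assms(4)[OF that] symD[OF assms(1)] by blast
  then show ?thesis using assms(2-4) unfolding indep_def by simp
qed

lemma conn_singleton [simp]: "conn R {x}"
  by (auto simp: conn_def)

lemma conn_mono: "conn R S \<Longrightarrow> R \<subseteq> R' \<Longrightarrow> conn R' S"
  unfolding conn_def using rtrancl_on_mono[of R R' S S] by blast

lemma conn_Un:
  assumes "sym R" "conn R A" "conn R B" "touching R A B"
  shows "conn R (A \<union> B)"
proof -
  obtain a b where ab: "a \<in> A" "b \<in> B" "a = b \<or> (a, b) \<in> R"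
    using assms(4) by (auto simp: touching_def)
  let ?T = "rtrancl_on (A \<union> B) R"
  have symT: "sym ?T" by (rule rtrancl_on_sym[OF assms(1)])
  have inA: "(u, v) \<in> ?T" if "u \<in> A" "v \<in> A" for u v
    using assms(2) that rtrancl_on_mono[of R R A "A \<union> B"] unfolding conn_def by blast
  have inB: "(u, v) \<in> ?T" if "u \<in> B" "v \<in> B" for u v
    using assms(3) that rtrancl_on_mono[of R R B "A \<union> B"] unfolding conn_def by blast
  have "(a, b) \<in> ?T"
    using ab by (metis UnI1 UnI2 rtrancl_on_into_rtrancl_on rtrancl_on_refl)
  then have AB: "(u, v) \<in> ?T" if "u \<in> A" "v \<in> B" for u v
    using inA[OF that(1) ab(1)] inB[OF ab(2) that(2)] by (meson rtrancl_on_trans)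
  then have "(v, u) \<in> ?T" if "u \<in> A" "v \<in> B" for u v
    using symT that by (meson symD)
  then show ?thesis
    using ab(1) inA inB AB unfolding conn_def by blast
qed

lemma conn_insert:
  assumes "sym R" "conn R S" "p \<in> S" "(p, l) \<in> R"
  shows "conn R (insert l S)"
  using conn_Un[OF assms(1,2) conn_singleton[of R l]] assms(3,4) by (auto simp: touching_def)

lemma conn_UN:
  assumes "sym R" "\<And>i. i < (k::nat) \<Longrightarrow> conn R (A i)" "k > 0"
    and "\<And>i. Suc i < k \<Longrightarrow> touching R (A i) (A (Suc i))"
  shows "conn R (\<Union>i<k. A i)"
  using assms(2-4)
proof (induction k)
  case (Suc k)
  show ?case
  proof (cases "k = 0")
    case True
    with Suc show ?thesis by (simp add: lessThan_Suc)
  next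
    case False
    then have "conn R (\<Union>i<k. A i)" using Suc by simp
    moreover have "touching R (\<Union>i<k. A i) (A k)"
    proof -
      have "touching R (A (k - 1)) (A k)" using Suc.prems(3)[of "k - 1"] False by simp
      then show ?thesis using False unfolding touching_def by (auto intro!: bexI[of _ "k-1"])
    qed
    ultimately show ?thesis
      using conn_Un[OF assms(1) _ Suc.prems(1)[of k], of "\<Union>i<k. A i"] by (simp add: lessThan_Suc Un_commute)
  qed
qed simp

lemma rtrancl_on_image:
  assumes "(u, v) \<in> rtrancl_on S R"
  shows "(f u, f v) \<in> rtrancl_on (f ` S) (map_prod f f ` R)"
  using assms
proof (induction rule: rtrancl_on_induct)
  case (step y z)
  then show ?case
    by (meson imageI map_prod_imageI rtrancl_on_into_rtrancl_on)
qed simp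

lemma conn_image: "conn R S \<Longrightarrow> conn (map_prod f f ` R) (f ` S)"
  unfolding conn_def by (auto intro: rtrancl_on_image)

text \<open>Generation by leaves makes leaf removal the induction rule. Edges are stored in both
  directions. \<open>undirected_tree_imp_itree\<close> and \<open>itree_imp_undirected_tree\<close>
  relate this to connected acyclic digraphs.\<close>

inductive itree :: "'t set \<Rightarrow> ('t \<times> 't) set \<Rightarrow> bool" where
  itree_single: "itree {t} {}"
| itree_leaf: "itree N E \<Longrightarrow> p \<in> N \<Longrightarrow> l \<notin> N \<Longrightarrow> itree (insert l N) (insert (p, l) (insert (l, p) E))"

lemma itree_sym: "itree N E \<Longrightarrow> sym E"
  by (induction rule: itree.induct) (auto simp: sym_def)

lemma itree_finite: "itree N E \<Longrightarrow> finite N"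
  by (induction rule: itree.induct) auto

lemma itree_edges: "itree N E \<Longrightarrow> E \<subseteq> N \<times> N"
  by (induction rule: itree.induct) auto

lemma itree_irrefl: "itree N E \<Longrightarrow> (x, x) \<notin> E"
  by (induction rule: itree.induct) auto

lemma itree_conn: "itree N E \<Longrightarrow> conn E N"
proof (induction rule: itree.induct)
  case (itree_leaf N E p l)
  let ?E = "insert (p, l) (insert (l, p) E)"
  have "itree (insert l N) ?E" using itree_leaf by (intro itree.itree_leaf) auto
  moreover have "conn ?E N" using itree_leaf(4) by (rule conn_mono) auto
  ultimately show ?case using conn_insert[of ?E N p l] itree_sym itree_leaf(2) by blast
qed simp

text \<open>A walk can enter or leave the leaf only through \<open>p\<close>, so detours to
  \<open>l\<close> can be cut out.\<close>

lemma conn_remove_leaf: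
  assumes "itree N E" "l \<notin> N" "conn (insert (p, l) (insert (l, p) E)) S" "S \<subseteq> insert l N" "S \<noteq> {l}"
  shows "l \<in> S \<Longrightarrow> p \<in> S" and "conn E (S - {l})"
proof -
  let ?E = "insert (p, l) (insert (l, p) E)"
  have EN: "E \<subseteq> N \<times> N" using assms(1) by (rule itree_edges)
  obtain x where x: "x \<in> S" "x \<noteq> l" using assms(3,5) by (auto simp: conn_def)
  \<comment> \<open>While the walk stands at \<open>l\<close>, the invariant remembers
    \<open>p\<close>, where it came from and where it must return.\<close>
  have step: "if y = l then (u, p) \<in> rtrancl_on (S - {l}) E else (u, y) \<in> rtrancl_on (S - {l}) E"
    if "(u, y) \<in> rtrancl_on S ?E" "u \<noteq> l" for u y
    using that
  proof (induction rule: rtrancl_on.induct)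
    case (rtrancl_on_into_rtrancl_on a b c)
    show ?case
    proof (cases "b = l")
      case True
      then have "c = p \<or> c = l" using rtrancl_on_into_rtrancl_on(2) EN assms(2) by auto
      then show ?thesis using True rtrancl_on_into_rtrancl_on by auto
    next
      case False
      then show ?thesis using rtrancl_on_into_rtrancl_on EN assms(2)
        by (auto intro: rtrancl_on.rtrancl_on_into_rtrancl_on)
    qed
  qed auto
  have reach: "(u, y) \<in> rtrancl_on S ?E" if "u \<in> S" "y \<in> S" for u y
    using assms(3) that by (simp add: conn_def)
  show "p \<in> S" if "l \<in> S"
  proof -
    have "(x, p) \<in> rtrancl_on (S - {l}) E" using step[OF reach[OF x(1) that] x(2)] by simp
    then show ?thesis using in_rtrancl_on_in_F(2) by fast
  qed
  have "(u, y) \<in> rtrancl_on (S - {l}) E" if "u \<in> S - {l}" "y \<in> S - {l}" for u y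
    using step[of u y] reach[of u y] that by simp
  then show "conn E (S - {l})" using x unfolding conn_def by blast
qed

text \<open>
  The Helly property of subtrees, by removing a leaf: a subtree containing the leaf is either the
  leaf alone or also contains its neighbour.
\<close>

lemma itree_helly:
  assumes "itree N E"
    and "\<And>S. S \<in> F \<Longrightarrow> S \<subseteq> N \<and> conn E S"
    and "\<And>S S'. S \<in> F \<Longrightarrow> S' \<in> F \<Longrightarrow> S \<inter> S' \<noteq> {}"
  shows "\<exists>t\<in>N. \<forall>S\<in>F. t \<in> S"
  using assms
proof (induction arbitrary: F rule: itree.induct)
  case (itree_single t)
  then show ?case by (auto simp: conn_def)
next
  case (itree_leaf N E p l)
  show ?case
  proof (cases "{l} \<in> F")
    case True
    then show ?thesis using itree_leaf.prems(2)[OF True] by auto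
  next
    case False
    have rem: "l \<in> S \<Longrightarrow> p \<in> S" "conn E (S - {l})" if "S \<in> F" for S
      using conn_remove_leaf[OF itree_leaf(1,3), of p S] itree_leaf.prems(1)[OF that] that False
      by blast+
    have "\<exists>t\<in>N. \<forall>S\<in>(\<lambda>S. S - {l}) ` F. t \<in> S"
    proof (rule itree_leaf.IH)
      fix S assume "S \<in> (\<lambda>S. S - {l}) ` F"
      then show "S \<subseteq> N \<and> conn E S" using rem(2) itree_leaf.prems(1) by blast
    next
      fix S S' assume "S \<in> (\<lambda>S. S - {l}) ` F" "S' \<in> (\<lambda>S. S - {l}) ` F"
      then obtain A B where AB: "A \<in> F" "B \<in> F" "S = A - {l}" "S' = B - {l}" by auto
      then obtain x where "x \<in> A" "x \<in> B" using itree_leaf.prems(2) by blast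
      \<comment> \<open>If the common node is the deleted leaf, then \<open>p\<close> is common as
        well.\<close>
      then show "S \<inter> S' \<noteq> {}" using AB rem(1)[of A] rem(1)[of B] itree_leaf.hyps(2,3)
        by (cases "x = l") auto
    qed
    then show ?thesis by auto
  qed
qed

lemma itree_map:
  assumes "itree N E" "inj f"
  shows "itree (f ` N) (map_prod f f ` E)"
  using assms
proof (induction rule: itree.induct)
  case (itree_single t)
  show ?case using itree.itree_single[of "f t"] by simp
next
  case (itree_leaf N E p l)
  have "f l \<notin> f ` N" using itree_leaf.hyps(3) itree_leaf.prems by (simp add: inj_image_mem_iff)
  from itree.itree_leaf[OF itree_leaf.IH[OF itree_leaf.prems] imageI[OF itree_leaf.hyps(2)] this]
  show ?case by simp
qed

text \<open>The second tree is regrown on the first: its initial node becomes a leaf at an arbitrary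
  node, the others follow in their order. The choice of node does not matter in
  \<open>tdec_join\<close>, where no vertex has bags in both trees.\<close>

lemma itree_join:
  assumes "itree N2 E2" "itree N1 E1" "N1 \<inter> N2 = {}"
  shows "\<exists>E. itree (N1 \<union> N2) E \<and> E1 \<subseteq> E \<and> E2 \<subseteq> E"
  using assms
proof (induction rule: itree.induct)
  case (itree_single t)
  then obtain p where p: "p \<in> N1" using itree_conn[of N1 E1] unfolding conn_def by blast
  have "t \<notin> N1" using itree_single.prems(2) by blast
  from itree.itree_leaf[OF itree_single.prems(1) p this]
  show ?case by (intro exI[of _ "insert (p, t) (insert (t, p) E1)"]) auto
next
  case (itree_leaf N E p l)
  have "N1 \<inter> N = {}" using itree_leaf.prems(2) by blast
  then obtain E' where E': "itree (N1 \<union> N) E'" "E1 \<subseteq> E'" "E \<subseteq> E'"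
    using itree_leaf.IH itree_leaf.prems(1) by blast
  have "p \<in> N1 \<union> N" "l \<notin> N1 \<union> N" using itree_leaf.hyps itree_leaf.prems(2) by blast+
  from itree.itree_leaf[OF E'(1) this]
  show ?case using E' by (intro exI[of _ "insert (p, l) (insert (l, p) E')"]) auto
qed

section \<open>Tree decompositions of vertex sets\<close>

text \<open>
  \<open>tdec R V P\<close>: the graph induced by \<open>R\<close> on \<open>V\<close> has a tree decomposition all of whose bags
  satisfy \<open>P\<close>.
\<close>

definition tdec :: "('a \<times> 'a) set \<Rightarrow> 'a set \<Rightarrow> ('a set \<Rightarrow> bool) \<Rightarrow> bool" where
  "tdec R V P \<longleftrightarrow> (\<exists>(N :: nat set) E \<chi>. itree N E \<and> (\<forall>t\<in>N. \<chi> t \<subseteq> V \<and> P (\<chi> t)) \<and>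
     (\<forall>u\<in>V. \<forall>v\<in>V. (u, v) \<in> R \<longrightarrow> (\<exists>t\<in>N. u \<in> \<chi> t \<and> v \<in> \<chi> t)) \<and>
     (\<forall>v\<in>V. conn E {t\<in>N. v \<in> \<chi> t}))"

lemma tdecE:
  assumes "tdec R V P"
  obtains N :: "nat set" and E \<chi> where "itree N E" "\<forall>t\<in>N. \<chi> t \<subseteq> V \<and> P (\<chi> t)"
    "\<forall>u\<in>V. \<forall>v\<in>V. (u, v) \<in> R \<longrightarrow> (\<exists>t\<in>N. u \<in> \<chi> t \<and> v \<in> \<chi> t)"
    "\<forall>v\<in>V. conn E {t\<in>N. v \<in> \<chi> t}"
  using assms unfolding tdec_def by blast

lemma tdecI:
  assumes "itree (N :: nat set) E" "\<forall>t\<in>N. \<chi> t \<subseteq> V \<and> P (\<chi> t)"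
    "\<forall>u\<in>V. \<forall>v\<in>V. (u, v) \<in> R \<longrightarrow> (\<exists>t\<in>N. u \<in> \<chi> t \<and> v \<in> \<chi> t)"
    "\<forall>v\<in>V. conn E {t\<in>N. v \<in> \<chi> t}"
  shows "tdec R V P"
  unfolding tdec_def by (rule exI[of _ N], rule exI[of _ E], rule exI[of _ \<chi>]) (use assms in simp)

lemma tdec_trivial: "P V \<Longrightarrow> tdec R V P"
  unfolding tdec_def
  by (intro exI[of _ "{0}"] exI[of _ "{}"] exI[of _ "\<lambda>_. V"]) (auto intro: itree_single simp: conn_def)

text \<open>
  A vertex that occurs in the bag of a leaf but not in that of its neighbour has its closed
  neighbourhood in the leaf bag.
\<close>

lemma tdec_low_degree:
  assumes "tdec R V P" "V \<noteq> {}"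
  shows "\<exists>v\<in>V. \<exists>B. P B \<and> B \<subseteq> V \<and> v \<in> B \<and> (\<forall>u\<in>V. (v, u) \<in> R \<longrightarrow> u \<in> B)"
proof -
  obtain N E \<chi> where "itree (N :: nat set) E" "\<forall>t\<in>N. \<chi> t \<subseteq> V \<and> P (\<chi> t)"
    "\<forall>u\<in>V. \<forall>v\<in>V. (u, v) \<in> R \<longrightarrow> (\<exists>t\<in>N. u \<in> \<chi> t \<and> v \<in> \<chi> t)"
    "\<forall>v\<in>V. conn E {t\<in>N. v \<in> \<chi> t}"
    by (rule tdecE[OF assms(1)])
  then show ?thesis
  proof (induction rule: itree.induct)
    case (itree_single t)
    obtain v where "v \<in> V" using assms(2) by blast
    moreover from this have "u \<in> \<chi> t" if "u \<in> V" for u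
      using itree_single(3) that by (fastforce simp: conn_def)
    ultimately show ?case using itree_single by blast
  next
    case (itree_leaf N E p l)
    let ?E = "insert (p, l) (insert (l, p) E)"
    let ?S = "\<lambda>v. {t \<in> insert l N. v \<in> \<chi> t}"
    show ?case
    proof (cases "\<chi> l \<subseteq> \<chi> p")
      \<comment> \<open>A leaf bag inside its neighbour's bag can be deleted: all its vertices
        survive in \<open>\<chi> p\<close>.\<close>
      case True
      have "conn E {t\<in>N. v \<in> \<chi> t}" if v: "v \<in> V" for v
      proof -
        have "?S v \<noteq> {l}" using True itree_leaf(2,3) by auto
        then have "conn E (?S v - {l})"
          using conn_remove_leaf(2)[OF itree_leaf(1,3), of p "?S v"] itree_leaf.prems(3) v by auto
        moreover have "?S v - {l} = {t\<in>N. v \<in> \<chi> t}" using itree_leaf(3) by auto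
        ultimately show ?thesis by simp
      qed
      moreover have "\<exists>t\<in>N. u \<in> \<chi> t \<and> v \<in> \<chi> t" if "u \<in> V" "v \<in> V" "(u, v) \<in> R" for u v
        using itree_leaf.prems(2) that True itree_leaf(2) by blast
      ultimately show ?thesis using itree_leaf.IH itree_leaf.prems(1) by blast
    next
      case False
      then obtain v where v: "v \<in> \<chi> l" "v \<notin> \<chi> p" by auto
      then have vV: "v \<in> V" using itree_leaf.prems(1) by auto
      have "?S v = {l}"
        using conn_remove_leaf(1)[OF itree_leaf(1,3), of p "?S v"] itree_leaf.prems(3) vV v by auto
      then have only: "t = l" if "t \<in> insert l N" "v \<in> \<chi> t" for t
        using that by blast
      have "u \<in> \<chi> l" if "u \<in> V" "(v, u) \<in> R" for u
        using itree_leaf.prems(2)[rule_format, OF vV that] only by blast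
      then show ?thesis using itree_leaf.prems(1) v vV by blast
    qed
  qed
qed

text \<open>
  The easy direction of treewidth duality.
\<close>

lemma tdec_bramble:
  assumes "tdec R V P"
    and B: "\<And>X. X \<in> \<B> \<Longrightarrow> X \<subseteq> V \<and> conn R X"
    and T: "\<And>X Y. X \<in> \<B> \<Longrightarrow> Y \<in> \<B> \<Longrightarrow> touching R X Y"
  shows "\<exists>B. P B \<and> B \<subseteq> V \<and> (\<forall>X\<in>\<B>. X \<inter> B \<noteq> {})"
proof -
  obtain N E \<chi> where tree: "itree (N :: nat set) E" and bag: "\<forall>t\<in>N. \<chi> t \<subseteq> V \<and> P (\<chi> t)"
    and edge: "\<forall>u\<in>V. \<forall>v\<in>V. (u, v) \<in> R \<longrightarrow> (\<exists>t\<in>N. u \<in> \<chi> t \<and> v \<in> \<chi> t)"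
    and node: "\<forall>v\<in>V. conn E {t\<in>N. v \<in> \<chi> t}"
    by (rule tdecE[OF assms(1)])
  \<comment> \<open>The nodes whose bags meet a connected set form a subtree: a walk in
    \<open>X\<close> is traced through the subtrees of its vertices, consecutive ones sharing a bag.
    Touching sets give intersecting subtrees, so the Helly property applies.\<close>
  let ?S = "\<lambda>X. {t\<in>N. \<chi> t \<inter> X \<noteq> {}}"
  have "\<exists>t\<in>N. \<forall>S\<in>?S ` \<B>. t \<in> S"
  proof (rule itree_helly[OF tree])
    fix S assume "S \<in> ?S ` \<B>"
    then obtain X where X: "X \<in> \<B>" "S = ?S X" by auto
    have XV: "X \<subseteq> V" and "conn R X" using B X(1) by auto
    have same: "(a, b) \<in> rtrancl_on S E" if "a \<in> N" "b \<in> N" "x \<in> X" "x \<in> \<chi> a" "x \<in> \<chi> b" for a b x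
    proof -
      have "conn E {t\<in>N. x \<in> \<chi> t}" using node that XV by auto
      then have "(a, b) \<in> rtrancl_on {t\<in>N. x \<in> \<chi> t} E" using that by (auto simp: conn_def)
      moreover have "{t\<in>N. x \<in> \<chi> t} \<subseteq> S" using that X(2) by auto
      ultimately show ?thesis using rtrancl_on_mono[of E E, OF subset_refl] by blast
    qed
    have reach: "(a, b) \<in> rtrancl_on S E"
      if "(x, y) \<in> rtrancl_on X R" "a \<in> N" "x \<in> \<chi> a" "b \<in> N" "y \<in> \<chi> b" for a b x y
      using that
    proof (induction arbitrary: b rule: rtrancl_on_induct)
      case base
      then show ?case using same by blast
    next
      case (step y z)
      then obtain c where c: "c \<in> N" "y \<in> \<chi> c" "z \<in> \<chi> c" using edge XV by blast
      then have "(a, c) \<in> rtrancl_on S E" using step by blast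
      moreover have "(c, b) \<in> rtrancl_on S E" using same c step by blast
      ultimately show ?case by (rule rtrancl_on_trans)
    qed
    obtain x where "x \<in> X" using \<open>conn R X\<close> by (auto simp: conn_def)
    then have "S \<noteq> {}" using node XV X(2) by (fastforce simp: conn_def)
    moreover have "(a, b) \<in> rtrancl_on S E" if ab: "a \<in> S" "b \<in> S" for a b
    proof -
      obtain x y where "x \<in> X" "y \<in> X" "x \<in> \<chi> a" "y \<in> \<chi> b" using ab X(2) by auto
      then show ?thesis using reach[of x y a b] \<open>conn R X\<close> ab X(2) unfolding conn_def by blast
    qed
    ultimately show "S \<subseteq> N \<and> conn E S" using X(2) by (auto simp: conn_def)
  next
    fix S S' assume "S \<in> ?S ` \<B>" "S' \<in> ?S ` \<B>"
    then obtain X Y where XY: "X \<in> \<B>" "Y \<in> \<B>" "S = ?S X" "S' = ?S Y" by auto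
    then obtain a b where ab: "a \<in> X" "b \<in> Y" "a = b \<or> (a, b) \<in> R" using T unfolding touching_def by blast
    have V: "a \<in> V" "b \<in> V" using ab B XY by blast+
    have "\<exists>t\<in>N. a \<in> \<chi> t \<and> b \<in> \<chi> t"
    proof (cases "a = b")
      case True
      then show ?thesis using node V unfolding conn_def by fastforce
    next
      case False
      then show ?thesis using edge V ab by blast
    qed
    then show "S \<inter> S' \<noteq> {}" using XY ab by blast
  qed
  then obtain t where "t \<in> N" "\<forall>X\<in>\<B>. t \<in> ?S X" by auto
  then show ?thesis using bag by (intro exI[of _ "\<chi> t"]) auto
qed

lemma tdec_join:
  assumes "tdec R A P" "tdec R B P" "A \<inter> B = {}" "\<And>a b. a \<in> A \<Longrightarrow> b \<in> B \<Longrightarrow> (a, b) \<notin> R \<and> (b, a) \<notin> R"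
  shows "tdec R (A \<union> B) P"
proof -
  obtain N1 E1 \<chi>1 where t1: "itree (N1 :: nat set) E1" and b1: "\<forall>t\<in>N1. \<chi>1 t \<subseteq> A \<and> P (\<chi>1 t)"
    and e1: "\<forall>u\<in>A. \<forall>v\<in>A. (u, v) \<in> R \<longrightarrow> (\<exists>t\<in>N1. u \<in> \<chi>1 t \<and> v \<in> \<chi>1 t)"
    and n1: "\<forall>v\<in>A. conn E1 {t\<in>N1. v \<in> \<chi>1 t}"
    by (rule tdecE[OF assms(1)])
  obtain N2 E2 \<chi>2 where t2: "itree (N2 :: nat set) E2" and b2: "\<forall>t\<in>N2. \<chi>2 t \<subseteq> B \<and> P (\<chi>2 t)"
    and e2: "\<forall>u\<in>B. \<forall>v\<in>B. (u, v) \<in> R \<longrightarrow> (\<exists>t\<in>N2. u \<in> \<chi>2 t \<and> v \<in> \<chi>2 t)"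
    and n2: "\<forall>v\<in>B. conn E2 {t\<in>N2. v \<in> \<chi>2 t}"
    by (rule tdecE[OF assms(2)])
  \<comment> \<open>Renaming nodes to even and odd numbers makes the two trees disjoint inside
    \<open>nat\<close>, the node type fixed in \<open>tdec\<close>.\<close>
  let ?f = "\<lambda>n. 2 * n :: nat" and ?g = "\<lambda>n. Suc (2 * n)"
  have inj: "inj ?f" "inj ?g" by (auto simp: inj_def)
  have disj: "?f ` N1 \<inter> ?g ` N2 = {}"
  proof -
    have "2 * m \<noteq> Suc (2 * k)" for m k :: nat by presburger
    then show ?thesis by auto
  qed
  obtain E where E: "itree (?f ` N1 \<union> ?g ` N2) E" "map_prod ?f ?f ` E1 \<subseteq> E" "map_prod ?g ?g ` E2 \<subseteq> E"
    using itree_join[OF itree_map[OF t2 inj(2)] itree_map[OF t1 inj(1)] disj] by auto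
  define \<chi> where "\<chi> t = (if even t then \<chi>1 (t div 2) else \<chi>2 (t div 2))" for t
  have \<chi>: "\<chi> (?f t) = \<chi>1 t" "\<chi> (?g t) = \<chi>2 t" for t by (auto simp: \<chi>_def)
  let ?N = "?f ` N1 \<union> ?g ` N2"
  have "conn E {t\<in>?N. v \<in> \<chi> t}" if v: "v \<in> A \<union> B" for v
  proof (cases "v \<in> A")
    case True
    then have "v \<notin> \<chi>2 t" if "t \<in> N2" for t using b2 assms(3) that by blast
    then have "{t\<in>?N. v \<in> \<chi> t} = ?f ` {t\<in>N1. v \<in> \<chi>1 t}"
      by (auto simp: \<chi>)
    then show ?thesis using True n1 E(2) conn_image[of E1 _ ?f] conn_mono by metis
  next
    case False
    then have "v \<notin> \<chi>1 t" if "t \<in> N1" for t using b1 that by blast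
    then have "{t\<in>?N. v \<in> \<chi> t} = ?g ` {t\<in>N2. v \<in> \<chi>2 t}"
      by (auto simp: \<chi>)
    then show ?thesis using False v n2 E(3) conn_image[of E2 _ ?g] conn_mono by (metis UnE)
  qed
  moreover have "\<exists>t\<in>?N. u \<in> \<chi> t \<and> v \<in> \<chi> t" if "u \<in> A \<union> B" "v \<in> A \<union> B" "(u, v) \<in> R" for u v
  proof (cases "u \<in> A")
    case True
    then have "v \<in> A" using that assms(4) by blast
    then show ?thesis using e1 that(3) True \<chi> by (metis UnI1 imageI)
  next
    case False
    then have "u \<in> B" "v \<in> B" using that assms(4) by blast+
    then show ?thesis using e2 that(3) \<chi> by (metis UnI2 imageI)
  qed
  moreover have "\<chi> t \<subseteq> A \<union> B \<and> P (\<chi> t)" if "t \<in> ?N" for t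
    using that
  proof
    assume "t \<in> ?f ` N1"
    then obtain m where "t = 2 * m" "m \<in> N1" by blast
    then show ?thesis using b1 \<chi>(1) by (simp add: le_supI1)
  next
    assume "t \<in> ?g ` N2"
    then obtain m where "t = Suc (2 * m)" "m \<in> N2" by blast
    then show ?thesis using b2 \<chi>(2) by (simp add: le_supI2)
  qed
  ultimately show ?thesis using E(1) by (intro tdecI[of ?N E \<chi>]) blast+
qed

text \<open>With \<open>X\<close> in every bag, its vertices occupy the whole tree, so every edge at
  \<open>X\<close> is covered.\<close>

lemma tdec_add:
  assumes "tdec R V P" "\<And>B. B \<subseteq> V \<Longrightarrow> P B \<Longrightarrow> Q (B \<union> X)" "sym R"
  shows "tdec R (V \<union> X) Q"
proof -
  obtain N E \<chi> where tree: "itree (N :: nat set) E" and bag: "\<forall>t\<in>N. \<chi> t \<subseteq> V \<and> P (\<chi> t)"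
    and edge: "\<forall>u\<in>V. \<forall>v\<in>V. (u, v) \<in> R \<longrightarrow> (\<exists>t\<in>N. u \<in> \<chi> t \<and> v \<in> \<chi> t)"
    and node: "\<forall>v\<in>V. conn E {t\<in>N. v \<in> \<chi> t}"
    by (rule tdecE[OF assms(1)])
  let ?\<chi> = "\<lambda>t. \<chi> t \<union> X"
  have ne: "\<exists>t\<in>N. v \<in> ?\<chi> t" if "v \<in> V \<union> X" for v
    using that node itree_conn[OF tree] unfolding conn_def by blast
  have "conn E {t\<in>N. v \<in> ?\<chi> t}" if "v \<in> V \<union> X" for v
  proof (cases "v \<in> X")
    case True
    then show ?thesis using itree_conn[OF tree] by simp
  next
    case False
    then show ?thesis using node that by simp
  qed
  moreover have "\<exists>t\<in>N. u \<in> ?\<chi> t \<and> v \<in> ?\<chi> t" if "u \<in> V \<union> X" "v \<in> V \<union> X" "(u, v) \<in> R" for u v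
    using edge that ne[of u] ne[of v] by (metis UnCI UnE)
  ultimately show ?thesis 
    using tree bag assms(2) by (intro tdecI[of N E ?\<chi>]) auto
qed

lemma tdec_mono: "tdec R V P \<Longrightarrow> (\<And>B. B \<subseteq> V \<Longrightarrow> P B \<Longrightarrow> Q B) \<Longrightarrow> tdec R V Q"
  by (rule tdecE, assumption, rule tdecI) auto

section \<open>Passing between digraphs and relations\<close>

lemma conn_Int: "conn (R \<inter> S \<times> S) S \<longleftrightarrow> conn R S"
proof -
  have "rtrancl_on S (R \<inter> S \<times> S) = rtrancl_on S R"
  proof (intro equalityI subsetI)
    fix x assume "x \<in> rtrancl_on S R"
    then obtain a b where x: "x = (a, b)" "(a, b) \<in> rtrancl_on S R" by (cases x) auto
    from x(2) have "(a, b) \<in> rtrancl_on S (R \<inter> S \<times> S)"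
    proof (induction rule: rtrancl_on_induct)
      case (step y z)
      then have "(y, z) \<in> R \<inter> S \<times> S" by blast
      with step show ?case by (meson rtrancl_on_into_rtrancl_on)
    qed simp
    then show "x \<in> rtrancl_on S (R \<inter> S \<times> S)" by (simp add: x)
  next
    fix x assume "x \<in> rtrancl_on S (R \<inter> S \<times> S)"
    then show "x \<in> rtrancl_on S R"
      using rtrancl_on_mono[of "R \<inter> S \<times> S" R S S] by (cases x) auto
  qed
  then show ?thesis by (simp add: conn_def)
qed

lemma symcl_sym: "sym R \<Longrightarrow> R\<^sup>s = R"
  by (auto simp: symcl_def sym_def)

lemma arcs_ends_induce: "arcs_ends (G \<restriction> S) = arcs_ends G \<inter> S \<times> S"
  by (auto simp: arcs_ends_conv)

lemma connected_iff_conn: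
  "sym (arcs_ends T) \<Longrightarrow> Digraph_Component.connected T \<longleftrightarrow> conn (arcs_ends T) (verts T)"
  by (simp add: connected_conv conn_def symcl_sym)

lemma connected_induce_iff_conn:
  assumes "sym (arcs_ends T)"
  shows "Digraph_Component.connected (T \<restriction> S) \<longleftrightarrow> conn (arcs_ends T) S"
proof -
  have "sym (arcs_ends (T \<restriction> S))"
    using assms by (auto simp: arcs_ends_induce sym_def)
  then show ?thesis by (simp add: connected_iff_conn arcs_ends_induce conn_Int)
qed

text \<open>A maximal vertex set inducing a leaf-generated tree is everything: connectedness
  supplies an outside neighbour \<open>l\<close>, and a second neighbour of \<open>l\<close> in the
  set would close a cycle along a path inside it.\<close>

lemma undirected_tree_imp_itree:
  assumes "undirected_tree T"
  shows "itree (verts T) (arcs_ends T)"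
proof -
  let ?R = "arcs_ends T"
  have "graph T" and con: "Digraph_Component.connected T"
    and acyc: "\<And>p. pre_digraph.cycle T p \<Longrightarrow> length p < 3"
    using assms unfolding undirected_tree_def by force+
  then interpret graph T by simp
  have symR: "sym ?R" using sym_arcs by (simp add: symmetric_def)
  have conR: "conn ?R (verts T)" using con connected_iff_conn[OF symR] by simp
  define Z where "Z = {S. S \<subseteq> verts T \<and> itree S (?R \<inter> S \<times> S)}"
  have irr: "(x, x) \<notin> ?R" for x using adj_not_same by blast
  obtain r where "r \<in> verts T" using conR by (auto simp: conn_def)
  moreover have "?R \<inter> {r} \<times> {r} = {}" using irr by auto
  ultimately have "{r} \<in> Z" using itree_single[of r] by (auto simp: Z_def)
  moreover have "finite Z" by (rule finite_subset[of _ "Pow (verts T)"]) (auto simp: Z_def)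
  ultimately obtain S where SZ: "S \<in> Z" and max: "\<And>S'. S' \<in> Z \<Longrightarrow> S \<subseteq> S' \<Longrightarrow> S' = S"
    using finite_has_maximal2[of Z "{r}"] by metis
  have S: "S \<subseteq> verts T" "itree S (?R \<inter> S \<times> S)" using SZ by (auto simp: Z_def)
  have conS: "conn ?R S" using itree_conn[OF S(2)] by (simp add: conn_Int)
  have "S = verts T"
  proof (rule ccontr)
    assume ne: "S \<noteq> verts T"
    obtain x where x: "x \<in> S" using conS by (auto simp: conn_def)
    obtain y where y: "y \<in> verts T" "y \<notin> S" using ne S(1) by blast
    have "(x, y) \<in> rtrancl_on (verts T) ?R" using conR x y S(1) by (auto simp: conn_def)
    then have "y \<in> S \<or> (\<exists>p l. p \<in> S \<and> l \<notin> S \<and> (p, l) \<in> ?R)"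
      by (induction rule: rtrancl_on_induct) (use x in blast)+
    then obtain p l where pl: "p \<in> S" "l \<notin> S" "(p, l) \<in> ?R" using y by blast
    have lp: "(l, p) \<in> ?R" using pl symR by (meson symD)
    have lV: "l \<in> verts T" using pl(3) by auto
    have uniq: "p' = p" if p': "p' \<in> S" "(p', l) \<in> ?R" for p'
    proof (rule ccontr)
      assume "p' \<noteq> p"
      interpret S: wf_digraph "T \<restriction> S" by (rule wellformed_induce_subgraph)
      have "(p, p') \<in> rtrancl_on S ?R" using conS pl p' by (auto simp: conn_def)
      then have "(p, p') \<in> rtrancl_on S (?R \<inter> S \<times> S)"
        using conS pl p' conn_Int[of ?R S] by (auto simp: conn_def)
      then have "p \<rightarrow>\<^sup>*\<^bsub>T \<restriction> S\<^esub> p'" by (simp add: reachable_def arcs_ends_induce)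
      then obtain w where w: "S.awalk p w p'" by (auto simp: S.reachable_awalk)
      then have "S.apath p (S.awalk_to_apath w) p'" by (rule S.apath_awalk_to_apath)
      then obtain q where q: "S.apath p q p'" by blast
      have awq: "S.awalk p q p'" using q by (simp add: S.apath_def)
      \<comment> \<open>Walk predicates depend only on \<open>tail\<close> and \<open>head\<close>,
        which the induced subgraph inherits.\<close>
      have cas: "pre_digraph.cas (T \<restriction> S) u es v = cas u es v" for u es v
        by (induction es arbitrary: u) (simp_all add: S.cas.simps cas.simps)
      have av: "pre_digraph.awalk_verts (T \<restriction> S) u es = awalk_verts u es" for u es
        by (induction es arbitrary: u) (simp_all add: S.awalk_verts.simps)
      have aw: "awalk p q p'" using awq S(1) by (auto simp: S.awalk_def awalk_def cas)
      have dist: "distinct (awalk_verts p q)" using q by (simp add: S.apath_def av)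
      have vS: "set (awalk_verts p q) \<subseteq> S"
      proof
        fix v assume "v \<in> set (awalk_verts p q)"
        then have "v \<in> set (S.awalk_verts p q)" by (simp add: av)
        from S.awalk_verts_in_verts[OF _ _ this] show "v \<in> S" using awq by (simp add: S.awalk_def)
      qed
      obtain e where e: "e \<in> arcs T" "tail T e = l" "head T e = p" using lp by auto
      obtain f where f: "f \<in> arcs T" "tail T f = p'" "head T f = l" using p'(2) by auto
      have aw2: "awalk l ([e] @ q @ [f]) l"
        using aw e f by (auto simp: awalk_simps)
      moreover have "tl (awalk_verts l ([e] @ q @ [f])) = awalk_verts p q @ [l]"
      proof -
        have "awalk_verts u (q' @ [f]) = awalk_verts u q' @ [l]" if "cas u q' p'" for u q'
          using that f by (induction q' arbitrary: u) auto
        then have "awalk_verts p (q @ [f]) = awalk_verts p q @ [l]"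
          using aw by (simp add: awalk_def)
        then show ?thesis using e by simp
      qed
      moreover have "l \<notin> set (awalk_verts p q)" using vS pl(2) by blast
      ultimately have "pre_digraph.cycle T ([e] @ q @ [f])" using dist by (auto simp: cycle_def)
      \<comment> \<open>Distinct ends force a nonempty path, so the cycle has at least three
        arcs.\<close>
      moreover have "q \<noteq> []" using aw \<open>p' \<noteq> p\<close> by (auto simp: awalk_Nil_iff)
      ultimately show False using acyc[of "[e] @ q @ [f]"] by (cases q) auto
    qed
    have uniq2: "p' = p" if p': "p' \<in> S" "(l, p') \<in> ?R" for p'
      using uniq[OF p'(1)] symD[OF symR p'(2)] by simp
    have "?R \<inter> (insert l S) \<times> (insert l S) = insert (p, l) (insert (l, p) (?R \<inter> S \<times> S))"
      by (auto simp: irr pl lp intro: uniq uniq2)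
    then have "insert l S \<in> Z"
      using itree_leaf[OF S(2) pl(1,2)] S(1) lV by (simp add: Z_def)
    then show False using max[of "insert l S"] pl(2) by blast
  qed
  moreover have "?R \<inter> verts T \<times> verts T = ?R" using adj_in_verts by fast
  ultimately show ?thesis using S(2) by simp
qed

text \<open>
  The vertex sequence of a cycle of length at least 3. In an inductively generated tree, the vertex
  of the sequence inserted last would have two distinct neighbours inserted before it.
\<close>

definition closed_seq :: "('a \<times> 'a) set \<Rightarrow> 'a list \<Rightarrow> bool" where
  "closed_seq E ws \<longleftrightarrow> length ws \<ge> 3 \<and> distinct ws \<and>
     (\<forall>i<length ws. (ws ! i, ws ! (Suc i mod length ws)) \<in> E)"

lemma itree_no_closed_seq: "itree N E \<Longrightarrow> \<not> closed_seq E ws"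
proof (induction rule: itree.induct)
  case (itree_single t)
  show ?case unfolding closed_seq_def by (metis empty_iff less_le_trans zero_less_numeral)
next
  case (itree_leaf N E p l)
  let ?E = "insert (p, l) (insert (l, p) E)" and ?m = "length ws"
  have EN: "E \<subseteq> N \<times> N" by (rule itree_edges[OF itree_leaf(1)])
  show ?case
  proof
    assume "closed_seq ?E ws"
    then have ws: "?m \<ge> 3" "distinct ws" and e: "\<And>i. i < ?m \<Longrightarrow> (ws ! i, ws ! (Suc i mod ?m)) \<in> ?E"
      by (auto simp: closed_seq_def)
    have bound: "Suc i mod ?m < ?m" for i using ws(1) by (intro mod_less_divisor) auto
    show False
    proof (cases "l \<in> set ws")
      case False
      have "ws ! i \<noteq> l" if "i < ?m" for i using False nth_mem[OF that] by auto
      then have "closed_seq E ws" using ws e bound unfolding closed_seq_def by blast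
      then show False using itree_leaf.IH by simp
    next
      case True
      then obtain i where i: "i < ?m" "ws ! i = l" by (auto simp: in_set_conv_nth)
      \<comment> \<open>\<open>j\<close> is the cyclic predecessor of \<open>i\<close>. Both cyclic
        neighbours of \<open>l\<close> would have to be \<open>p\<close>, although length at least 3
        keeps them distinct.\<close>
      define j where "j = (if i = 0 then ?m - 1 else i - 1)"
      have j: "j < ?m" "Suc j mod ?m = i" using i(1) by (auto simp: j_def)
      have "ws ! (Suc i mod ?m) = p \<or> ws ! (Suc i mod ?m) = l"
        using e[OF i(1)] i(2) EN itree_leaf(3) by auto
      moreover have "ws ! j = p \<or> ws ! j = l" using e[OF j(1)] j(2) i(2) EN itree_leaf(3) by auto
      moreover have "j \<noteq> i" using ws(1) i(1) by (auto simp: j_def)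
      moreover have "Suc i mod ?m \<noteq> i" using ws(1) i(1) by (cases "Suc i = ?m") auto
      ultimately have "ws ! (Suc i mod ?m) = ws ! j"
        using i j(1) bound nth_eq_iff_index_eq[OF ws(2)] by metis
      then have "Suc i mod ?m = j" using nth_eq_iff_index_eq[OF ws(2) bound j(1)] by simp
      then show False using ws(1) i(1) unfolding j_def
        by (cases "Suc i = ?m"; cases "i = 0") auto
    qed
  qed
qed

lemma itree_imp_undirected_tree:
  assumes "itree N E"
  shows "undirected_tree (with_proj \<lparr>pverts = N, parcs = E\<rparr>)"
proof -
  let ?T = "\<lparr>pverts = N, parcs = E\<rparr>"
  have EN: "E \<subseteq> N \<times> N" and symE: "sym E" and fin: "finite N"
    using itree_edges[OF assms] itree_sym[OF assms] itree_finite[OF assms] by auto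
  interpret T: pair_graph ?T
  proof
    show "finite (parcs ?T)" using EN fin by (auto intro: finite_subset)
    show "symmetric (with_proj ?T)" using symE by (simp add: symmetric_def)
  qed (use EN fin itree_irrefl[OF assms] in auto)
  have con: "Digraph_Component.connected (with_proj ?T)"
    using itree_conn[OF assms] symE by (simp add: connected_iff_conn)
  have False if p: "pre_digraph.cycle (with_proj ?T) p" "length p \<ge> 3" for p
  proof -
    \<comment> \<open>The heads of the arcs list the vertices of the closed walk with its base point
      once, at the end; this is the list that \<open>cycle\<close> requires to be distinct.\<close>
    let ?ws = "map snd p" and ?m = "length p"
    obtain u where u: "T.awalk u p u" "distinct (tl (pawalk_verts u p))" "p \<noteq> []"
      using p(1) by (auto simp: T.cycle_def)
    have tl: "tl (pawalk_verts v q) = map snd q" if "pcas v q w" for v q w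
      using that
    proof (induction q arbitrary: v)
      case (Cons e q)
      then show ?case by (cases q) auto
    qed simp
    have cas: "pcas u p u" and pE: "set p \<subseteq> E" using u(1) by (auto simp: T.awalk_def)
    have fst: "fst (q ! Suc i) = snd (q ! i)" if "pcas v q w" "Suc i < length q" for v q w i
      using that
    proof (induction q arbitrary: v i)
      case (Cons e q)
      then show ?case by (cases i; cases q) auto
    qed simp
    have hd: "fst (p ! 0) = u" using cas u(3) by (cases p) auto
    have lst: "snd (q ! (length q - 1)) = w" if "pcas v q w" "q \<noteq> []" for v q w
      using that
    proof (induction q arbitrary: v)
      case (Cons e q)
      then show ?case by (cases q) auto
    qed simp
    have "(?ws ! i, ?ws ! (Suc i mod ?m)) \<in> E" if i: "i < ?m" for i
    proof (cases "Suc i = ?m")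
      case True
      then have "snd (p ! i) = u" using lst[OF cas u(3)] by (metis diff_Suc_1)
      then have "(snd (p ! i), snd (p ! 0)) = p ! 0" using hd by (simp add: prod_eq_iff)
      moreover have "p ! 0 \<in> E" using pE u(3) nth_mem[of 0 p] by auto
      ultimately show ?thesis using True u(3) i by simp
    next
      case False
      then have "Suc i < ?m" using i by simp
      then have "(snd (p ! i), snd (p ! Suc i)) = p ! Suc i" using fst[OF cas] by (simp add: prod_eq_iff)
      moreover have "p ! Suc i \<in> E" using pE nth_mem[OF \<open>Suc i < ?m\<close>] by blast
      ultimately show ?thesis using \<open>Suc i < ?m\<close> i by simp
    qed
    then have "closed_seq E ?ws" using p(2) u(2) tl[OF cas] by (simp add: closed_seq_def)
    then show False using itree_no_closed_seq[OF assms] by simp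
  qed
  then have "\<not> (\<exists>p. pre_digraph.cycle (with_proj ?T) p \<and> length p \<ge> 3)" by (intro notI, elim exE conjE)
  then show ?thesis unfolding undirected_tree_def
    by (intro conjI T.pair_graphD_graph con)
qed

lemma tree_decomposition_imp_tdec:
  fixes T :: "nat pair_pre_digraph"
  assumes "graph G" "tree_decomposition G (with_proj T) \<chi>" "\<And>t. t \<in> pverts T \<Longrightarrow> P (\<chi> t)"
  shows "tdec (arcs_ends G) (verts G) P"
proof (rule tdecI[of "pverts T" "parcs T" \<chi>])
  have it: "itree (pverts T) (parcs T)"
    using assms(2) undirected_tree_imp_itree[of "with_proj T"] by (simp add: tree_decomposition_def)
  then show "itree (pverts T) (parcs T)" .
  show "\<forall>t\<in>pverts T. \<chi> t \<subseteq> verts G \<and> P (\<chi> t)"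
    using assms(2,3) by (simp add: tree_decomposition_def)
  show "\<forall>u\<in>verts G. \<forall>v\<in>verts G. (u, v) \<in> arcs_ends G \<longrightarrow> (\<exists>t\<in>pverts T. u \<in> \<chi> t \<and> v \<in> \<chi> t)"
    using assms(2) by (simp add: tree_decomposition_def)
  show "\<forall>v\<in>verts G. conn (parcs T) {t \<in> pverts T. v \<in> \<chi> t}"
    using assms(2) connected_induce_iff_conn[of "with_proj T"] itree_sym[OF it]
    by (simp add: tree_decomposition_def)
qed

lemma tdec_imp_tree_decomposition:
  assumes "graph G" "tdec (arcs_ends G) (verts G) P"
  shows "\<exists>(T :: nat pair_pre_digraph) \<chi>. tree_decomposition G (with_proj T) \<chi> \<and>
    finite (pverts T) \<and> pverts T \<noteq> {} \<and> (\<forall>t\<in>pverts T. \<chi> t \<subseteq> verts G \<and> P (\<chi> t))"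
proof -
  interpret graph G by fact
  obtain N :: "nat set" and E \<chi> where tree: "itree N E" and bag: "\<forall>t\<in>N. \<chi> t \<subseteq> verts G \<and> P (\<chi> t)"
    and edge: "\<forall>u\<in>verts G. \<forall>v\<in>verts G. (u, v) \<in> arcs_ends G \<longrightarrow> (\<exists>t\<in>N. u \<in> \<chi> t \<and> v \<in> \<chi> t)"
    and node: "\<forall>v\<in>verts G. conn E {t\<in>N. v \<in> \<chi> t}"
    by (rule tdecE[OF assms(2)])
  let ?T = "\<lparr>pverts = N, parcs = E\<rparr>"
  have "tree_decomposition G (with_proj ?T) \<chi>"
    unfolding tree_decomposition_def
  proof (intro conjI ballI allI impI)
    show "undirected_tree (with_proj ?T)" by (rule itree_imp_undirected_tree[OF tree])
    show "\<chi> t \<subseteq> verts G" if "t \<in> verts (with_proj ?T)" for t using that bag by simp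
    show "\<exists>t\<in>verts (with_proj ?T). {u, v} \<subseteq> \<chi> t" if "u \<rightarrow>\<^bsub>G\<^esub> v" for u v
    proof -
      have "u \<in> verts G" "v \<in> verts G" using that by auto
      then show ?thesis using edge that by simp
    qed
    show "Digraph_Component.connected (with_proj ?T \<restriction> {t \<in> verts (with_proj ?T). v \<in> \<chi> t})"
      if "v \<in> verts G" for v
      using node that connected_induce_iff_conn[of "with_proj ?T"] itree_sym[OF tree] by simp
  qed
  then show ?thesis using itree_finite[OF tree] itree_conn[OF tree] bag
    by (intro exI[of _ ?T] exI[of _ \<chi>]) (auto simp: conn_def)
qed

section \<open>The numerical parameters in terms of \<open>tdec\<close>\<close>

lemma independence_number_le_iff:
  assumes "graph G" "X \<subseteq> verts G"
  shows "independence_number (G \<restriction> X) \<le> k \<longleftrightarrow> alpha_le (arcs_ends G) k X"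
proof -
  interpret graph G by fact
  have finX: "finite X" using assms(2) finite_verts finite_subset by blast
  \<comment> \<open>\<open>independent_set\<close> compares distinct vertices only,
    \<open>indep\<close> also forbids loops; they agree because \<open>G\<close> is
    loop-free.\<close>
  have ind: "independent_set (G \<restriction> X) S \<longleftrightarrow> S \<subseteq> X \<and> (\<forall>u\<in>S. \<forall>v\<in>S. (u, v) \<notin> arcs_ends G)" for S
  proof -
    have "u \<noteq> v" if "(u, v) \<in> arcs_ends G" for u v using adj_not_same that by blast
    then show ?thesis unfolding independent_set_def arcs_ends_induce induce_subgraph_verts by blast
  qed
  let ?M = "{card S | S. independent_set (G \<restriction> X) S}"
  have "finite ?M"
    by (rule finite_subset[of _ "card ` Pow X"]) (use finX in \<open>auto simp: ind\<close>)
  moreover have "independent_set (G \<restriction> X) {}" by (simp add: independent_set_def)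
  then have "?M \<noteq> {}" by blast
  ultimately have "Max ?M \<le> k \<longleftrightarrow> (\<forall>m\<in>?M. m \<le> k)" by (rule Max_le_iff)
  also have "\<dots> \<longleftrightarrow> alpha_le (arcs_ends G) k X" unfolding alpha_le_def indep_def ind by blast
  finally show ?thesis unfolding independence_number_def .
qed

lemma clique_number_ge:
  assumes "graph G" "clique G K"
  shows "card K \<le> clique_number G"
proof -
  interpret graph G by fact
  have "{card K | K. clique G K} \<subseteq> card ` Pow (verts G)" by (auto simp: clique_def)
  then have "finite {card K | K. clique G K}" by (rule finite_subset) simp
  then show ?thesis unfolding clique_number_def using assms(2) by (auto intro!: Max_ge)
qed

lemma clique_number_le:
  assumes "graph G" "\<And>K. clique G K \<Longrightarrow> card K \<le> k"
  shows "clique_number G \<le> k"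
proof -
  interpret graph G by fact
  have "{card K | K. clique G K} \<subseteq> card ` Pow (verts G)" by (auto simp: clique_def)
  then have "finite {card K | K. clique G K}" by (rule finite_subset) simp
  moreover have "clique G {}" by (simp add: clique_def)
  ultimately show ?thesis unfolding clique_number_def using assms(2) by (subst Max_le_iff) auto
qed

text \<open>\<open>LEAST\<close> is attained because the decomposition with a single bag exists. The
  parameter \<open>f\<close> stands for the width and for the independence number.\<close>

lemma optimal_decomposition:
  fixes f :: "nat pair_pre_digraph \<Rightarrow> (nat \<Rightarrow> 'a set) \<Rightarrow> nat" and G :: "('a, 'b) pre_digraph"
  assumes "graph G"
  shows "\<exists>T \<chi>. tree_decomposition G (with_proj T) \<chi> \<and> finite (pverts T) \<and>
    f T \<chi> = (LEAST k. \<exists>T \<chi>. tree_decomposition G (with_proj T) \<chi> \<and> f T \<chi> = k)"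
proof -
  have "tdec (arcs_ends G) (verts G) (\<lambda>_. True)" by (rule tdec_trivial) simp
  then have "\<exists>k T \<chi>. tree_decomposition G (with_proj T) \<chi> \<and> f T \<chi> = k"
    using tdec_imp_tree_decomposition[OF assms] by blast
  then have "\<exists>T \<chi>. tree_decomposition G (with_proj T) \<chi> \<and>
      f T \<chi> = (LEAST k. \<exists>T \<chi>. tree_decomposition G (with_proj T) \<chi> \<and> f T \<chi> = k)"
    by (rule LeastI_ex)
  moreover have "finite (pverts T)" if "tree_decomposition G (with_proj T) \<chi>" for T :: "nat pair_pre_digraph" and \<chi>
    using that itree_finite[OF undirected_tree_imp_itree[of "with_proj T"]]
    by (simp add: tree_decomposition_def)
  ultimately show ?thesis by blast
qed

lemma treewidth_imp_tdec:
  assumes "graph G"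
  shows "tdec (arcs_ends G) (verts G) (\<lambda>B. card B \<le> Suc (treewidth G))"
proof -
  obtain T :: "nat pair_pre_digraph" and \<chi> where
    T: "tree_decomposition G (with_proj T) \<chi>" "finite (pverts T)" "width (with_proj T) \<chi> = treewidth G"
    using optimal_decomposition[OF assms, of "\<lambda>T. width (with_proj T)"] unfolding treewidth_def by blast
  have "card (\<chi> t) \<le> Suc (treewidth G)" if "t \<in> pverts T" for t
  proof -
    have "card (\<chi> t) \<le> Max ((\<lambda>t. card (\<chi> t)) ` pverts T)" using that T(2) by (intro Max_ge) auto
    then show ?thesis using T(3) unfolding width_def by simp
  qed
  then show ?thesis by (rule tree_decomposition_imp_tdec[OF assms T(1)])
qed

lemma tdec_imp_treewidth:
  assumes "graph G" "tdec (arcs_ends G) (verts G) (\<lambda>B. card B \<le> Suc k)"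
  shows "treewidth G \<le> k"
proof -
  obtain T :: "nat pair_pre_digraph" and \<chi> where
    T: "tree_decomposition G (with_proj T) \<chi>" "finite (pverts T)" "pverts T \<noteq> {}"
      "\<forall>t\<in>pverts T. \<chi> t \<subseteq> verts G \<and> card (\<chi> t) \<le> Suc k"
    using tdec_imp_tree_decomposition[OF assms] by blast
  have "Max ((\<lambda>t. card (\<chi> t)) ` pverts T) \<le> Suc k" using T(2-4) by (subst Max_le_iff) auto
  then have "width (with_proj T) \<chi> \<le> k" unfolding width_def by simp
  moreover have "treewidth G \<le> width (with_proj T) \<chi>"
    unfolding treewidth_def by (rule Least_le) (use T(1) in blast)
  ultimately show ?thesis by simp
qed

lemma tree_independence_number_imp_tdec:
  assumes "graph G"
  shows "tdec (arcs_ends G) (verts G) (alpha_le (arcs_ends G) (tree_independence_number G))"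
proof -
  obtain T :: "nat pair_pre_digraph" and \<chi> where
    T: "tree_decomposition G (with_proj T) \<chi>" "finite (pverts T)"
      "decomposition_independence_number G (with_proj T) \<chi> = tree_independence_number G"
    using optimal_decomposition[OF assms, of "\<lambda>T. decomposition_independence_number G (with_proj T)"]
    unfolding tree_independence_number_def by blast
  have "alpha_le (arcs_ends G) (tree_independence_number G) (\<chi> t)" if t: "t \<in> pverts T" for t
  proof -
    have "independence_number (G \<restriction> \<chi> t) \<le> tree_independence_number G"
      unfolding T(3)[symmetric] decomposition_independence_number_def
      using t T(2) by (intro Max_ge) auto
    moreover have "\<chi> t \<subseteq> verts G" using T(1) t by (simp add: tree_decomposition_def)
    ultimately show ?thesis using independence_number_le_iff[OF assms] by blast
  qed
  then show ?thesis by (rule tree_decomposition_imp_tdec[OF assms T(1)])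
qed

lemma tdec_imp_tree_independence_number:
  assumes "graph G" "tdec (arcs_ends G) (verts G) (alpha_le (arcs_ends G) k)"
  shows "tree_independence_number G \<le> k"
proof -
  obtain T :: "nat pair_pre_digraph" and \<chi> where
    T: "tree_decomposition G (with_proj T) \<chi>" "finite (pverts T)" "pverts T \<noteq> {}"
      "\<forall>t\<in>pverts T. \<chi> t \<subseteq> verts G \<and> alpha_le (arcs_ends G) k (\<chi> t)"
    using tdec_imp_tree_decomposition[OF assms] by blast
  have "\<forall>t\<in>pverts T. independence_number (G \<restriction> \<chi> t) \<le> k"
    using T(4) independence_number_le_iff[OF assms(1)] by blast
  then have "decomposition_independence_number G (with_proj T) \<chi> \<le> k"
    using T(2,3) by (simp add: decomposition_independence_number_def)
  moreover have "tree_independence_number G \<le> decomposition_independence_number G (with_proj T) \<chi>"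
    unfolding tree_independence_number_def by (rule Least_le) (use T(1) in blast)
  ultimately show ?thesis by simp
qed

section \<open>Graphs without an induced biclique\<close>

text \<open>Pick a vertex, delete its closed neighbourhood of at most \<open>d\<close> vertices,
  repeat.\<close>

lemma greedy_indep:
  assumes "finite V" "sym R" "\<And>x. (x, x) \<notin> R"
    and "\<And>v. v \<in> V \<Longrightarrow> card {u\<in>V. u = v \<or> (v, u) \<in> R} \<le> d"
  shows "\<exists>J\<subseteq>V. indep R J \<and> card V \<le> d * card J"
  using assms(1,4)
proof (induction "card V" arbitrary: V rule: less_induct)
  case less
  show ?case
  proof (cases "V = {}")
    case True
    then show ?thesis by (intro exI[of _ "{}"]) (simp add: indep_def)
  next
    case False
    then obtain v where v: "v \<in> V" by blast
    let ?N = "{u\<in>V. u = v \<or> (v, u) \<in> R}"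
    let ?W = "V - ?N"
    have sub: "?W \<subset> V" using v by blast
    have "card {u\<in>?W. u = x \<or> (x, u) \<in> R} \<le> d" if "x \<in> ?W" for x
    proof -
      have "card {u\<in>?W. u = x \<or> (x, u) \<in> R} \<le> card {u\<in>V. u = x \<or> (x, u) \<in> R}"
        by (rule card_mono) (use less.prems(1) in auto)
      then show ?thesis using less.prems(2)[of x] that by simp
    qed
    then obtain J where J: "J \<subseteq> ?W" "indep R J" "card ?W \<le> d * card J"
      using less.hyps[of ?W] psubset_card_mono[OF less.prems(1) sub] less.prems(1) by auto
    have "indep R (insert v J)"
      by (rule indep_insertI[OF assms(2,3) J(2)]) (use J(1) in blast)
    moreover have "finite J" "v \<notin> J"
      using J(1) less.prems(1) finite_subset[of J V] v by blast+
    then have "card (insert v J) = Suc (card J)" by simp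
    moreover have "card V = card ?W + card ?N"
      using card_Diff_subset[of ?N V] card_mono[of V ?N] less.prems(1) by simp
    then have "card V \<le> d * Suc (card J)" using J(3) less.prems(2)[OF v] by simp
    moreover have "insert v J \<subseteq> V" using J(1) v by blast
    ultimately show ?thesis by metis
  qed
qed

text \<open>If some vertex has \<open>Suc w ^ t\<close> non-neighbours, recurse into them. Otherwise
  the complement has small degrees, and the greedy choice there finds a clique with more than
  \<open>w\<close> vertices. For fixed \<open>t\<close> the bound is polynomial in \<open>w\<close>,
  as the passage to treewidth needs.\<close>

lemma ramsey_indep:
  assumes "finite V" "sym R" "\<And>x. (x, x) \<notin> R"
    and "\<And>K. K \<subseteq> V \<Longrightarrow> cliq R K \<Longrightarrow> card K \<le> w" "Suc w ^ t \<le> card V"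
  shows "\<exists>J\<subseteq>V. indep R J \<and> card J = t"
  using assms(1,4,5)
proof (induction t arbitrary: V)
  case 0
  show ?case by (intro exI[of _ "{}"]) (simp add: indep_def)
next
  case (Suc t)
  let ?M = "\<lambda>v. {u\<in>V. u \<noteq> v \<and> (v, u) \<notin> R}"
  show ?case
  proof (cases "\<exists>v\<in>V. Suc w ^ t \<le> card (?M v)")
    case True
    then obtain v where v: "v \<in> V" "Suc w ^ t \<le> card (?M v)" by blast
    obtain J where J: "J \<subseteq> ?M v" "indep R J" "card J = t"
    proof -
      have "finite (?M v)" "\<And>K. K \<subseteq> ?M v \<Longrightarrow> cliq R K \<Longrightarrow> card K \<le> w"
        using Suc.prems(1,2) by auto
      then show ?thesis using Suc.IH[of "?M v"] v(2) that by blast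
    qed
    have "indep R (insert v J)"
      by (rule indep_insertI[OF assms(2,3) J(2)]) (use J(1) in blast)
    moreover have "finite J" "v \<notin> J"
      using J(1) Suc.prems(1) finite_subset[of J V] by blast+
    then have "card (insert v J) = Suc t" using J(3) by simp
    moreover have "insert v J \<subseteq> V" using J(1) v by blast
    ultimately show ?thesis by blast
  next
    case False
    let ?C = "{(u, v). u \<noteq> v \<and> (u, v) \<notin> R}"
    have "card {u\<in>V. u = v \<or> (v, u) \<in> ?C} \<le> Suc w ^ t" if v: "v \<in> V" for v
    proof -
      have "{u\<in>V. u = v \<or> (v, u) \<in> ?C} = insert v (?M v)" using v by auto
      moreover have "card (insert v (?M v)) = Suc (card (?M v))"
        using Suc.prems(1) by (subst card_insert_disjoint) auto
      ultimately show ?thesis using False v by (auto simp: not_le)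
    qed
    moreover have "sym ?C" using assms(2) by (auto simp: sym_def)
    ultimately obtain J where J: "J \<subseteq> V" "indep ?C J" "card V \<le> Suc w ^ t * card J"
      using greedy_indep[of V ?C "Suc w ^ t"] Suc.prems(1) by auto
    have "cliq R J" using J(2) by (auto simp: indep_def cliq_def)
    then have "card J \<le> w" using Suc.prems(2) J(1) by blast
    then have "Suc w ^ t * card J < Suc w ^ Suc t"
      using mult_strict_left_mono[of "card J" "Suc w" "Suc w ^ t"] by (simp add: mult.commute)
    then show ?thesis using J(3) Suc.prems(3) by linarith
  qed
qed

text \<open>
  The set \<open>Y\<close> is the union of \<open>N\<close> successive maximal independent sets, each of which dominates
  the vertices outside.
\<close>

lemma dominating_layers:
  assumes "finite V" "sym R" "\<And>x. (x, x) \<notin> R" "alpha_le R a V"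
  shows "\<exists>Y\<subseteq>V. card Y \<le> a * N \<and> (\<forall>v\<in>V - Y. N \<le> card {y\<in>Y. (v, y) \<in> R})"
proof (induction N)
  case 0
  show ?case by (intro exI[of _ "{}"]) simp
next
  case (Suc N)
  then obtain Y where Y: "Y \<subseteq> V" "card Y \<le> a * N" "\<And>v. v \<in> V - Y \<Longrightarrow> N \<le> card {y\<in>Y. (v, y) \<in> R}"
    by blast
  let ?Z = "{M. M \<subseteq> V - Y \<and> indep R M}"
  have "finite ?Z" using assms(1) by simp
  moreover have "{} \<in> ?Z" by (simp add: indep_def)
  ultimately obtain M where M: "M \<in> ?Z" and max: "\<And>M'. M' \<in> ?Z \<Longrightarrow> M \<subseteq> M' \<Longrightarrow> M' = M"
    using finite_has_maximal2[of ?Z "{}"] by metis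
  have finY: "finite Y" "finite M" using Y(1) M assms(1) finite_subset by blast+
  have "card M \<le> a" using M assms(4) unfolding alpha_le_def by blast
  then have "card (Y \<union> M) \<le> a * Suc N" using card_Un_le[of Y M] Y(2) by simp
  moreover have "Suc N \<le> card {y\<in>Y \<union> M. (v, y) \<in> R}" if v: "v \<in> V - (Y \<union> M)" for v
  proof -
    have "insert v M \<notin> ?Z" using max[of "insert v M"] v by blast
    then have "\<not> indep R (insert v M)" using v M by blast
    then obtain m where m: "m \<in> M" "(v, m) \<in> R"
      using indep_insertI[OF assms(2,3), of M v] M by blast
    have "insert m {y\<in>Y. (v, y) \<in> R} \<subseteq> {y\<in>Y \<union> M. (v, y) \<in> R}" using m by blast
    then have "card (insert m {y\<in>Y. (v, y) \<in> R}) \<le> card {y\<in>Y \<union> M. (v, y) \<in> R}"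
      by (rule card_mono[rotated]) (use finY in auto)
    moreover have "m \<notin> Y" using m M by blast
    ultimately show ?thesis using Y(3)[of v] v finY by simp
  qed
  ultimately show ?case using Y(1) M by (intro exI[of _ "Y \<union> M"]) auto
qed

text \<open>
  The Erdos-Hajnal property of the biclique. Every vertex outside the small set \<open>Y\<close> above sees
  an independent \<open>t\<close>-set in \<open>Y\<close>; if too many vertices see the same one, they contain an
  independent \<open>t\<close>-set themselves.
\<close>

theorem erdos_hajnal_bipartite:
  assumes "finite V" "sym R" "\<And>x. (x, x) \<notin> R" "alpha_le R a V"
    and clq: "\<And>K. K \<subseteq> V \<Longrightarrow> cliq R K \<Longrightarrow> card K \<le> w"
    and free: "\<And>A B. A \<subseteq> V \<Longrightarrow> B \<subseteq> V \<Longrightarrow> indep R A \<Longrightarrow> indep R B \<Longrightarrow> card A = t \<Longrightarrow> card B = t \<Longrightarrow>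
       \<not> A \<times> B \<subseteq> R"
  shows "card V \<le> a * Suc w ^ t + (a * Suc w ^ t) ^ t * Suc w ^ t"
proof -
  let ?N = "Suc w ^ t"
  obtain Y where Y: "Y \<subseteq> V" "card Y \<le> a * ?N" "\<And>v. v \<in> V - Y \<Longrightarrow> ?N \<le> card {y\<in>Y. (v, y) \<in> R}"
    using dominating_layers[OF assms(1-4), of ?N] by blast
  have finY: "finite Y" using Y(1) assms(1) finite_subset by blast
  have "\<exists>J. J \<subseteq> {y\<in>Y. (v, y) \<in> R} \<and> indep R J \<and> card J = t" if v: "v \<in> V - Y" for v
    by (rule ramsey_indep[OF _ assms(2,3) _ Y(3)[OF v]]) (use finY clq Y(1) in auto)
  then obtain f where f: "\<And>v. v \<in> V - Y \<Longrightarrow> f v \<subseteq> {y\<in>Y. (v, y) \<in> R} \<and> indep R (f v) \<and> card (f v) = t"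
    by metis
  let ?S = "{J. J \<subseteq> Y \<and> card J = t}"
  have finS: "finite ?S" using finY by simp
  have cardS: "card ?S \<le> (a * ?N) ^ t"
  proof (cases "t \<le> card Y")
    case True
    have "card ?S = card Y choose t" using finY by (rule n_subsets)
    also have "\<dots> \<le> card Y ^ t" using True by (rule binomial_le_pow)
    also have "\<dots> \<le> (a * ?N) ^ t" using Y(2) by (rule power_mono) simp
    finally show ?thesis .
  next
    case False
    have "?S = {}" using False card_mono[OF finY] by fastforce
    then show ?thesis by (metis card.empty zero_le)
  qed
  have fib: "card {v\<in>V - Y. f v = J} \<le> ?N" for J
  proof (rule ccontr)
    assume "\<not> card {v\<in>V - Y. f v = J} \<le> ?N"
    then have big: "?N \<le> card {v\<in>V - Y. f v = J}" by simp
    have "\<exists>B\<subseteq>{v\<in>V - Y. f v = J}. indep R B \<and> card B = t"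
      by (rule ramsey_indep[OF _ assms(2,3) _ big]) (use clq assms(1) in auto)
    then obtain B where B: "B \<subseteq> {v\<in>V - Y. f v = J}" "indep R B" "card B = t" by blast
    have "0 < card {v\<in>V - Y. f v = J}" using big by (rule less_le_trans[rotated]) simp
    then have "{v\<in>V - Y. f v = J} \<noteq> {}" using card_gt_0_iff by blast
    then obtain v0 where v0: "v0 \<in> V - Y" "f v0 = J" by blast
    then have J: "J \<subseteq> V" "indep R J" "card J = t" using f[of v0] Y(1) by auto
    have "(x, y) \<in> R" if "x \<in> B" "y \<in> J" for x y
    proof -
      have "x \<in> V - Y" "f x = J" using that(1) B(1) by auto
      then show ?thesis using f[of x] that(2) by blast
    qed
    then have "B \<times> J \<subseteq> R" by auto
    moreover have "B \<subseteq> V" using B(1) by auto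
    ultimately show False using free[OF _ J(1) B(2) J(2) B(3) J(3)] by blast
  qed
  have "V - Y = (\<Union>J\<in>?S. {v\<in>V - Y. f v = J})" using f by blast
  then have "card (V - Y) = card (\<Union>J\<in>?S. {v\<in>V - Y. f v = J})" by (rule arg_cong)
  also have "\<dots> \<le> (\<Sum>J\<in>?S. card {v\<in>V - Y. f v = J})" using finS by (rule card_UN_le)
  also have "\<dots> \<le> card ?S * ?N" 
    using sum_bounded_above[of ?S "\<lambda>J. card {v\<in>V - Y. f v = J}" ?N] fib by simp
  also have "\<dots> \<le> (a * ?N) ^ t * ?N" using cardS by simp
  finally have "card (V - Y) \<le> (a * ?N) ^ t * ?N" .
  moreover have "card V = card (V - Y) + card Y" using Y(1) assms(1) by (metis card_Diff_subset card_mono finY le_add_diff_inverse2)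
  ultimately show ?thesis using Y(2) by linarith
qed

text \<open>The edges of the biclique form a bramble, and a set meeting all of them contains
  \<open>A\<close> or \<open>B\<close>.\<close>

lemma tdec_biclique:
  assumes "tdec R (A \<union> B) (alpha_le R k)" "sym R" "A \<times> B \<subseteq> R" "indep R A" "indep R B"
  shows "card A \<le> k \<or> card B \<le> k"
proof -
  let ?\<B> = "{{a, b} | a b. a \<in> A \<and> b \<in> B}"
  have "\<exists>C. alpha_le R k C \<and> C \<subseteq> A \<union> B \<and> (\<forall>X\<in>?\<B>. X \<inter> C \<noteq> {})"
  proof (rule tdec_bramble[OF assms(1)])
    fix X assume "X \<in> ?\<B>"
    then obtain a b where ab: "X = {a, b}" "a \<in> A" "b \<in> B" by blast
    have "conn R {b, a}"
      by (rule conn_insert[OF assms(2) conn_singleton, of a]) (use ab assms(3) in auto)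
    then show "X \<subseteq> A \<union> B \<and> conn R X" using ab by (simp add: insert_commute)
  next
    fix X Y assume "X \<in> ?\<B>" "Y \<in> ?\<B>"
    then obtain a b a' b' where XY: "X = {a, b}" "a \<in> A" "Y = {a', b'}" "b' \<in> B" by blast
    then have "(a, b') \<in> R" using assms(3) by blast
    then show "touching R X Y" unfolding touching_def XY(1,3) by simp
  qed
  then obtain C where *: "alpha_le R k C \<and> C \<subseteq> A \<union> B \<and> (\<forall>X\<in>?\<B>. X \<inter> C \<noteq> {})" by (rule exE)
  have C: "alpha_le R k C" using * by (rule conjunct1)
  have "a \<in> C \<or> b \<in> C" if "a \<in> A" "b \<in> B" for a b
  proof -
    have "{a, b} \<in> ?\<B>" using that by blast
    then have "{a, b} \<inter> C \<noteq> {}" using *[THEN conjunct2, THEN conjunct2] by (rule bspec[rotated])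
    then show ?thesis by blast
  qed
  then have "A \<subseteq> C \<or> B \<subseteq> C" by auto
  then show ?thesis using C assms(4,5) unfolding alpha_le_def by blast
qed

section \<open>Thin layers of weighted balls\<close>

text \<open>This is the weighted independence number; constant weight 1 gives the usual one.\<close>

definition max_weight :: "('a \<times> 'a) set \<Rightarrow> ('a \<Rightarrow> nat) \<Rightarrow> 'a set \<Rightarrow> nat" where
  "max_weight R x X = Max (sum x ` {J. J \<subseteq> X \<and> indep R J})"

lemma indep_empty [simp]: "indep R {}"
  by (simp add: indep_def)

lemma max_weight_ge: "finite X \<Longrightarrow> J \<subseteq> X \<Longrightarrow> indep R J \<Longrightarrow> sum x J \<le> max_weight R x X"
  unfolding max_weight_def by (rule Max_ge) auto

lemma max_weight_attained:
  assumes "finite X"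
  obtains J where "J \<subseteq> X" "indep R J" "sum x J = max_weight R x X"
proof -
  have "max_weight R x X \<in> sum x ` {J. J \<subseteq> X \<and> indep R J}"
    unfolding max_weight_def
  proof (rule Max_in)
    show "finite (sum x ` {J. J \<subseteq> X \<and> indep R J})" using assms by simp
    have "{} \<in> {J. J \<subseteq> X \<and> indep R J}" by simp
    then show "sum x ` {J. J \<subseteq> X \<and> indep R J} \<noteq> {}" by blast
  qed
  then show ?thesis using that by auto
qed

lemma max_weight_le:
  assumes "finite X" "\<And>J. J \<subseteq> X \<Longrightarrow> indep R J \<Longrightarrow> sum x J \<le> k"
  shows "max_weight R x X \<le> k"
  using max_weight_attained[OF assms(1)] assms(2) by metis

lemma max_weight_mono: "finite Y \<Longrightarrow> X \<subseteq> Y \<Longrightarrow> max_weight R x X \<le> max_weight R x Y"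
  by (rule max_weight_le) (auto intro: max_weight_ge finite_subset)

lemma alpha_le_max_weight: "finite X \<Longrightarrow> alpha_le R k X \<longleftrightarrow> max_weight R (\<lambda>_. 1) X \<le> k"
proof
  assume fin: "finite X" and "alpha_le R k X"
  then show "max_weight R (\<lambda>_. 1) X \<le> k" by (intro max_weight_le) (simp_all add: alpha_le_def)
next
  assume fin: "finite X" and le: "max_weight R (\<lambda>_. 1) X \<le> k"
  show "alpha_le R k X"
    unfolding alpha_le_def
  proof (intro allI impI)
    fix J assume "J \<subseteq> X" "indep R J"
    then have "sum (\<lambda>_. 1) J \<le> max_weight R (\<lambda>_. 1 :: nat) X" using max_weight_ge[OF fin] by blast
    then show "card J \<le> k" using le by simp
  qed
qed

lemma max_weight_Un_le:
  assumes "finite X" "finite Y"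
  shows "max_weight R x (X \<union> Y) \<le> max_weight R x X + max_weight R x Y"
proof (rule max_weight_le)
  fix J assume J: "J \<subseteq> X \<union> Y" "indep R J"
  have fJ: "finite J" using J(1) assms finite_subset[of J "X \<union> Y"] by simp
  have "J = (J \<inter> X) \<union> (J - X)" by blast
  then have "sum x J = sum x (J \<inter> X) + sum x (J - X)"
    using fJ sum.union_disjoint[of "J \<inter> X" "J - X" x] by (metis Diff_disjoint Int_Diff_disjoint finite_Diff finite_Int)
  moreover have "sum x (J \<inter> X) \<le> max_weight R x X"
    by (rule max_weight_ge[OF assms(1)]) (use J(2) in \<open>auto simp: indep_def\<close>)
  moreover have "sum x (J - X) \<le> max_weight R x Y"
    by (rule max_weight_ge[OF assms(2)]) (use J in \<open>auto simp: indep_def\<close>)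
  ultimately show "sum x J \<le> max_weight R x X + max_weight R x Y" by simp
qed (use assms in simp)

text \<open>Independent sets of anticomplete parts unite. This lets all carved balls share one
  weight budget.\<close>

lemma max_weight_Un_ge:
  assumes "finite X" "finite Y" "X \<inter> Y = {}" "sym R" "\<And>a b. a \<in> X \<Longrightarrow> b \<in> Y \<Longrightarrow> (a, b) \<notin> R"
  shows "max_weight R x X + max_weight R x Y \<le> max_weight R x (X \<union> Y)"
proof -
  obtain I where I: "I \<subseteq> X" "indep R I" "sum x I = max_weight R x X" by (rule max_weight_attained[OF assms(1)])
  obtain J where J: "J \<subseteq> Y" "indep R J" "sum x J = max_weight R x Y" by (rule max_weight_attained[OF assms(2)])
  have ab: "(a, b) \<notin> R" "(b, a) \<notin> R" if "a \<in> I" "b \<in> J" for a b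
  proof -
    show "(a, b) \<notin> R" using assms(5)[of a b] that I(1) J(1) by blast
    then show "(b, a) \<notin> R" using symD[OF assms(4)] by blast
  qed
  have "indep R (I \<union> J)"
    unfolding indep_def
  proof (intro ballI)
    fix u v assume "u \<in> I \<union> J" "v \<in> I \<union> J"
    then show "(u, v) \<notin> R" using ab I(2) J(2) unfolding indep_def by blast
  qed
  moreover have "finite I" "finite J" "I \<inter> J = {}"
    using I(1) J(1) assms(1-3) finite_subset by blast+
  then have "sum x (I \<union> J) = sum x I + sum x J" by (rule sum.union_disjoint)
  moreover have "sum x (I \<union> J) \<le> max_weight R x (X \<union> Y)"
    by (rule max_weight_ge) (use calculation(1) I(1) J(1) assms(1,2) in auto)
  ultimately show ?thesis using I(3) J(3) by simp
qed

text \<open>Integral weights make radii natural numbers, so that they can be summed over and reduced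
  modulo powers of 2. Positivity makes costs increase strictly along walks.\<close>

locale wgraph =
  fixes R :: "('a \<times> 'a) set" and x :: "'a \<Rightarrow> nat"
  assumes symR: "sym R" and irrR: "(v, v) \<notin> R" and pos: "x v > 0"
begin

text \<open>
  The length of a walk from \<open>u0\<close> is the sum of its vertex weights, both ends included.
\<close>

inductive cost :: "'a set \<Rightarrow> 'a \<Rightarrow> 'a \<Rightarrow> nat \<Rightarrow> bool" for U u0 where
  start: "u0 \<in> U \<Longrightarrow> cost U u0 u0 (x u0)"
| step: "cost U u0 v k \<Longrightarrow> w \<in> U \<Longrightarrow> (v, w) \<in> R \<Longrightarrow> cost U u0 w (k + x w)"

definition ball where "ball U u0 r = {v. \<exists>k\<le>r. cost U u0 v k}"

definition boundary where "boundary U u0 r = {w\<in>U. w \<notin> ball U u0 r \<and> (\<exists>v\<in>ball U u0 r. (v, w) \<in> R)}"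

abbreviation "mu \<equiv> max_weight R x"
abbreviation "alpha \<equiv> max_weight R (\<lambda>_. 1)"

lemma cost_in: "cost U u0 v k \<Longrightarrow> v \<in> U"
  by (induction rule: cost.induct)

lemma cost_mono: "cost U u0 v k \<Longrightarrow> U \<subseteq> U' \<Longrightarrow> cost U' u0 v k"
  by (induction rule: cost.induct) (auto intro: cost.intros)

lemma ball_subset: "ball U u0 r \<subseteq> U"
  using cost_in by (auto simp: ball_def)

lemma boundary_subset: "boundary U u0 r \<subseteq> U"
  by (auto simp: boundary_def)

lemma finite_ball: "finite U \<Longrightarrow> finite (ball U u0 r)"
  by (rule finite_subset[OF ball_subset])

lemma finite_boundary: "finite U \<Longrightarrow> finite (boundary U u0 r)"
  by (rule finite_subset[OF boundary_subset])

lemma ball_mono: "U \<subseteq> U' \<Longrightarrow> r \<le> r' \<Longrightarrow> ball U u0 r \<subseteq> ball U' u0 r'"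
  unfolding ball_def using cost_mono by (auto intro: order_trans)

lemma ball_step: "v \<in> ball U u0 r \<Longrightarrow> w \<in> U \<Longrightarrow> (v, w) \<in> R \<Longrightarrow> w \<in> ball U u0 (r + x w)"
  unfolding ball_def using cost.step by (auto intro!: add_right_mono)

lemma boundary_in_ball: "v \<in> boundary U u0 r \<Longrightarrow> v \<in> ball U u0 (r + x v)"
  using ball_step unfolding boundary_def by blast

text \<open>A vertex of the inner boundary is reached at cost at most \<open>r + b\<close>, and a
  neighbour of weight at most \<open>b\<close> at cost at most \<open>r + 2 * b\<close>, hence
  within the ball of radius \<open>r'\<close>.\<close>

lemma boundary_far:
  assumes "v \<in> boundary U u0 r" "v' \<in> boundary U u0 r'" "x v \<le> b" "x v' \<le> b" "r + 2 * b \<le> r'"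
  shows "v \<noteq> v'" "(v, v') \<notin> R"
proof -
  have v: "v \<in> ball U u0 (r + b)" using boundary_in_ball[OF assms(1)] ball_mono[of U U "r + x v" "r + b"] assms(3) by auto
  have v': "v' \<notin> ball U u0 r'" "v' \<in> U" using assms(2) by (auto simp: boundary_def)
  show "v \<noteq> v'" using v v' ball_mono[of U U "r + b" r' u0] assms(5) by auto
  show "(v, v') \<notin> R"
  proof
    assume "(v, v') \<in> R"
    then have "v' \<in> ball U u0 (r + b + x v')" using ball_step v v'(2) by blast
    then show False using v'(1) ball_mono[of U U "r + b + x v'" r' u0] assms(4,5) by auto
  qed
qed

definition weight_class where "weight_class i = {v. 2 ^ i \<le> x v \<and> x v < 2 ^ Suc i}"

text \<open>
  Boundaries with radii congruent modulo \<open>2 ^ (i + 2)\<close> have no edges between them within one dyadic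
  weight class. Hence their independent sets add up, at a total weight of at most that of the
  enclosing ball.
\<close>

lemma class_layers:
  assumes "finite U"
  shows "(\<Sum>r\<in>{a..<b}. alpha (boundary U u0 r \<inter> weight_class i)) \<le> 4 * mu (ball U u0 (b + 2 ^ Suc i))"
proof -
  let ?M = "2 ^ (i + 2) :: nat" and ?B = "\<lambda>r. boundary U u0 r \<inter> weight_class i" and ?L = "ball U u0 (b + 2 ^ Suc i)"
  have finB: "finite (?B r)" for r using finite_boundary[OF assms] by simp
  have finL: "finite ?L" by (rule finite_ball[OF assms])
  have "\<forall>r. \<exists>J. J \<subseteq> ?B r \<and> indep R J \<and> sum (\<lambda>_. 1) J = alpha (?B r)"
  proof
    fix r
    obtain J where "J \<subseteq> ?B r" "indep R J" "sum (\<lambda>_. 1) J = alpha (?B r)"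
      by (rule max_weight_attained[OF finB])
    then show "\<exists>J. J \<subseteq> ?B r \<and> indep R J \<and> sum (\<lambda>_. 1) J = alpha (?B r)" by (intro exI conjI)
  qed
  then obtain J where "\<forall>r. J r \<subseteq> ?B r \<and> indep R (J r) \<and> sum (\<lambda>_. 1) (J r) = alpha (?B r)"
    by (rule choice[THEN exE])
  then have J: "J r \<subseteq> ?B r" "indep R (J r)" "card (J r) = alpha (?B r)" for r
    by simp_all
  \<comment> \<open>The sets \<open>J r\<close> of one residue class unite to a single independent
    subset of \<open>?L\<close>, in which each vertex weighs at least \<open>2 ^ i\<close>.\<close>
  have res: "2 ^ i * (\<Sum>r\<in>{r\<in>{a..<b}. r mod ?M = \<rho>}. card (J r)) \<le> mu ?L" for \<rho>
  proof -
    let ?S = "{r\<in>{a..<b}. r mod ?M = \<rho>}"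
    have far: "v \<noteq> v' \<and> (v, v') \<notin> R"
      if "r \<in> ?S" "r' \<in> ?S" "r < r'" "v \<in> J r" "v' \<in> J r'" for r r' v v'
    proof -
      have "?M dvd r' - r" using that(1-3) by (intro iffD1[OF mod_eq_dvd_iff_nat]) auto
      then have "?M \<le> r' - r" using that(3) by (intro dvd_imp_le) auto
      then have le: "r + 2 * 2 ^ Suc i \<le> r'" using that(3) by simp
      have "v \<in> boundary U u0 r" "v' \<in> boundary U u0 r'" "x v \<le> 2 ^ Suc i" "x v' \<le> 2 ^ Suc i"
        using subsetD[OF J(1) that(4)] subsetD[OF J(1) that(5)] unfolding weight_class_def by simp_all
      from boundary_far[OF this le] show ?thesis by simp
    qed
    have far2: "v \<noteq> v' \<and> (v, v') \<notin> R"
      if "r \<in> ?S" "r' \<in> ?S" "r \<noteq> r'" "v \<in> J r" "v' \<in> J r'" for r r' v v'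
      using far[of r r' v v'] far[of r' r v' v] that symD[OF symR, of v v'] by (metis nat_neq_iff)
    have "indep R (\<Union>r\<in>?S. J r)"
      unfolding indep_def
    proof (intro ballI)
      fix u v assume "u \<in> (\<Union>r\<in>?S. J r)" "v \<in> (\<Union>r\<in>?S. J r)"
      then obtain r r' where "r \<in> ?S" "r' \<in> ?S" "u \<in> J r" "v \<in> J r'" by blast
      then show "(u, v) \<notin> R" using far2[of r r' u v] J(2)[of r] unfolding indep_def by (cases "r = r'") auto
    qed
    moreover have "(\<Union>r\<in>?S. J r) \<subseteq> ?L"
    proof
      fix v assume "v \<in> (\<Union>r\<in>?S. J r)"
      then obtain r where r: "r \<in> ?S" "v \<in> ?B r" using J(1) by blast
      then have "v \<in> ball U u0 (r + x v)" using boundary_in_ball by blast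
      moreover have "r + x v \<le> b + 2 ^ Suc i" using r by (auto simp: weight_class_def)
      ultimately show "v \<in> ?L" using ball_mono[of U U "r + x v"] by blast
    qed
    ultimately have "sum x (\<Union>r\<in>?S. J r) \<le> mu ?L" by (intro max_weight_ge[OF finL])
    moreover have "sum x (\<Union>r\<in>?S. J r) = (\<Sum>r\<in>?S. sum x (J r))"
    proof (rule sum.UNION_disjoint)
      show "\<forall>r\<in>?S. finite (J r)" using finite_subset[OF J(1) finB] by simp
      show "\<forall>r\<in>?S. \<forall>r'\<in>?S. r \<noteq> r' \<longrightarrow> J r \<inter> J r' = {}" using far2 by blast
    qed simp
    moreover have "2 ^ i * card (J r) \<le> sum x (J r)" for r
    proof -
      have "of_nat (card (J r)) * 2 ^ i \<le> sum x (J r)"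
        by (rule sum_bounded_below) (use J(1)[of r] in \<open>auto simp: weight_class_def\<close>)
      then show ?thesis by (simp add: mult.commute)
    qed
    then have "(\<Sum>r\<in>?S. 2 ^ i * card (J r)) \<le> (\<Sum>r\<in>?S. sum x (J r))" by (intro sum_mono)
    ultimately show ?thesis by (simp add: sum_distrib_left)
  qed
  \<comment> \<open>Summing over the \<open>2 ^ (i + 2)\<close> residues and cancelling
    \<open>2 ^ i\<close> leaves the factor 4.\<close>
  have "(\<Sum>r\<in>{a..<b}. card (J r)) = (\<Sum>\<rho>\<in>{..<?M}. \<Sum>r\<in>{r\<in>{a..<b}. r mod ?M = \<rho>}. card (J r))"
    by (rule sum.group[symmetric]) auto
  then have "2 ^ i * (\<Sum>r\<in>{a..<b}. card (J r))
      = (\<Sum>\<rho>\<in>{..<?M}. 2 ^ i * (\<Sum>r\<in>{r\<in>{a..<b}. r mod ?M = \<rho>}. card (J r)))"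
    by (simp add: sum_distrib_left)
  also have "\<dots> \<le> of_nat (card {..<?M}) * mu ?L" by (rule sum_bounded_above) (rule res)
  also have "\<dots> = 2 ^ i * (4 * mu ?L)" by simp
  finally show ?thesis by (simp add: J(3))
qed

lemma alpha_classes:
  assumes "finite X" "\<And>v. v \<in> X \<Longrightarrow> x v < 2 ^ m"
  shows "alpha X \<le> (\<Sum>i<m. alpha (X \<inter> weight_class i))"
proof (rule max_weight_le[OF assms(1)])
  fix J assume J: "J \<subseteq> X" "indep R J"
  have finJ: "finite J" using J(1) assms(1) finite_subset by blast
  have "\<exists>i<m. v \<in> weight_class i" if v: "v \<in> J" for v
  proof -
    have "x v < 2 ^ m" using assms(2) v J(1) by blast
    have "\<exists>i. 2 ^ i \<le> x v \<and> x v < 2 ^ Suc i" using ex_power_ivl1[of 2 "x v"] pos[of v] by auto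
    then obtain i where i: "2 ^ i \<le> x v" "x v < 2 ^ Suc i" by blast
    have "(2::nat) ^ i < 2 ^ m" using i \<open>x v < 2 ^ m\<close> by linarith
    then have "i < m" by simp
    then show ?thesis using i by (auto simp: weight_class_def)
  qed
  then have "J = (\<Union>i<m. J \<inter> weight_class i)" by blast
  then have "card J \<le> (\<Sum>i<m. card (J \<inter> weight_class i))"
    using card_UN_le[of "{..<m}" "\<lambda>i. J \<inter> weight_class i"] by simp
  also have "\<dots> \<le> (\<Sum>i<m. alpha (X \<inter> weight_class i))"
  proof (rule sum_mono)
    fix i
    have "sum (\<lambda>_. 1) (J \<inter> weight_class i) \<le> alpha (X \<inter> weight_class i)"
      by (rule max_weight_ge) (use J assms(1) in \<open>auto simp: indep_def\<close>)
    then show "card (J \<inter> weight_class i) \<le> alpha (X \<inter> weight_class i)" by simp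
  qed
  finally show "sum (\<lambda>_. 1) J \<le> (\<Sum>i<m. alpha (X \<inter> weight_class i))" by simp
qed

text \<open>Averaging over \<open>2 * 2 ^ m\<close> radii: by \<open>class_layers\<close>, each of
  the \<open>m\<close> dyadic classes contributes at most 4 times the weight of the outer ball. Its
  extra radius \<open>2 ^ m\<close> makes room for boundary vertices, which weigh less than
  that.\<close>

lemma thin_layer:
  assumes "finite U" "\<And>v. v \<in> U \<Longrightarrow> x v < 2 ^ m"
  shows "\<exists>r\<in>{a..<a + 2 * 2 ^ m}. 2 ^ m * alpha (boundary U u0 r) \<le> 2 * m * mu (ball U u0 (a + 3 * 2 ^ m))"
proof (rule ccontr)
  let ?W = "2 ^ m :: nat"
  let ?I = "{a..<a + 2 * ?W}" and ?F = "mu (ball U u0 (a + 3 * ?W))"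
  assume "\<not> ?thesis"
  then have neg: "2 * m * ?F < ?W * alpha (boundary U u0 r)" if "r \<in> ?I" for r using that by (meson not_le)
  have "(\<Sum>r\<in>?I. 2 * m * ?F) < (\<Sum>r\<in>?I. ?W * alpha (boundary U u0 r))"
    by (rule sum_strict_mono) (use neg in auto)
  then have 1: "2 * ?W * (2 * m * ?F) < ?W * (\<Sum>r\<in>?I. alpha (boundary U u0 r))"
    by (simp add: sum_distrib_left)
  have "(\<Sum>r\<in>?I. alpha (boundary U u0 r)) \<le> (\<Sum>r\<in>?I. \<Sum>i<m. alpha (boundary U u0 r \<inter> weight_class i))"
  proof (intro sum_mono alpha_classes finite_boundary[OF assms(1)])
    show "x v < 2 ^ m" if "v \<in> boundary U u0 r" for r v
      using assms(2) subsetD[OF boundary_subset that] by simp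
  qed
  also have "\<dots> = (\<Sum>i<m. \<Sum>r\<in>?I. alpha (boundary U u0 r \<inter> weight_class i))" by (rule sum.swap)
  also have "\<dots> \<le> (\<Sum>i<m. 4 * ?F)"
  proof (rule sum_mono)
    fix i assume i: "i \<in> {..<m}"
    have "(2::nat) ^ Suc i \<le> 2 ^ m" using i by (intro power_increasing) auto
    then have "ball U u0 (a + 2 * ?W + 2 ^ Suc i) \<subseteq> ball U u0 (a + 3 * ?W)" by (intro ball_mono) auto
    then have "mu (ball U u0 (a + 2 * ?W + 2 ^ Suc i)) \<le> ?F"
      by (rule max_weight_mono[OF finite_ball[OF assms(1)]])
    then show "(\<Sum>r\<in>?I. alpha (boundary U u0 r \<inter> weight_class i)) \<le> 4 * ?F"
      using class_layers[OF assms(1), of u0 i a "a + 2 * ?W"] by linarith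
  qed
  also have "\<dots> = m * (4 * ?F)" by simp
  finally have "?W * (\<Sum>r\<in>?I. alpha (boundary U u0 r)) \<le> ?W * (m * (4 * ?F))" by (rule mult_le_mono2)
  then show False using 1 by (simp add: algebra_simps)
qed

text \<open>
  The weight of the balls cannot double \<open>l\<close> times in a row.
\<close>

lemma growing_ball:
  assumes "finite U" "\<And>v. v \<in> U \<Longrightarrow> x v < 2 ^ m" "u0 \<in> U" "mu U < 2 ^ l"
  shows "\<exists>r\<le>3 * 2 ^ m * Suc l. u0 \<in> ball U u0 r \<and> 2 ^ m * alpha (boundary U u0 r) \<le> 4 * m * mu (ball U u0 r)"
proof -
  let ?W = "2 ^ m :: nat"
  define f where "f j = mu (ball U u0 (3 * ?W * Suc j))" for j
  have fin: "finite (ball U u0 r)" for r by (rule finite_ball[OF assms(1)])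
  have u0: "u0 \<in> ball U u0 r" if "?W \<le> r" for r
  proof -
    have "x u0 \<le> r" using assms(2)[OF assms(3)] that by simp
    then show ?thesis unfolding ball_def using cost.start[OF assms(3)] by blast
  qed
  have "\<exists>j<l. f (Suc j) \<le> 2 * f j"
  proof (rule ccontr)
    assume "\<not> ?thesis"
    then have grow: "2 * f j \<le> f (Suc j)" if "j < l" for j using that by (meson nat_le_linear not_le)
    have f0: "1 \<le> f 0"
    proof -
      have "sum x {u0} \<le> f 0" unfolding f_def
        by (rule max_weight_ge[OF fin]) (use u0[of "3 * ?W * Suc 0"] irrR in \<open>auto simp: indep_def\<close>)
      then show ?thesis using pos[of u0] by simp
    qed
    have "2 ^ j \<le> f j" if "j \<le> l" for j
      using that
    proof (induction j)
      case (Suc j)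
      then show ?case using grow[of j] by simp
    qed (use f0 in simp)
    then have "2 ^ l \<le> f l" by simp
    also have "\<dots> \<le> mu U" unfolding f_def by (rule max_weight_mono[OF assms(1) ball_subset])
    finally show False using assms(4) by simp
  qed
  then obtain j where j: "j < l" "f (Suc j) \<le> 2 * f j" by blast
  \<comment> \<open>The radii in \<open>f\<close> are spaced by \<open>3 * ?W\<close>, exactly the
    overshoot in \<open>thin_layer\<close>: the outer ball there is the next one of the sequence and
    weighs at most \<open>2 * f j\<close>.\<close>
  let ?a = "3 * ?W * Suc j"
  obtain r where r: "r \<in> {?a..<?a + 2 * ?W}"
    "?W * alpha (boundary U u0 r) \<le> 2 * m * mu (ball U u0 (?a + 3 * ?W))"
    using thin_layer[OF assms(1,2), of ?a u0] by blast
  have "mu (ball U u0 (?a + 3 * ?W)) = f (Suc j)" by (simp add: f_def algebra_simps)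
  also have "\<dots> \<le> 2 * f j" by (rule j(2))
  also have "f j \<le> mu (ball U u0 r)" unfolding f_def
    by (rule max_weight_mono[OF fin ball_mono[OF subset_refl]]) (use r(1) in simp)
  finally have "mu (ball U u0 (?a + 3 * ?W)) \<le> 2 * mu (ball U u0 r)" by simp
  then have "2 * m * mu (ball U u0 (?a + 3 * ?W)) \<le> 2 * m * (2 * mu (ball U u0 r))" by (rule mult_le_mono2)
  with r(2) have "?W * alpha (boundary U u0 r) \<le> 2 * m * (2 * mu (ball U u0 r))" by (rule order_trans)
  also have "\<dots> = 4 * m * mu (ball U u0 r)" by simp
  finally have "?W * alpha (boundary U u0 r) \<le> 4 * m * mu (ball U u0 r)" .
  moreover have "r \<le> 3 * ?W * Suc l"
  proof -
    have "r \<le> 3 * ?W * Suc j + 3 * ?W" using r(1) by simp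
    also have "\<dots> = 3 * ?W * Suc (Suc j)" by simp
    also have "\<dots> \<le> 3 * ?W * Suc l" using j(1) by (intro mult_le_mono2) simp
    finally show ?thesis .
  qed
  moreover have "u0 \<in> ball U u0 r" using u0[of r] r(1) by simp
  ultimately show ?thesis by blast
qed

end

section \<open>Balanced separators from region growing\<close>

text \<open>The balance \<open>1 - 1/K\<close> is cleared of denominators to stay in
  \<open>nat\<close>.\<close>

definition separable :: "('a \<times> 'a) set \<Rightarrow> 'a set \<Rightarrow> nat \<Rightarrow> nat \<Rightarrow> bool" where
  "separable R V K d \<longleftrightarrow> (\<exists>A B X. V = A \<union> B \<union> X \<and> A \<inter> B = {} \<and> (\<forall>a\<in>A. \<forall>b\<in>B. (a, b) \<notin> R) \<and> alpha_le R d X \<and>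
     K * card A \<le> (K - 1) * card V \<and> K * card B \<le> (K - 1) * card V)"

context wgraph
begin

lemma ball_boundary_no_edge:
  "v \<in> ball U u0 r \<Longrightarrow> w \<in> U - ball U u0 r - boundary U u0 r \<Longrightarrow> (v, w) \<notin> R"
  unfolding boundary_def by blast

text \<open>
  Balls are carved off one after another. They are pairwise non-adjacent, so their weights add up
  and pay for the independence numbers of all boundaries.
\<close>

lemma ball_carving:
  assumes "finite V" "Y \<subseteq> V" "\<And>v. v \<in> Y \<Longrightarrow> x v < 2 ^ m" "mu V < 2 ^ l"
    and small: "\<And>U u r. U \<subseteq> Y \<Longrightarrow> r \<le> 3 * 2 ^ m * Suc l \<Longrightarrow> 2 * card (ball U u r) \<le> card V"
  shows "\<exists>A X. A \<subseteq> Y \<and> X \<subseteq> Y - A \<and> (\<forall>a\<in>A. \<forall>b\<in>Y - A - X. (a, b) \<notin> R) \<and>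
    2 ^ m * alpha X \<le> 4 * m * mu A \<and> 4 * card A \<le> 3 * card V \<and> 4 * card (Y - A - X) \<le> 3 * card V"
proof -
  have finY: "finite Y" by (rule finite_subset[OF assms(2,1)])
  define P where "P A X \<longleftrightarrow> A \<subseteq> Y \<and> X \<subseteq> Y - A \<and> (\<forall>a\<in>A. \<forall>b\<in>Y - A - X. (a, b) \<notin> R) \<and>
    2 ^ m * alpha X \<le> 4 * m * mu A \<and> 4 * card A \<le> 3 * card V" for A X
  have "alpha {} \<le> 0" by (rule max_weight_le) auto
  then have P0: "\<exists>X. P {} X" unfolding P_def by (intro exI[of _ "{}"]) simp
  have "\<forall>A. (\<exists>X. P A X) \<longrightarrow> card A < Suc (card Y)"
    using card_mono[OF finY] by (simp add: P_def less_Suc_eq_le)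
  \<comment> \<open>A carving with as many vertices in \<open>A\<close> as possible replaces an
    explicit iteration.\<close>
  from ex_has_greatest_nat[of "\<lambda>A. \<exists>X. P A X" _ card, OF P0 this]
  obtain A X where PAX: "P A X" and max: "\<And>A' X'. P A' X' \<Longrightarrow> card A' \<le> card A" by blast
  have A: "A \<subseteq> Y" and X: "X \<subseteq> Y - A" and no: "\<And>a b. a \<in> A \<Longrightarrow> b \<in> Y - A - X \<Longrightarrow> (a, b) \<notin> R"
    and alfX: "2 ^ m * alpha X \<le> 4 * m * mu A" and cA: "4 * card A \<le> 3 * card V"
    using PAX unfolding P_def by simp_all
  let ?U = "Y - A - X"
  have finA: "finite A" and finX: "finite X" using finite_subset[OF A finY] finite_subset[OF X] finY by auto
  have cU: "card A + card ?U \<le> card V"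
  proof -
    have "card (A \<union> ?U) = card A + card ?U" by (rule card_Un_disjoint) (use finA finY in auto)
    moreover have "card (A \<union> ?U) \<le> card V" by (rule card_mono[OF assms(1)]) (use A assms(2) in auto)
    ultimately show ?thesis by simp
  qed
  have "4 * card ?U \<le> 3 * card V"
  proof (rule ccontr)
    assume big: "\<not> ?thesis"
    \<comment> \<open>More than 3/4 left over means less than 1/4 in \<open>A\<close>, so one more
      ball with at most half of the vertices keeps \<open>A\<close> below 3/4.\<close>
    then have "4 * card A < card V" using cU by simp
    have "?U \<noteq> {}" using big by (intro notI) simp
    then obtain u where u: "u \<in> ?U" by blast
    have lightU: "x v < 2 ^ m" if "v \<in> ?U" for v using assms(3) that by simp
    have finU: "finite ?U" using finY by simp
    have "mu ?U \<le> mu V" by (rule max_weight_mono[OF assms(1)]) (use assms(2) in auto)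
    then have "mu ?U < 2 ^ l" using assms(4) by simp
    from growing_ball[OF finU lightU u this]
    obtain r where r: "r \<le> 3 * 2 ^ m * Suc l" "u \<in> ball ?U u r"
      "2 ^ m * alpha (boundary ?U u r) \<le> 4 * m * mu (ball ?U u r)" by blast
    let ?B = "ball ?U u r" and ?D = "boundary ?U u r"
    have BU: "?B \<subseteq> ?U" and DU: "?D \<subseteq> ?U" by (rule ball_subset, rule boundary_subset)
    have finB: "finite ?B" and finD: "finite ?D" by (rule finite_ball[OF finU], rule finite_boundary[OF finU])
    have BD: "?B \<inter> ?D = {}" by (auto simp: boundary_def)
    have "2 * card ?B \<le> card V" by (rule small[OF _ r(1)]) blast
    have cAB: "card (A \<union> ?B) = card A + card ?B"
      by (rule card_Un_disjoint[OF finA finB]) (use BU in blast)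
    have "P (A \<union> ?B) (X \<union> ?D)"
      unfolding P_def
    proof (intro conjI ballI)
      show "A \<union> ?B \<subseteq> Y" using A BU by blast
      show "X \<union> ?D \<subseteq> Y - (A \<union> ?B)" using X BU DU BD by blast
      show "4 * card (A \<union> ?B) \<le> 3 * card V"
        using cAB \<open>4 * card A < card V\<close> \<open>2 * card ?B \<le> card V\<close> by simp
      show "(a, b) \<notin> R" if "a \<in> A \<union> ?B" "b \<in> Y - (A \<union> ?B) - (X \<union> ?D)" for a b
      proof (cases "a \<in> A")
        case True
        then show ?thesis using no that(2) by blast
      next
        case False
        then have "a \<in> ?B" "b \<in> ?U - ?B - ?D" using that by blast+
        then show ?thesis by (rule ball_boundary_no_edge)
      qed
      have "2 ^ m * alpha (X \<union> ?D) \<le> 2 ^ m * (alpha X + alpha ?D)"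
        by (intro mult_le_mono2 max_weight_Un_le[OF finX finD])
      also have "\<dots> \<le> 4 * m * mu A + 4 * m * mu ?B"
        using alfX r(3) by (simp add: distrib_left)
      also have "\<dots> = 4 * m * (mu A + mu ?B)" by (simp add: distrib_left)
      also have "\<dots> \<le> 4 * m * mu (A \<union> ?B)"
      proof (rule mult_le_mono2, rule max_weight_Un_ge[OF finA finB _ symR])
        show "A \<inter> ?B = {}" using BU by blast
        show "(a, b) \<notin> R" if "a \<in> A" "b \<in> ?B" for a b using no[OF that(1)] that(2) BU by blast
      qed
      finally show "2 ^ m * alpha (X \<union> ?D) \<le> 4 * m * mu (A \<union> ?B)" .
    qed
    then have "card (A \<union> ?B) \<le> card A" by (rule max)
    moreover have "card ?B > 0" using r(2) finB card_gt_0_iff by blast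
    ultimately show False using cAB by simp
  qed
  moreover have "\<forall>a\<in>A. \<forall>b\<in>?U. (a, b) \<notin> R" using no by simp
  ultimately show ?thesis using A X alfX cA by (intro exI[of _ A] exI[of _ X] conjI)
qed

text \<open>Vertices of weight at least \<open>2 ^ m\<close> join the separator: an independent set
  of them weighs at most \<open>K * 2 ^ m\<close>, hence has at most \<open>K\<close> members.
  Region growing then only deals with the light vertices \<open>Y\<close>.\<close>

lemma separableI:
  assumes "finite V" "Y = V - {v\<in>V. 2 ^ m \<le> x v}" "mu V \<le> K * 2 ^ m" "A \<subseteq> Y" "X \<subseteq> Y"
    "A \<inter> X = {}" "\<And>a b. a \<in> A \<Longrightarrow> b \<in> Y - A - X \<Longrightarrow> (a, b) \<notin> R"
    "2 ^ m * alpha X \<le> 4 * m * (K * 2 ^ m)"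
    "K * card A \<le> (K - 1) * card V" "K * card (Y - A - X) \<le> (K - 1) * card V"
  shows "separable R V K (K + 4 * m * K)"
proof -
  let ?Z = "{v\<in>V. 2 ^ m \<le> x v}"
  have finZ: "finite ?Z" using assms(1) by simp
  have finX: "finite X" using finite_subset[OF assms(5)] assms(1,2) by simp
  have "alpha ?Z \<le> K"
  proof (rule max_weight_le[OF finZ])
    fix J assume J: "J \<subseteq> ?Z" "indep R J"
    have "of_nat (card J) * 2 ^ m \<le> sum x J" by (rule sum_bounded_below) (use J(1) in auto)
    also have "\<dots> \<le> mu V" by (rule max_weight_ge[OF assms(1) _ J(2)]) (use J(1) in auto)
    also have "\<dots> \<le> K * 2 ^ m" by (rule assms(3))
    finally show "sum (\<lambda>_. 1) J \<le> K" by simp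
  qed
  moreover have "alpha X \<le> 4 * m * K" using assms(8) by (simp add: mult.assoc mult.left_commute[of "2 ^ m"])
  ultimately have "alpha (?Z \<union> X) \<le> K + 4 * m * K" using max_weight_Un_le[OF finZ finX, of R "\<lambda>_. 1"] by linarith
  then have "alpha_le R (K + 4 * m * K) (?Z \<union> X)" using alpha_le_max_weight[of "?Z \<union> X" R] finZ finX by simp
  moreover have "V = A \<union> (Y - A - X) \<union> (?Z \<union> X)" using assms(2,4,5) by blast
  moreover have "A \<inter> (Y - A - X) = {}" "\<forall>a\<in>A. \<forall>b\<in>Y - A - X. (a, b) \<notin> R" using assms(7) by auto
  ultimately show ?thesis unfolding separable_def
    using assms(9,10) by (intro exI[of _ A] exI[of _ "Y - A - X"] exI[of _ "?Z \<union> X"] conjI)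
qed

text \<open>Carving must fail, so some ball of small radius holds more than half of the vertices.
  Enlarged until its boundary is thin, it would be one side of a separation, and the only balance
  condition that can fail is the one for the ball itself.\<close>

lemma central_ball:
  assumes "finite V" "mu V \<le> K * 2 ^ m" "K * 2 ^ m < 2 ^ l" "4 \<le> K"
    and nosep: "\<not> separable R V K (K + 4 * m * K)"
  shows "\<exists>u0\<in>V. K * card (V - ball V u0 (3 * 2 ^ m * Suc l + 2 * 2 ^ m)) < card V"
proof -
  let ?W = "2 ^ m :: nat" and ?\<rho> = "3 * 2 ^ m * Suc l :: nat"
  define Y where "Y = V - {v\<in>V. ?W \<le> x v}"
  have YV: "Y \<subseteq> V" and light: "\<And>v. v \<in> Y \<Longrightarrow> x v < ?W" by (auto simp: Y_def)
  have finY: "finite Y" by (rule finite_subset[OF YV assms(1)])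
  have muA: "mu A \<le> K * ?W" if "A \<subseteq> Y" for A
    using order_trans[OF max_weight_mono[OF assms(1) order_trans[OF that YV]] assms(2)] .
  have "mu V < 2 ^ l" using assms(2,3) by simp
  \<comment> \<open>For \<open>K \<ge> 4\<close>, a side with at most 3/4 of the vertices is
    balanced enough.\<close>
  have frac: "K * c \<le> (K - 1) * n" if "4 * c \<le> 3 * n" for c n
  proof -
    have "4 * (K * c) \<le> K * (3 * n)" using mult_le_mono2[OF that, of K] by simp
    also have "\<dots> = (3 * K) * n" by simp
    also have "\<dots> \<le> (4 * (K - 1)) * n" by (rule mult_le_mono1) (use assms(4) in simp)
    finally show ?thesis by simp
  qed
  have "\<exists>U u r. U \<subseteq> Y \<and> r \<le> ?\<rho> \<and> card V < 2 * card (ball U u r)"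
  proof (rule ccontr)
    assume "\<not> ?thesis"
    then have small: "2 * card (ball U u r) \<le> card V" if "U \<subseteq> Y" "r \<le> ?\<rho>" for U u r
      using that by (meson not_le)
    from ball_carving[OF assms(1) YV light \<open>mu V < 2 ^ l\<close> small]
    obtain A X where AX: "A \<subseteq> Y" "X \<subseteq> Y - A" "\<And>a b. a \<in> A \<Longrightarrow> b \<in> Y - A - X \<Longrightarrow> (a, b) \<notin> R"
      "?W * alpha X \<le> 4 * m * mu A" "4 * card A \<le> 3 * card V" "4 * card (Y - A - X) \<le> 3 * card V"
      by metis
    have "?W * alpha X \<le> 4 * m * (K * ?W)"
      by (rule order_trans[OF AX(4) mult_le_mono2[OF muA[OF AX(1)]]])
    then have "separable R V K (K + 4 * m * K)"
      using AX frac[OF AX(5)] frac[OF AX(6)]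
      by (intro separableI[OF assms(1) Y_def assms(2), of A X]) auto
    then show False using nosep by simp
  qed
  then obtain U u r where U: "U \<subseteq> Y" "r \<le> ?\<rho>" "card V < 2 * card (ball U u r)" by blast
  have "ball U u r \<noteq> {}" using U(3) by (intro notI) simp
  then have "u \<in> U"
  proof -
    have "cost U u v k \<Longrightarrow> u \<in> U" for v k by (induction rule: cost.induct)
    then show ?thesis using \<open>ball U u r \<noteq> {}\<close> by (auto simp: ball_def)
  qed
  obtain r' where r': "r' \<in> {?\<rho>..<?\<rho> + 2 * ?W}"
    "?W * alpha (boundary Y u r') \<le> 2 * m * mu (ball Y u (?\<rho> + 3 * ?W))"
    using thin_layer[OF finY light, of ?\<rho> u] by blast
  let ?A = "ball Y u r'" and ?X = "boundary Y u r'"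
  have AY: "?A \<subseteq> Y" and XY: "?X \<subseteq> Y" by (rule ball_subset, rule boundary_subset)
  have finA: "finite ?A" by (rule finite_ball[OF finY])
  have sub: "ball U u r \<subseteq> ?A" by (rule ball_mono[OF U(1)]) (use U(2) r'(1) in auto)
  have big: "card V < 2 * card ?A" using card_mono[OF finA sub] U(3) by simp
  have "K * card (Y - ?A - ?X) \<le> (K - 1) * card V"
  proof (rule frac)
    have "card (V - ?A) = card V - card ?A" by (rule card_Diff_subset[OF finA]) (use AY YV in blast)
    moreover have "card (Y - ?A - ?X) \<le> card (V - ?A)" by (rule card_mono) (use assms(1) YV in auto)
    ultimately show "4 * card (Y - ?A - ?X) \<le> 3 * card V" using big by simp
  qed
  moreover have "?W * alpha ?X \<le> 4 * m * (K * ?W)"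
  proof -
    have "?W * alpha ?X \<le> 2 * m * (K * ?W)"
      using r'(2) mult_le_mono2[OF muA[OF ball_subset], of "2 * m" u "?\<rho> + 3 * ?W"] by linarith
    also have "\<dots> \<le> 4 * m * (K * ?W)" by (rule mult_le_mono1) simp
    finally show ?thesis .
  qed
  moreover have "?A \<inter> ?X = {}" by (auto simp: boundary_def)
  moreover have "(a, b) \<notin> R" if "a \<in> ?A" "b \<in> Y - ?A - ?X" for a b
    by (rule ball_boundary_no_edge[OF that])
  ultimately have "\<not> K * card ?A \<le> (K - 1) * card V"
    using separableI[OF assms(1) Y_def assms(2) AY XY] nosep by blast
  then have bigA: "(K - 1) * card V < K * card ?A" by simp
  have "?A \<subseteq> ball V u (?\<rho> + 2 * ?W)" by (rule ball_mono[OF YV]) (use r'(1) in auto)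
  then have "card (V - ball V u (?\<rho> + 2 * ?W)) \<le> card (V - ?A)" by (intro card_mono) (use assms(1) in auto)
  also have "\<dots> = card V - card ?A" by (rule card_Diff_subset[OF finA]) (use AY YV in blast)
  finally have "K * card (V - ball V u (?\<rho> + 2 * ?W)) \<le> K * (card V - card ?A)" by (rule mult_le_mono2)
  also have "\<dots> = K * card V - K * card ?A" by (simp add: diff_mult_distrib2)
  also have "\<dots> < card V"
  proof -
    have "K * card V = (K - 1) * card V + card V" using assms(4) by (cases K) auto
    moreover have "card V > 0" using big by (cases "card V") (use card_mono[OF assms(1), of ?A] AY YV in auto)
    ultimately show ?thesis using bigA by linarith
  qed
  finally show ?thesis using \<open>u \<in> U\<close> U(1) YV by blast
qed

lemma cost_exists:
  assumes "conn R V" "u0 \<in> V" "v \<in> V"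
  shows "\<exists>k. cost V u0 v k"
proof -
  have "(u0, v) \<in> rtrancl_on V R" using assms by (simp add: conn_def)
  then show ?thesis
  proof (induction rule: rtrancl_on_induct)
    case base
    then show ?case using cost.start by blast
  next
    case (step y z)
    then show ?case using cost.step by blast
  qed
qed

text \<open>
  A shortest path is induced, hence the union of the two independent sets of its even and its odd
  vertices. This bounds both its length and its cliques.
\<close>

lemma shortest_path:
  assumes "cost V u0 v k" "\<And>k'. cost V u0 v k' \<Longrightarrow> k \<le> k'"
  shows "\<exists>I J. I \<subseteq> V \<and> J \<subseteq> V \<and> indep R I \<and> indep R J \<and> conn R (I \<union> J) \<and> u0 \<in> I \<union> J \<and> v \<in> I \<and> v \<notin> J \<and>
    finite I \<and> finite J \<and> sum x I + sum x J \<le> k \<and> (\<forall>w\<in>I \<union> J. w = v \<or> (\<exists>k'<k. cost V u0 w k'))"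
  using assms
proof (induction k arbitrary: v rule: less_induct)
  case (less k)
  from less.prems(1) show ?case
  proof (cases rule: cost.cases)
    case start
    then show ?thesis using irrR by (intro exI[of _ "{u0}"] exI[of _ "{}"]) (simp add: indep_def)
  next
    case (step p k')
    have "k' < k" using step(1) pos[of v] by simp
    have min: "k' \<le> k''" if "cost V u0 p k''" for k''
      using less.prems(2)[OF cost.step[OF that step(3,4)]] step(1) by simp
    have "\<exists>I J. I \<subseteq> V \<and> J \<subseteq> V \<and> indep R I \<and> indep R J \<and> conn R (I \<union> J) \<and> u0 \<in> I \<union> J \<and> p \<in> I \<and> p \<notin> J \<and>
      finite I \<and> finite J \<and> sum x I + sum x J \<le> k' \<and> (\<forall>w\<in>I \<union> J. w = p \<or> (\<exists>k''<k'. cost V u0 w k''))"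
      by (rule less.IH[OF \<open>k' < k\<close> step(2)]) (erule min)
    then obtain I J where IJ: "I \<subseteq> V" "J \<subseteq> V" "indep R I" "indep R J" "conn R (I \<union> J)" "u0 \<in> I \<union> J" "p \<in> I"
      "p \<notin> J" "finite I" "finite J" "sum x I + sum x J \<le> k'"
      and low': "\<forall>w\<in>I \<union> J. w = p \<or> (\<exists>k''<k'. cost V u0 w k'')"
      by (elim exE conjE)
    have low: "\<exists>k''<k. cost V u0 w k''" if "w \<in> I \<union> J" for w
      using bspec[OF low' that] \<open>k' < k\<close> step(2) less_trans by metis
    have vn: "v \<notin> I \<union> J"
    proof
      assume "v \<in> I \<union> J"
      then obtain k'' where "k'' < k" "cost V u0 v k''" using low by blast
      then show False using less.prems(2)[of k''] by simp
    qed
    \<comment> \<open>A neighbour of \<open>v\<close> in \<open>J\<close> differs from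
      \<open>p\<close>, so it is strictly closer to \<open>u0\<close> than \<open>p\<close> and
      would be a shortcut to \<open>v\<close>.\<close>
    have nadj: "(v, w) \<notin> R" if w: "w \<in> J" for w
    proof
      assume "(v, w) \<in> R"
      then have wv: "(w, v) \<in> R" by (rule symD[OF symR])
      have "w \<noteq> p" using w IJ(8) by blast
      then obtain k'' where k'': "k'' < k'" "cost V u0 w k''" using bspec[OF low', of w] w by blast
      from less.prems(2)[OF cost.step[OF k''(2) step(3) wv]] show False using k''(1) step(1) by simp
    qed
    have "indep R (insert v J)" by (rule indep_insertI[OF symR irrR IJ(4) nadj])
    moreover have "conn R (insert v J \<union> I)"
      using conn_insert[OF symR IJ(5), of p v] IJ(7) step(4) by (simp add: Un_commute)
    moreover have "sum x (insert v J) + sum x I \<le> k" using IJ(10,11) vn step(1) by simp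
    moreover have "\<forall>w\<in>insert v J \<union> I. w = v \<or> (\<exists>k'<k. cost V u0 w k')" using low by blast
    moreover have "insert v J \<subseteq> V" "u0 \<in> insert v J \<union> I" "v \<in> insert v J" "v \<notin> I" "finite (insert v J)"
      using IJ(2,6,10) vn step(3) by auto
    \<comment> \<open>\<open>I\<close> and \<open>J\<close> exchange roles, since the end of the
      path always belongs to the first set.\<close>
    ultimately show ?thesis using IJ(1,3,9)
      by (intro exI[of _ "insert v J"] exI[of _ I] conjI)
  qed
qed

end

section \<open>Multiplicative weights\<close>

text \<open>Converse of \<open>1 + y \<le> exp y\<close> up to a quadratic loss, which a small step
  size absorbs.\<close>

lemma one_plus_ge_exp:
  fixes y :: real
  assumes "\<bar>y\<bar> \<le> 1/2"
  shows "exp (y - 2 * y\<^sup>2) \<le> 1 + y"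
proof -
  have pos: "0 < 1 + y" using assms by linarith
  have "\<bar>ln (1 + y) - y\<bar> \<le> 2 * y\<^sup>2" using assms by (rule abs_ln_one_plus_x_minus_x_bound)
  then have "y - 2 * y\<^sup>2 \<le> ln (1 + y)" by linarith
  then have "exp (y - 2 * y\<^sup>2) \<le> exp (ln (1 + y))" by simp
  then show ?thesis using pos by simp
qed

text \<open>The potential is the sum over \<open>v\<close> of the products of
  \<open>1 + \<eta> * g t v\<close>. Each response lowers it by the factor
  \<open>exp (- (\<eta> * \<delta>))\<close>, whereas a vertex with positive total would alone
  contribute at least \<open>exp (- (T * \<eta> * \<delta> / 2))\<close>. For large \<open>T\<close>
  this is a contradiction; the slack \<open>\<delta>\<close> is what yields the exact bound 0 after
  finitely many rounds.\<close>

lemma multiplicative_weights: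
  fixes G :: "('a \<Rightarrow> real) set" and V :: "'a set"
  assumes "finite V" "\<delta> > 0" "B > 0" "\<And>g v. g \<in> G \<Longrightarrow> v \<in> V \<Longrightarrow> \<bar>g v\<bar> \<le> B"
    and response: "\<And>w. (\<And>v. v \<in> V \<Longrightarrow> w v > 0) \<Longrightarrow> \<exists>g\<in>G. (\<Sum>v\<in>V. w v * g v) \<le> - \<delta> * (\<Sum>v\<in>V. w v)"
  shows "\<exists>T>0. \<exists>g. (\<forall>t<T. g t \<in> G) \<and> (\<forall>v\<in>V. (\<Sum>t<(T::nat). g t v) \<le> 0)"
proof -
  \<comment> \<open>The first term keeps \<open>\<eta> * g v\<close> within 1/2, the second keeps
    the quadratic loss at half of the drift \<open>\<eta> * \<delta>\<close>.\<close>
  define \<eta> where "\<eta> = min (1 / (2 * B)) (\<delta> / (4 * B\<^sup>2))"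
  have \<eta>: "\<eta> > 0" "\<eta> * B \<le> 1/2" "2 * \<eta> * B\<^sup>2 \<le> \<delta> / 2"
  proof -
    show "\<eta> > 0" using assms(2,3) by (simp add: \<eta>_def)
    have "\<eta> \<le> 1 / (2 * B)" by (simp add: \<eta>_def)
    then show "\<eta> * B \<le> 1/2" using assms(3) by (simp add: field_simps)
    have "\<eta> \<le> \<delta> / (4 * B\<^sup>2)" by (simp add: \<eta>_def)
    then show "2 * \<eta> * B\<^sup>2 \<le> \<delta> / 2" using assms(3) by (simp add: field_simps)
  qed
  have small: "\<bar>\<eta> * g v\<bar> \<le> 1/2" if "g \<in> G" "v \<in> V" for g v
  proof -
    have "\<bar>\<eta> * g v\<bar> = \<eta> * \<bar>g v\<bar>" using \<eta>(1) by (simp add: abs_mult)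
    also have "\<dots> \<le> \<eta> * B" using assms(4)[OF that] \<eta>(1) by (intro mult_left_mono) auto
    finally show ?thesis using \<eta>(2) by linarith
  qed
  have run: "\<exists>g. (\<forall>t<T. g t \<in> G) \<and>
      (\<Sum>v\<in>V. \<Prod>t<T. 1 + \<eta> * g t v) \<le> card V * exp (- (\<eta> * \<delta>)) ^ T" for T
  proof (induction T)
    case 0
    then show ?case by simp
  next
    case (Suc T)
    then obtain g where g: "\<forall>t<T. g t \<in> G"
      "(\<Sum>v\<in>V. \<Prod>t<T. 1 + \<eta> * g t v) \<le> card V * exp (- (\<eta> * \<delta>)) ^ T" by blast
    define w where "w v = (\<Prod>t<T. 1 + \<eta> * g t v)" for v
    have wpos: "w v > 0" if "v \<in> V" for v
      unfolding w_def
    proof (rule prod_pos)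
      fix t assume "t \<in> {..<T}"
      then have "\<bar>\<eta> * g t v\<bar> \<le> 1/2" using small[of "g t" v] g(1) that by simp
      then show "0 < 1 + \<eta> * g t v" by linarith
    qed
    obtain h where h: "h \<in> G" "(\<Sum>v\<in>V. w v * h v) \<le> - \<delta> * (\<Sum>v\<in>V. w v)"
      using response[of w] wpos by blast
    have nonneg: "0 \<le> (\<Sum>v\<in>V. w v)" by (rule sum_nonneg) (use wpos less_imp_le in blast)
    have "(\<Sum>v\<in>V. \<Prod>t<Suc T. 1 + \<eta> * (g(T := h)) t v) = (\<Sum>v\<in>V. w v * (1 + \<eta> * h v))"
      by (simp add: w_def)
    also have "\<dots> = (\<Sum>v\<in>V. w v) + \<eta> * (\<Sum>v\<in>V. w v * h v)"
      by (simp add: sum_distrib_left sum.distrib algebra_simps)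
    also have "\<dots> \<le> (\<Sum>v\<in>V. w v) + \<eta> * (- \<delta> * (\<Sum>v\<in>V. w v))"
      using mult_left_mono[OF h(2), of \<eta>] \<eta>(1) by simp
    also have "\<dots> = (\<Sum>v\<in>V. w v) * (1 + - (\<eta> * \<delta>))" by (simp add: algebra_simps)
    also have "\<dots> \<le> (\<Sum>v\<in>V. w v) * exp (- (\<eta> * \<delta>))"
      by (rule mult_left_mono[OF exp_ge_add_one_self nonneg])
    also have "\<dots> \<le> card V * exp (- (\<eta> * \<delta>)) ^ T * exp (- (\<eta> * \<delta>))"
      by (rule mult_right_mono) (use g(2) in \<open>simp_all add: w_def\<close>)
    finally have "(\<Sum>v\<in>V. \<Prod>t<Suc T. 1 + \<eta> * (g(T := h)) t v) \<le> card V * exp (- (\<eta> * \<delta>)) ^ Suc T"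
      by (simp add: mult_ac)
    moreover have "\<forall>t<Suc T. (g(T := h)) t \<in> G" using g(1) h(1) by (simp add: less_Suc_eq)
    ultimately show ?case by blast
  qed
  \<comment> \<open>So many rounds that \<open>exp (T * \<eta> * \<delta> / 2)\<close> exceeds the
    initial potential \<open>card V\<close>.\<close>
  obtain T where T: "real T * (\<eta> * \<delta> / 2) > real (card V)"
    using reals_Archimedean3[of "\<eta> * \<delta> / 2"] \<eta>(1) assms(2) by fastforce
  have "T > 0" using T by (cases T) auto
  obtain g where g: "\<forall>t<T. g t \<in> G" "(\<Sum>v\<in>V. \<Prod>t<T. 1 + \<eta> * g t v) \<le> card V * exp (- (\<eta> * \<delta>)) ^ T"
    using run[of T] by blast
  have "(\<Sum>t<T. g t v) \<le> 0" if v: "v \<in> V" for v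
  proof (rule ccontr)
    assume neg: "\<not> ?thesis"
    have sm: "\<bar>\<eta> * g t v\<bar> \<le> 1/2" if "t < T" for t using small[of "g t" v] g(1) that v by simp
    have "(\<Sum>t<T. 2 * (\<eta> * g t v)\<^sup>2) \<le> (\<Sum>t<T. 2 * (\<eta> * B)\<^sup>2)"
    proof (rule sum_mono)
      fix t assume "t \<in> {..<T}"
      then have "\<bar>g t v\<bar> \<le> \<bar>B\<bar>" using assms(4)[of "g t" v] assms(3) g(1) v by simp
      then have "(g t v)\<^sup>2 \<le> B\<^sup>2" by (rule abs_le_square_iff[THEN iffD1])
      then have "\<eta>\<^sup>2 * (g t v)\<^sup>2 \<le> \<eta>\<^sup>2 * B\<^sup>2" by (rule mult_left_mono) simp
      then show "2 * (\<eta> * g t v)\<^sup>2 \<le> 2 * (\<eta> * B)\<^sup>2" by (simp add: power_mult_distrib)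
    qed
    also have "\<dots> = real T * (\<eta> * (2 * \<eta> * B\<^sup>2))" by (simp add: power2_eq_square algebra_simps)
    also have "\<dots> \<le> real T * (\<eta> * (\<delta> / 2))"
      using \<eta>(1,3) by (intro mult_left_mono) auto
    finally have sq: "(\<Sum>t<T. 2 * (\<eta> * g t v)\<^sup>2) \<le> real T * (\<eta> * (\<delta> / 2))" .
    have "- (real T * (\<eta> * (\<delta> / 2))) \<le> \<eta> * (\<Sum>t<T. g t v) - (\<Sum>t<T. 2 * (\<eta> * g t v)\<^sup>2)"
    proof -
      have "0 \<le> \<eta> * (\<Sum>t<T. g t v)" using neg \<eta>(1) by simp
      then show ?thesis using sq by linarith
    qed
    also have "\<dots> = (\<Sum>t<T. \<eta> * g t v - 2 * (\<eta> * g t v)\<^sup>2)" by (simp add: sum_subtractf sum_distrib_left)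
    finally have "exp (- (real T * (\<eta> * (\<delta> / 2)))) \<le> exp (\<Sum>t<T. \<eta> * g t v - 2 * (\<eta> * g t v)\<^sup>2)" by simp
    also have "\<dots> = (\<Prod>t<T. exp (\<eta> * g t v - 2 * (\<eta> * g t v)\<^sup>2))" by (rule exp_sum) simp
    also have "\<dots> \<le> (\<Prod>t<T. 1 + \<eta> * g t v)"
      by (rule prod_mono) (use sm one_plus_ge_exp in simp)
    also have "\<dots> \<le> (\<Sum>v\<in>V. \<Prod>t<T. 1 + \<eta> * g t v)"
    proof (rule member_le_sum[OF v _ assms(1)])
      fix u assume u: "u \<in> V - {v}"
      show "0 \<le> (\<Prod>t<T. 1 + \<eta> * g t u)"
      proof (rule prod_nonneg)
        fix t assume "t \<in> {..<T}"
        then have "\<bar>\<eta> * g t u\<bar> \<le> 1/2" using small[of "g t" u] g(1) u by simp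
        then show "0 \<le> 1 + \<eta> * g t u" by linarith
      qed
    qed
    also have "\<dots> \<le> card V * exp (- (\<eta> * \<delta>)) ^ T" by (rule g(2))
    also have "\<dots> = card V * exp (- (real T * (\<eta> * \<delta>)))" by (simp add: exp_of_nat_mult[symmetric])
    finally have "exp (- (real T * (\<eta> * (\<delta> / 2)))) * exp (real T * (\<eta> * \<delta>)) \<le>
        card V * exp (- (real T * (\<eta> * \<delta>))) * exp (real T * (\<eta> * \<delta>))" by (rule mult_right_mono) simp
    then have "exp (real T * (\<eta> * \<delta> / 2)) \<le> card V" by (simp add: exp_add[symmetric] mult.assoc field_simps)
    moreover have "1 + real T * (\<eta> * \<delta> / 2) \<le> exp (real T * (\<eta> * \<delta> / 2))" by (rule exp_ge_add_one_self)
    ultimately show False using T by linarith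
  qed
  then show ?thesis using \<open>T > 0\<close> g(1) by blast
qed

section \<open>Fractional routing\<close>

text \<open>Of a shortest path only three features are kept: the common centre \<open>u0\<close>,
  through which any two paths can be joined, connectedness, and the cover by two independent sets,
  which bounds cliques.\<close>

definition path_system :: "('a \<times> 'a) set \<Rightarrow> 'a set \<Rightarrow> 'a \<Rightarrow> ('a \<Rightarrow> 'a set) \<Rightarrow> bool" where
  "path_system R V u0 Q \<longleftrightarrow> (\<forall>v\<in>V. v \<in> Q v \<and> u0 \<in> Q v \<and> Q v \<subseteq> V \<and> conn R (Q v) \<and>
     (\<exists>I J. Q v = I \<union> J \<and> indep R I \<and> indep R J))"

context wgraph
begin

text \<open>Shortest paths serve. For vertices of the central ball they weigh at most its radius.
  The fewer than \<open>n / K\<close> vertices outside may use weight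
  \<open>2 * (K * 2 ^ m)\<close>, as a path is covered by two independent sets; on average this adds
  only \<open>2 * 2 ^ m\<close>.\<close>

lemma routing_nat:
  assumes "finite V" "conn R V" "mu V \<le> K * 2 ^ m" "K * 2 ^ m < 2 ^ l" "4 \<le> K"
    and "\<not> separable R V K (K + 4 * m * K)"
  shows "\<exists>u0 Q. path_system R V u0 Q \<and> (\<Sum>v\<in>V. sum x (Q v)) \<le> card V * (2 ^ m * (3 * l + 7))"
proof -
  let ?W = "2 ^ m :: nat"
  let ?r = "3 * ?W * Suc l + 2 * ?W"
  obtain u0 where u0: "u0 \<in> V" "K * card (V - ball V u0 ?r) < card V"
    using central_ball[OF assms(1,3-6)] by blast
  define good where "good v Q \<longleftrightarrow> v \<in> Q \<and> u0 \<in> Q \<and> Q \<subseteq> V \<and> conn R Q \<and> (\<exists>I J. Q = I \<union> J \<and> indep R I \<and> indep R J) \<and>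
      (v \<in> ball V u0 ?r \<longrightarrow> sum x Q \<le> ?r) \<and> sum x Q \<le> 2 * (K * ?W)" for v Q
  have ex: "\<exists>Q. good v Q" if v: "v \<in> V" for v
  proof -
    define k where "k = (LEAST k. cost V u0 v k)"
    have k: "cost V u0 v k" unfolding k_def by (rule LeastI_ex[OF cost_exists[OF assms(2) u0(1) v]])
    have kmin: "k \<le> k'" if "cost V u0 v k'" for k' using Least_le[of "cost V u0 v" k'] that by (simp add: k_def)
    have "\<exists>I J. I \<subseteq> V \<and> J \<subseteq> V \<and> indep R I \<and> indep R J \<and> conn R (I \<union> J) \<and> u0 \<in> I \<union> J \<and> v \<in> I \<and> v \<notin> J \<and>
      finite I \<and> finite J \<and> sum x I + sum x J \<le> k \<and> (\<forall>w\<in>I \<union> J. w = v \<or> (\<exists>k'<k. cost V u0 w k'))"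
      by (rule shortest_path[OF k]) (erule kmin)
    then obtain I J where IJ: "I \<subseteq> V" "J \<subseteq> V" "indep R I" "indep R J" "conn R (I \<union> J)" "u0 \<in> I \<union> J" "v \<in> I"
      "finite I" "finite J" "sum x I + sum x J \<le> k"
      by (elim exE conjE)
    have sum: "sum x (I \<union> J) \<le> sum x I + sum x J" using sum_Un_nat[OF IJ(8,9), of x] by simp
    have "sum x (I \<union> J) \<le> ?r" if "v \<in> ball V u0 ?r"
    proof -
      have "\<exists>k'\<le>?r. cost V u0 v k'" using that by (simp only: ball_def mem_Collect_eq)
      then obtain k' where "k' \<le> ?r" "cost V u0 v k'" by (elim exE conjE)
      then have "k \<le> ?r" using kmin[of k'] by linarith
      then show ?thesis using sum IJ(10) by linarith
    qed
    moreover have "sum x (I \<union> J) \<le> 2 * (K * ?W)"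
      using sum max_weight_ge[OF assms(1) IJ(1,3), of x] max_weight_ge[OF assms(1) IJ(2,4), of x] assms(3) by linarith
    moreover have "I \<union> J \<subseteq> V" "v \<in> I \<union> J" using IJ(1,2,7) by auto
    moreover have "\<exists>I' J'. I \<union> J = I' \<union> J' \<and> indep R I' \<and> indep R J'" using IJ(3,4) by blast
    ultimately have "good v (I \<union> J)" unfolding good_def using IJ(5,6) by (intro conjI impI)
    then show ?thesis by (rule exI)
  qed
  then have "\<forall>v\<in>V. \<exists>Q. good v Q" by simp
  then obtain Q where good: "\<forall>v\<in>V. good v (Q v)" by (rule bchoice[THEN exE])
  then have "path_system R V u0 Q" unfolding path_system_def good_def by (intro ballI) simp
  moreover have "(\<Sum>v\<in>V. sum x (Q v)) \<le> card V * (?W * (3 * l + 7))"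
  proof -
    let ?B = "ball V u0 ?r"
    have BV: "?B \<subseteq> V" by (rule ball_subset)
    have "(\<Sum>v\<in>V. sum x (Q v)) = (\<Sum>v\<in>V - ?B. sum x (Q v)) + (\<Sum>v\<in>?B. sum x (Q v))"
      by (rule sum.subset_diff[OF BV assms(1)])
    also have "(\<Sum>v\<in>V - ?B. sum x (Q v)) \<le> of_nat (card (V - ?B)) * (2 * (K * ?W))"
      by (rule sum_bounded_above) (use good in \<open>simp add: good_def\<close>)
    also have "of_nat (card (V - ?B)) * (2 * (K * ?W)) = 2 * ?W * (K * card (V - ?B))" by simp
    also have "\<dots> \<le> 2 * ?W * card V" by (rule mult_le_mono2) (use u0(2) in simp)
    also have "(\<Sum>v\<in>?B. sum x (Q v)) \<le> of_nat (card ?B) * ?r"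
    proof (rule sum_bounded_above)
      fix v assume v: "v \<in> ?B"
      then have "v \<in> V" using BV by blast
      then show "sum x (Q v) \<le> ?r" using good v by (simp add: good_def)
    qed
    also have "of_nat (card ?B) * ?r \<le> card V * ?r"
      using card_mono[OF assms(1) BV] by (simp only: of_nat_id mult_le_mono1)
    finally have "(\<Sum>v\<in>V. sum x (Q v)) \<le> 2 * ?W * card V + card V * ?r" by simp
    \<comment> \<open>In units of \<open>?W\<close>, the radius gives \<open>3 * (l + 1) + 2\<close>
      and the outside 2 more.\<close>
    also have "\<dots> = card V * (?W * (3 * l + 7))" by (simp add: algebra_simps)
    finally show ?thesis .
  qed
  ultimately show ?thesis by blast
qed

end

text \<open>
  The real weights are scaled and rounded up to positive integers, with the heaviest independent set
  receiving weight about \<open>(K - 1) * 2 ^ m\<close>; the rounding costs at most \<open>card V \<le> 2 ^ m\<close>.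
\<close>

lemma routing_real:
  fixes w :: "'a \<Rightarrow> real"
  assumes "sym R" "\<And>v. (v, v) \<notin> R" "finite V" "conn R V" "card V \<le> 2 ^ m" "K * 2 ^ m < 2 ^ l" "4 \<le> K"
    and "\<not> separable R V K (K + 4 * m * K)" and w: "\<And>v. v \<in> V \<Longrightarrow> w v > 0"
  shows "\<exists>u0 Q I. path_system R V u0 Q \<and> I \<subseteq> V \<and> indep R I \<and>
    (\<Sum>v\<in>V. sum w (Q v)) \<le> card V * (real (3 * l + 7) / real (K - 1)) * sum w I \<and> sum w V \<le> card V * sum w I"
proof -
  let ?W = "2 ^ m :: nat"
  let ?J = "{J. J \<subseteq> V \<and> indep R J}"
  have finJ: "finite (sum w ` ?J)" using assms(3) by simp
  have "{} \<in> ?J" by simp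
  then have "Max (sum w ` ?J) \<in> sum w ` ?J" using finJ by (intro Max_in) auto
  then obtain I where I: "I \<subseteq> V" "indep R I" "sum w I = Max (sum w ` ?J)" by auto
  define \<mu> where "\<mu> = sum w I"
  have \<mu>: "sum w J \<le> \<mu>" if "J \<subseteq> V" "indep R J" for J
    unfolding \<mu>_def I(3) by (rule Max_ge[OF finJ]) (use that in blast)
  have single: "w v \<le> \<mu>" if "v \<in> V" for v
    using \<mu>[of "{v}"] that assms(2) by (simp add: indep_def)
  obtain v0 where "v0 \<in> V" using assms(4) by (auto simp: conn_def)
  then have \<mu>pos: "\<mu> > 0" using single w less_le_trans by blast
  define c where "c = real (K - 1) * real ?W / \<mu>"
  have cpos: "c > 0" using \<mu>pos assms(7) by (simp add: c_def)
  define x where "x v = (if v \<in> V then nat \<lceil>c * w v\<rceil> else 1)" for v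
  have xV: "x v > 0 \<and> c * w v \<le> real (x v) \<and> real (x v) \<le> c * w v + 1" if "v \<in> V" for v
  proof -
    have "c * w v > 0" using cpos w[OF that] by simp
    then have "\<lceil>c * w v\<rceil> > 0" by simp
    then have "real (x v) = of_int \<lceil>c * w v\<rceil>" "x v > 0" using that by (simp_all add: x_def)
    then show ?thesis by linarith
  qed
  interpret wgraph R x
  proof
    show "0 < x v" for v using xV[of v] by (cases "v \<in> V") (auto simp: x_def)
  qed (use assms(1,2) in auto)
  have mu: "mu V \<le> K * ?W"
  proof (rule max_weight_le[OF assms(3)])
    fix J assume J: "J \<subseteq> V" "indep R J"
    have "real (sum x J) = (\<Sum>v\<in>J. real (x v))" by simp
    also have "\<dots> \<le> (\<Sum>v\<in>J. c * w v + 1)" by (rule sum_mono) (use xV J(1) in blast)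
    also have "\<dots> = c * sum w J + real (card J)" by (simp add: sum.distrib sum_distrib_left)
    also have "\<dots> \<le> c * \<mu> + real ?W"
    proof (rule add_mono)
      show "c * sum w J \<le> c * \<mu>" using \<mu>[OF J] cpos by simp
      have "card J \<le> ?W" using card_mono[OF assms(3) J(1)] assms(5) by simp
      then show "real (card J) \<le> real ?W" by (rule of_nat_mono)
    qed
    also have "\<dots> = real (K - 1) * real ?W + real ?W" using \<mu>pos by (simp add: c_def)
    also have "\<dots> = (real (K - 1) + 1) * real ?W" by (simp add: distrib_right)
    also have "real (K - 1) + 1 = real K" using assms(7) by (simp add: of_nat_diff)
    finally have "real (sum x J) \<le> real (K * ?W)" by simp
    then show "sum x J \<le> K * ?W" by (simp only: of_nat_le_iff)
  qed
  obtain u0 Q where Q: "path_system R V u0 Q" "(\<Sum>v\<in>V. sum x (Q v)) \<le> card V * (?W * (3 * l + 7))"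
    using routing_nat[OF assms(3,4) mu assms(6-8)] by blast
  have "c * (\<Sum>v\<in>V. sum w (Q v)) = (\<Sum>v\<in>V. \<Sum>y\<in>Q v. c * w y)" by (simp add: sum_distrib_left)
  also have "\<dots> \<le> (\<Sum>v\<in>V. \<Sum>y\<in>Q v. real (x y))"
  proof (intro sum_mono)
    fix v y assume "v \<in> V" "y \<in> Q v"
    then have "y \<in> V" using Q(1) unfolding path_system_def by blast
    then show "c * w y \<le> real (x y)" using xV by blast
  qed
  also have "\<dots> = real (\<Sum>v\<in>V. sum x (Q v))" by simp
  also have "\<dots> \<le> real (card V * (?W * (3 * l + 7)))" using Q(2) by (rule of_nat_mono)
  finally have "(\<Sum>v\<in>V. sum w (Q v)) \<le> real (card V * (?W * (3 * l + 7))) / c"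
    using cpos by (simp add: pos_le_divide_eq mult.commute)
  also have "\<dots> = card V * (real (3 * l + 7) / real (K - 1)) * \<mu>"
    using \<mu>pos assms(7) by (simp add: c_def field_simps)
  finally have "(\<Sum>v\<in>V. sum w (Q v)) \<le> card V * (real (3 * l + 7) / real (K - 1)) * \<mu>" .
  moreover have "sum w V \<le> card V * \<mu>" using sum_bounded_above[of V w \<mu>] single by simp
  ultimately show ?thesis using Q(1) I(1,2) unfolding \<mu>_def
    by (intro exI[of _ u0] exI[of _ Q] exI[of _ I] conjI)
qed

text \<open>
  The congestion of a vertex is bounded by the probability that it lies in a random independent set:
  this is the dual of the statement that every weighting admits short paths.
\<close>

lemma fractional_routing:
  assumes "sym R" "\<And>v. (v, v) \<notin> R" "finite V" "conn R V" "card V \<le> 2 ^ m" "K * 2 ^ m < 2 ^ l" "4 \<le> K"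
    and "\<not> separable R V K (K + 4 * m * K)"
  shows "\<exists>T>0. \<exists>u Q I. (\<forall>t<T. path_system R V (u t) (Q t) \<and> I t \<subseteq> V \<and> indep R (I t)) \<and>
    (\<forall>y\<in>V. real (\<Sum>t<(T::nat). card {v\<in>V. y \<in> Q t v}) \<le>
       2 * (real (3 * l + 7) / real (K - 1)) * card V * card {t. t < T \<and> y \<in> I t})"
proof -
  let ?n = "real (card V)"
  have npos: "?n > 0" using assms(3,4) by (auto simp: conn_def card_gt_0_iff)
  define \<kappa> :: real where "\<kappa> = real (3 * l + 7) / real (K - 1)"
  have \<kappa>: "\<kappa> > 0" using assms(7) by (simp add: \<kappa>_def)
  \<comment> \<open>Congestion minus a reward on \<open>I\<close>. A reward of
    \<open>\<kappa>\<close> would just balance the bound of \<open>routing_real\<close>; doubling it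
    leaves the surplus \<open>\<kappa> * sum w I\<close>, the slack that
    \<open>multiplicative_weights\<close> demands.\<close>
  define gain where "gain Q I y = real (card {v\<in>V. y \<in> Q v}) / ?n - 2 * \<kappa> * of_bool (y \<in> I)"
    for Q :: "'a \<Rightarrow> 'a set" and I :: "'a set" and y
  define G where "G = {gain Q I | u0 Q I. path_system R V u0 Q \<and> I \<subseteq> V \<and> indep R I}"
  have "\<exists>T>0. \<exists>g. (\<forall>t<T. g t \<in> G) \<and> (\<forall>v\<in>V. (\<Sum>t<(T::nat). g t v) \<le> 0)"
  proof (rule multiplicative_weights[OF assms(3)])
    show "\<kappa> / ?n > 0" using \<kappa> npos by simp
    show "1 + 2 * \<kappa> > 0" using \<kappa> by simp
    show "\<bar>g v\<bar> \<le> 1 + 2 * \<kappa>" if g: "g \<in> G" for g v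
    proof -
      obtain Q I where gQ: "g = gain Q I" using g by (auto simp: G_def)
      have "card {u\<in>V. v \<in> Q u} \<le> card V" by (rule card_mono[OF assms(3)]) auto
      then have "real (card {u\<in>V. v \<in> Q u}) / ?n \<le> 1" using npos by simp
      moreover have "0 \<le> real (card {u\<in>V. v \<in> Q u}) / ?n" by simp
      moreover have "0 \<le> 2 * \<kappa> * of_bool (v \<in> I)" "2 * \<kappa> * of_bool (v \<in> I) \<le> 2 * \<kappa>"
        using \<kappa> by simp_all
      ultimately show ?thesis unfolding gQ gain_def by linarith
    qed
    fix w :: "'a \<Rightarrow> real" assume w: "\<And>v. v \<in> V \<Longrightarrow> w v > 0"
    have "\<exists>u0 Q I. path_system R V u0 Q \<and> I \<subseteq> V \<and> indep R I \<and>
      (\<Sum>v\<in>V. sum w (Q v)) \<le> card V * \<kappa> * sum w I \<and> sum w V \<le> card V * sum w I"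
      unfolding \<kappa>_def by (rule routing_real[OF assms]) (rule w)
    then obtain u0 Q I where Q: "path_system R V u0 Q" "I \<subseteq> V" "indep R I"
      "(\<Sum>v\<in>V. sum w (Q v)) \<le> card V * \<kappa> * sum w I" "sum w V \<le> card V * sum w I"
      by (elim exE conjE)
    have QV: "Q v \<subseteq> V" if "v \<in> V" for v using Q(1) that unfolding path_system_def by blast
    have 1: "(\<Sum>y\<in>V. w y * real (card {v\<in>V. y \<in> Q v})) = (\<Sum>v\<in>V. sum w (Q v))"
    proof -
      have "(\<Sum>y\<in>V. w y * real (card {v\<in>V. y \<in> Q v})) = (\<Sum>y\<in>V. \<Sum>v\<in>V. w y * of_bool (y \<in> Q v))"
        using assms(3) by (intro sum.cong refl) (simp add: sum_distrib_left[symmetric] sum_of_bool_eq Collect_conj_eq)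
      also have "\<dots> = (\<Sum>v\<in>V. \<Sum>y\<in>V. w y * of_bool (y \<in> Q v))" by (rule sum.swap)
      also have "\<dots> = (\<Sum>v\<in>V. sum w (Q v))"
      proof (rule sum.cong[OF refl])
        fix v assume "v \<in> V"
        have "(\<Sum>y\<in>V. w y * of_bool (y \<in> Q v)) = sum w (V \<inter> Q v)"
          using sum_mult_of_bool_eq[OF assms(3), of w "\<lambda>y. y \<in> Q v"] by simp
        then show "(\<Sum>y\<in>V. w y * of_bool (y \<in> Q v)) = sum w (Q v)" using QV[OF \<open>v \<in> V\<close>] by (simp add: Int_absorb1)
      qed
      finally show ?thesis .
    qed
    have 2: "(\<Sum>y\<in>V. w y * of_bool (y \<in> I)) = sum w I"
    proof -
      have "(\<Sum>y\<in>V. w y * of_bool (y \<in> I)) = sum w (V \<inter> I)"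
        using sum_mult_of_bool_eq[OF assms(3), of w "\<lambda>y. y \<in> I"] by simp
      then show ?thesis using Q(2) by (simp add: Int_absorb1)
    qed
    have "(\<Sum>y\<in>V. w y * gain Q I y)
        = (\<Sum>y\<in>V. w y * real (card {v\<in>V. y \<in> Q v})) / ?n - 2 * \<kappa> * (\<Sum>y\<in>V. w y * of_bool (y \<in> I))"
      by (simp add: gain_def right_diff_distrib sum_subtractf sum_divide_distrib sum_distrib_left mult_ac)
    also have "\<dots> = (\<Sum>v\<in>V. sum w (Q v)) / ?n - 2 * \<kappa> * sum w I" by (simp only: 1 2)
    also have "\<dots> \<le> \<kappa> * sum w I - 2 * \<kappa> * sum w I"
    proof -
      have "(\<Sum>v\<in>V. sum w (Q v)) / ?n \<le> \<kappa> * sum w I" using Q(4) npos by (simp add: pos_divide_le_eq mult_ac)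
      then show ?thesis by simp
    qed
    also have "\<dots> = - (\<kappa> * sum w I)" by simp
    \<comment> \<open>As \<open>sum w I\<close> is at least the average weight, the surplus becomes
      proportional to the total weight.\<close>
    also have "\<dots> \<le> - (\<kappa> / ?n) * sum w V"
    proof -
      have "\<kappa> * sum w V \<le> \<kappa> * (?n * sum w I)" using Q(5) \<kappa> by (intro mult_left_mono) auto
      then have "\<kappa> / ?n * sum w V \<le> \<kappa> * sum w I" using npos by (simp add: field_simps)
      then show ?thesis by simp
    qed
    finally have "(\<Sum>y\<in>V. w y * gain Q I y) \<le> - (\<kappa> / ?n) * sum w V" .
    moreover have "gain Q I \<in> G" using Q(1-3) unfolding G_def by blast
    ultimately show "\<exists>g\<in>G. (\<Sum>v\<in>V. w v * g v) \<le> - (\<kappa> / ?n) * sum w V" by blast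
  qed
  then obtain T :: nat and g where T: "T > 0" and gG: "\<forall>t<T. g t \<in> G" and sum: "\<forall>v\<in>V. (\<Sum>t<T. g t v) \<le> 0"
    by blast
  have "\<forall>t\<in>{..<T}. \<exists>p. g t = gain (fst (snd p)) (snd (snd p)) \<and> path_system R V (fst p) (fst (snd p)) \<and>
      snd (snd p) \<subseteq> V \<and> indep R (snd (snd p))"
    using gG unfolding G_def by fastforce
  then obtain p where p: "\<forall>t\<in>{..<T}. g t = gain (fst (snd (p t))) (snd (snd (p t))) \<and>
      path_system R V (fst (p t)) (fst (snd (p t))) \<and> snd (snd (p t)) \<subseteq> V \<and> indep R (snd (snd (p t)))"
    by (rule bchoice[THEN exE])
  define u where "u t = fst (p t)" for t
  define Q where "Q t = fst (snd (p t))" for t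
  define I where "I t = snd (snd (p t))" for t
  have P: "g t = gain (Q t) (I t)" "path_system R V (u t) (Q t) \<and> I t \<subseteq> V \<and> indep R (I t)" if "t < T" for t
    using p that by (simp_all add: u_def Q_def I_def)
  have "real (\<Sum>t<T. card {v\<in>V. y \<in> Q t v}) \<le> 2 * \<kappa> * card V * card {t. t < T \<and> y \<in> I t}" if y: "y \<in> V" for y
  proof -
    have "0 \<ge> (\<Sum>t<T. g t y)" using sum y by blast
    also have "(\<Sum>t<T. g t y) = (\<Sum>t<T. gain (Q t) (I t) y)" by (rule sum.cong) (simp_all add: P(1))
    also have "\<dots> = (\<Sum>t<T. real (card {v\<in>V. y \<in> Q t v})) / ?n - 2 * \<kappa> * (\<Sum>t<T. of_bool (y \<in> I t))"
      by (simp add: gain_def sum_subtractf sum_divide_distrib sum_distrib_left)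
    also have "(\<Sum>t<T. of_bool (y \<in> I t) :: real) = card {t. t < T \<and> y \<in> I t}"
      using sum_of_bool_eq[of "{..<T}" "\<lambda>t. y \<in> I t"] by (simp add: lessThan_def Collect_conj_eq)
    finally show ?thesis using npos by (simp add: field_simps)
  qed
  then have "\<forall>y\<in>V. real (\<Sum>t<T. card {v\<in>V. y \<in> Q t v}) \<le> 2 * \<kappa> * card V * card {t. t < T \<and> y \<in> I t}"
    by (rule ballI)
  moreover have "\<forall>t<T. path_system R V (u t) (Q t) \<and> I t \<subseteq> V \<and> indep R (I t)" using P(2) by simp
  ultimately show ?thesis using T unfolding \<kappa>_def
    by (intro exI[of _ T] exI[of _ u] exI[of _ Q] exI[of _ I] conjI)
qed

section \<open>Recursive separation and counting\<close>

lemma alpha_le_Un: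
  assumes "alpha_le R a X" "alpha_le R b Y"
  shows "alpha_le R (a + b) (X \<union> Y)"
  unfolding alpha_le_def
proof (intro allI impI)
  fix J assume J: "J \<subseteq> X \<union> Y" "indep R J"
  have "indep R (J \<inter> X)" "indep R (J - X)" using J(2) unfolding indep_def by blast+
  moreover have "J \<inter> X \<subseteq> X" "J - X \<subseteq> Y" using J(1) by blast+
  ultimately have "card (J \<inter> X) \<le> a" "card (J - X) \<le> b" using assms unfolding alpha_le_def by blast+
  moreover have "card J \<le> card (J \<inter> X) + card (J - X)"
    using card_Un_le[of "J \<inter> X" "J - X"] by (simp add: Int_Diff_Un)
  ultimately show "card J \<le> a + b" by simp
qed

text \<open>The number \<open>j\<close> of rounds satisfies \<open>n * (1 - 1/K) ^ j < 1\<close>. A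
  disconnected set splits at no cost; in the connected case the separator joins every bag and one
  round is spent.\<close>

lemma tdec_recursion:
  assumes "sym R" "finite V0"
    and sep: "\<And>V. V \<subseteq> V0 \<Longrightarrow> conn R V \<Longrightarrow> separable R V K d" and "K > 0"
  shows "V \<subseteq> V0 \<Longrightarrow> card V * (K - 1) ^ j < K ^ j \<Longrightarrow> tdec R V (alpha_le R (d * j))"
proof (induction "card V" arbitrary: V j rule: less_induct)
  case less
  have finV: "finite V" by (rule finite_subset[OF less.prems(1) assms(2)])
  show ?case
  proof (cases "V = {}")
    case True
    then show ?thesis by (intro tdec_trivial) (simp add: alpha_le_def)
  next
    case ne: False
    show ?thesis
    proof (cases "conn R V")
      case False
      then obtain u v where uv: "u \<in> V" "v \<in> V" "(u, v) \<notin> rtrancl_on V R" using ne by (auto simp: conn_def)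
      define A where "A = {y. (u, y) \<in> rtrancl_on V R}"
      have AV: "A \<subseteq> V" unfolding A_def using in_rtrancl_on_in_F(2) by fast
      have uA: "u \<in> A" using uv(1) by (simp add: A_def)
      have vA: "v \<notin> A" using uv(3) by (simp add: A_def)
      have no: "(a, b) \<notin> R" if "a \<in> A" "b \<in> V - A" for a b
      proof
        assume "(a, b) \<in> R"
        then have "(u, b) \<in> rtrancl_on V R"
          using that rtrancl_on_into_rtrancl_on[of u a V R b] by (simp add: A_def)
        then show False using that(2) by (simp add: A_def)
      qed
      have sub: "tdec R W (alpha_le R (d * j))" if "W \<subset> V" for W
      proof (rule less.hyps)
        show "card W < card V" by (rule psubset_card_mono[OF finV that])
        then have "card W * (K - 1) ^ j \<le> card V * (K - 1) ^ j" by (intro mult_le_mono1) simp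
        then show "card W * (K - 1) ^ j < K ^ j" using less.prems(2) by (rule le_less_trans)
        show "W \<subseteq> V0" using that less.prems(1) by blast
      qed
      have "tdec R (A \<union> (V - A)) (alpha_le R (d * j))"
      proof (rule tdec_join)
        show "tdec R A (alpha_le R (d * j))" by (rule sub) (use AV vA uv(2) in blast)
        show "tdec R (V - A) (alpha_le R (d * j))" by (rule sub) (use uA uv(1) in blast)
        show "(a, b) \<notin> R \<and> (b, a) \<notin> R" if "a \<in> A" "b \<in> V - A" for a b
          using no[OF that] symD[OF assms(1), of b a] by blast
      qed simp
      then show ?thesis using AV by (simp add: Un_absorb1)
    next
      case True
      from sep[OF less.prems(1) True] obtain A B X where S: "V = A \<union> B \<union> X" "A \<inter> B = {}"
        "\<forall>a\<in>A. \<forall>b\<in>B. (a, b) \<notin> R" "alpha_le R d X"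
        "K * card A \<le> (K - 1) * card V" "K * card B \<le> (K - 1) * card V"
        unfolding separable_def by (elim exE conjE)
      have cV: "card V > 0" using ne finV by (simp add: card_gt_0_iff)
      \<comment> \<open>For \<open>j = 0\<close> the size bound would force \<open>V\<close> to be
        empty.\<close>
      obtain i where i: "j = Suc i"
        using less.prems(2) cV by (cases j) auto
      have sub: "tdec R W (alpha_le R (d * i))" if W: "W \<subseteq> V" "K * card W \<le> (K - 1) * card V" for W
      proof (rule less.hyps)
        have "(K - 1) * card V < K * card V" using cV assms(4) by simp
        with W(2) have "K * card W < K * card V" by (rule le_less_trans)
        then show "card W < card V" by simp
        have "K * (card W * (K - 1) ^ i) \<le> (K - 1) * card V * (K - 1) ^ i"
          using mult_le_mono1[OF W(2), of "(K - 1) ^ i"] by (simp add: mult.assoc)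
        also have "\<dots> < K * K ^ i" using less.prems(2) by (simp add: i mult_ac)
        finally show "card W * (K - 1) ^ i < K ^ i" by simp
        show "W \<subseteq> V0" using W(1) less.prems(1) by blast
      qed
      have "tdec R (A \<union> B) (alpha_le R (d * i))"
      proof (rule tdec_join)
        show "tdec R A (alpha_le R (d * i))" by (rule sub[OF _ S(5)]) (use S(1) in blast)
        show "tdec R B (alpha_le R (d * i))" by (rule sub[OF _ S(6)]) (use S(1) in blast)
        show "(a, b) \<notin> R \<and> (b, a) \<notin> R" if "a \<in> A" "b \<in> B" for a b
          using S(3) that symD[OF assms(1), of b a] by blast
      qed (rule S(2))
      then have "tdec R (A \<union> B \<union> X) (alpha_le R (d * j))"
      proof (rule tdec_add[OF _ _ assms(1)])
        fix C assume "alpha_le R (d * i) C"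
        then have "alpha_le R (d * i + d) (C \<union> X)" by (rule alpha_le_Un[OF _ S(4)])
        then show "alpha_le R (d * j) (C \<union> X)" by (simp add: i add.commute)
      qed
      then show ?thesis using S(1) by simp
    qed
  qed
qed

text \<open>Values may repeat, so one notion covers many segments through one vertex as well as many
  segments meeting one clique.\<close>

definition weak_clique :: "('a \<times> 'a) set \<Rightarrow> 'b set \<Rightarrow> ('b \<Rightarrow> 'a) \<Rightarrow> bool" where
  "weak_clique R F f \<longleftrightarrow> (\<forall>e\<in>F. \<forall>e'\<in>F. f e = f e' \<or> (f e, f e') \<in> R)"

text \<open>
  A degeneracy count: split according to whether \<open>f\<close> uses a vertex of low degree, whose closed
  neighbourhood then contains all values of \<open>f\<close>.
\<close>

lemma card_weak_clique_le:
  assumes "finite F" "F \<noteq> {}" "finite U"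
    and "\<And>W. W \<subseteq> U \<Longrightarrow> W \<noteq> {} \<Longrightarrow> \<exists>v\<in>W. card {u\<in>W. u = v \<or> (v, u) \<in> R} \<le> D"
  shows "card {f \<in> PiE F (\<lambda>_. U). weak_clique R F f} \<le> card U * (card F * D ^ (card F - 1))"
  using assms(3,4)
proof (induction "card U" arbitrary: U rule: less_induct)
  case less
  show ?case
  proof (cases "U = {}")
    case True
    then have "{f \<in> PiE F (\<lambda>_. U). weak_clique R F f} = {}" using assms(2) by (auto simp: PiE_eq_empty_iff)
    then show ?thesis by (metis card.empty zero_le)
  next
    case False
    then obtain v where v: "v \<in> U" "card {u\<in>U. u = v \<or> (v, u) \<in> R} \<le> D" using less.prems(2)[of U] by blast
    let ?N = "{u\<in>U. u = v \<or> (v, u) \<in> R}" and ?U = "U - {v}"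
    let ?S = "\<lambda>U. {f \<in> PiE F (\<lambda>_. U). weak_clique R F f}"
    \<comment> \<open>Once \<open>e\<close> is sent to \<open>v\<close>, the other
      \<open>card F - 1\<close> values lie in a closed neighbourhood of at most \<open>D\<close>
      vertices.\<close>
    let ?T = "\<lambda>e. PiE F (\<lambda>e'. if e' = e then {v} else ?N)"
    have finT: "finite (?T e)" for e by (rule finite_PiE[OF assms(1)]) (use less.prems(1) in simp)
    have cT: "card (?T e) \<le> D ^ (card F - 1)" if e: "e \<in> F" for e
    proof -
      have "card (?T e) = (\<Prod>e'\<in>F. card (if e' = e then {v} else ?N))" by (rule card_PiE[OF assms(1)])
      also have "\<dots> = (\<Prod>e'\<in>F - {e}. card ?N)"
        using assms(1) e by (simp add: prod.remove[of F e])
      also have "\<dots> = card ?N ^ (card F - 1)" using e assms(1) by simp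
      also have "\<dots> \<le> D ^ (card F - 1)" by (rule power_mono[OF v(2)]) simp
      finally show ?thesis .
    qed
    have "card (?S ?U) \<le> card ?U * (card F * D ^ (card F - 1))"
    proof (rule less.hyps)
      show "card ?U < card U" using v(1) less.prems(1) by (rule card_Diff1_less[rotated])
      show "finite ?U" using less.prems(1) by simp
      show "\<exists>v\<in>W. card {u\<in>W. u = v \<or> (v, u) \<in> R} \<le> D" if "W \<subseteq> ?U" "W \<noteq> {}" for W
        using less.prems(2)[of W] that by blast
    qed
    moreover have "card (\<Union>e\<in>F. ?T e) \<le> card F * D ^ (card F - 1)"
    proof -
      have "card (\<Union>e\<in>F. ?T e) \<le> (\<Sum>e\<in>F. card (?T e))" by (rule card_UN_le[OF assms(1)])
      also have "\<dots> \<le> of_nat (card F) * D ^ (card F - 1)" by (rule sum_bounded_above) (rule cT)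
      finally show ?thesis by simp
    qed
    moreover have "?S U \<subseteq> ?S ?U \<union> (\<Union>e\<in>F. ?T e)"
    proof
      fix f assume f: "f \<in> ?S U"
      then have fU: "f \<in> PiE F (\<lambda>_. U)" and fw: "weak_clique R F f" by auto
      show "f \<in> ?S ?U \<union> (\<Union>e\<in>F. ?T e)"
      proof (cases "\<exists>e\<in>F. f e = v")
        case True
        then obtain e where e: "e \<in> F" "f e = v" by blast
        have "f e' \<in> ?N" if "e' \<in> F" for e'
        proof -
          have "f e' \<in> U" using fU that by (rule PiE_mem)
          moreover have "f e' = v \<or> (v, f e') \<in> R" using fw e that unfolding weak_clique_def by metis
          ultimately show ?thesis by simp
        qed
        then have "f \<in> ?T e" using fU e(2) by (auto simp: PiE_iff)
        then show ?thesis using e(1) by blast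
      next
        case False
        then have "f \<in> PiE F (\<lambda>_. ?U)" using fU by (auto simp: PiE_iff)
        then show ?thesis using fw by simp
      qed
    qed
    then have "card (?S U) \<le> card (?S ?U \<union> (\<Union>e\<in>F. ?T e))"
      by (rule card_mono[rotated]) (use assms(1) less.prems(1) finT in \<open>simp add: finite_PiE\<close>)
    then have "card (?S U) \<le> card (?S ?U) + card (\<Union>e\<in>F. ?T e)" using card_Un_le order_trans by blast
    moreover have "card U = Suc (card ?U)" using v(1) less.prems(1) by (simp only: card_Suc_Diff1)
    ultimately show ?thesis by simp
  qed
qed

text \<open>
  Independence, in terms of cardinalities, of events that depend on disjoint pairs of coordinates of a
  uniformly random function.
\<close>

lemma card_PiE_pairs:
  assumes "finite F" "finite X" "finite Y" "\<And>e. e \<in> F \<Longrightarrow> a e \<in> X \<and> b e \<in> X"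
    "inj_on a F" "inj_on b F" "a ` F \<inter> b ` F = {}"
  shows "card {\<psi> \<in> PiE X (\<lambda>_. Y). \<forall>e\<in>F. P e (\<psi> (a e)) (\<psi> (b e))} * card Y ^ (2 * card F)
    \<le> card Y ^ card X * (\<Prod>e\<in>F. card {p \<in> Y \<times> Y. P e (fst p) (snd p)})"
  using assms
proof (induction F arbitrary: X rule: finite_induct)
  case empty
  then show ?case by (simp add: card_PiE)
next
  case (insert e F)
  let ?X = "X - {a e, b e}"
  let ?S = "{\<psi> \<in> PiE X (\<lambda>_. Y). \<forall>e\<in>insert e F. P e (\<psi> (a e)) (\<psi> (b e))}"
  let ?S' = "{\<psi> \<in> PiE ?X (\<lambda>_. Y). \<forall>e\<in>F. P e (\<psi> (a e)) (\<psi> (b e))}"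
  let ?C = "{p \<in> Y \<times> Y. P e (fst p) (snd p)}"
  have ab: "a e \<in> X" "b e \<in> X" "a e \<noteq> b e" using insert.prems(3,6) by blast+
  have ab': "a e' \<in> ?X \<and> b e' \<in> ?X" if "e' \<in> F" for e'
  proof -
    have "e' \<noteq> e" using that insert.hyps(2) by blast
    then have "a e' \<noteq> a e" "b e' \<noteq> b e" using insert.prems(4,5) that by (auto simp: inj_on_def)
    moreover have "a e' \<noteq> b e" "b e' \<noteq> a e" using insert.prems(6) that by blast+
    ultimately show ?thesis using insert.prems(3) that by blast
  qed
  have IH: "card ?S' * card Y ^ (2 * card F) \<le> card Y ^ card ?X * (\<Prod>e\<in>F. card {p \<in> Y \<times> Y. P e (fst p) (snd p)})"
    using insert.prems ab' by (intro insert.IH) (auto simp: inj_on_def)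
  \<comment> \<open>The two coordinates used by \<open>e\<close> are split off; injectivity is
    enough for an upper bound.\<close>
  let ?h = "\<lambda>\<psi>. ((\<psi> (a e), \<psi> (b e)), restrict \<psi> ?X)"
  have inj: "inj_on ?h ?S"
  proof (rule inj_onI)
    fix \<psi> \<phi> assume \<psi>: "\<psi> \<in> ?S" and \<phi>: "\<phi> \<in> ?S" and eq: "?h \<psi> = ?h \<phi>"
    show "\<psi> = \<phi>"
    proof (rule PiE_ext)
      show "\<psi> \<in> PiE X (\<lambda>_. Y)" "\<phi> \<in> PiE X (\<lambda>_. Y)" using \<psi> \<phi> by auto
      fix z assume "z \<in> X"
      have "restrict \<psi> ?X z = restrict \<phi> ?X z" using eq by simp
      then show "\<psi> z = \<phi> z" using eq \<open>z \<in> X\<close> by (cases "z = a e"; cases "z = b e") auto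
    qed
  qed
  have img: "?h ` ?S \<subseteq> ?C \<times> ?S'"
  proof
    fix y assume "y \<in> ?h ` ?S"
    then obtain \<psi> where \<psi>: "\<psi> \<in> PiE X (\<lambda>_. Y)" "\<And>e'. e' \<in> insert e F \<Longrightarrow> P e' (\<psi> (a e')) (\<psi> (b e'))"
      and y: "y = ?h \<psi>" by blast
    have "\<psi> (a e) \<in> Y" "\<psi> (b e) \<in> Y" using PiE_mem[OF \<psi>(1)] ab by auto
    then have "(\<psi> (a e), \<psi> (b e)) \<in> ?C" using \<psi>(2)[of e] by simp
    moreover have "restrict \<psi> ?X \<in> PiE ?X (\<lambda>_. Y)" using PiE_mem[OF \<psi>(1)] by (auto simp: PiE_iff)
    moreover have "P e' (restrict \<psi> ?X (a e')) (restrict \<psi> ?X (b e'))" if "e' \<in> F" for e'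
      using \<psi>(2)[of e'] ab'[OF that] that by simp
    ultimately show "y \<in> ?C \<times> ?S'" unfolding y by simp
  qed
  have "card ?S = card (?h ` ?S)" by (rule card_image[OF inj, symmetric])
  also have "\<dots> \<le> card (?C \<times> ?S')"
  proof (rule card_mono[OF _ img])
    have "finite (PiE ?X (\<lambda>_. Y))" by (rule finite_PiE) (use insert.prems(1,2) in auto)
    then have "finite ?S'" by simp
    moreover have "finite ?C" using insert.prems(2) by simp
    ultimately show "finite (?C \<times> ?S')" by (rule finite_cartesian_product[rotated])
  qed
  finally have 1: "card ?S \<le> card ?C * card ?S'" by (simp add: card_cartesian_product)
  have cX: "card X = card ?X + 2"
  proof -
    have "card ?X = card X - card {a e, b e}" by (rule card_Diff_subset) (use ab in auto)
    moreover have "card {a e, b e} \<le> card X" by (rule card_mono) (use ab insert.prems(1) in auto)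
    ultimately show ?thesis using ab(3) by simp
  qed
  have "card ?S * card Y ^ (2 * card (insert e F)) \<le> card ?C * card ?S' * card Y ^ (2 * card (insert e F))"
    by (rule mult_le_mono1[OF 1])
  also have "\<dots> = card ?C * card Y ^ 2 * (card ?S' * card Y ^ (2 * card F))"
    using insert.hyps by (simp add: power_add power2_eq_square mult_ac)
  also have "\<dots> \<le> card ?C * card Y ^ 2 * (card Y ^ card ?X * (\<Prod>e\<in>F. card {p \<in> Y \<times> Y. P e (fst p) (snd p)}))"
    by (rule mult_le_mono2[OF IH])
  also have "\<dots> = card Y ^ card X * (\<Prod>e\<in>insert e F. card {p \<in> Y \<times> Y. P e (fst p) (snd p)})"
    using insert.hyps unfolding cX by (simp add: power_add power2_eq_square mult_ac)
  finally show ?case .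
qed

section \<open>Sampling a grid of paths\<close>

lemma cliq_indep_card_le_1:
  assumes "cliq R K" "indep R I" "finite K"
  shows "card (K \<inter> I) \<le> 1"
proof -
  have "a = b" if "a \<in> K \<inter> I" "b \<in> K \<inter> I" for a b
  proof (rule ccontr)
    assume "a \<noteq> b"
    then have "(a, b) \<in> R" using assms(1) that unfolding cliq_def by blast
    moreover have "(a, b) \<notin> R" using assms(2) that unfolding indep_def by blast
    ultimately show False by simp
  qed
  then show ?thesis using assms(3) by (simp add: card_le_Suc0_iff_eq)
qed

text \<open>The data of \<open>fractional_routing\<close>, read as the uniform distribution on the
  indices below \<open>T\<close>. In \<open>low\<close>, \<open>D\<close> bounds the bags of
  subgraphs of clique number at most \<open>16 * s\<close>, which include the union of the segments
  of a good sample.\<close>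

locale routing_family =
  fixes R :: "('a \<times> 'a) set" and V :: "'a set" and T :: nat and u :: "nat \<Rightarrow> 'a"
    and Q :: "nat \<Rightarrow> 'a \<Rightarrow> 'a set" and I :: "nat \<Rightarrow> 'a set" and \<kappa> :: real and D s :: nat
  assumes symR: "sym R" and finV: "finite V" and neV: "V \<noteq> {}" and Tpos: "T > 0"
    and ps: "\<And>t. t < T \<Longrightarrow> path_system R V (u t) (Q t)"
    and ind: "\<And>t. t < T \<Longrightarrow> I t \<subseteq> V \<and> indep R (I t)"
    and flow: "\<And>y. y \<in> V \<Longrightarrow> real (\<Sum>t<T. card {v\<in>V. y \<in> Q t v}) \<le> \<kappa> * card V * card {t. t < T \<and> y \<in> I t}"
    and kpos: "\<kappa> > 0" and spos: "s > 0" and Dpos: "D > 0"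
    and low: "\<And>W. W \<subseteq> V \<Longrightarrow> (\<And>K. K \<subseteq> W \<Longrightarrow> cliq R K \<Longrightarrow> card K \<le> 16 * s) \<Longrightarrow> tdec R W (\<lambda>B. card B \<le> D)"
begin

text \<open>Each sampled grid vertex carries an index besides a vertex of \<open>V\<close>, so that
  one uniform choice also selects the path system.\<close>

definition Y where "Y = V \<times> {..<T}"

text \<open>The index at the first end selects the system for both paths. They meet at its centre,
  so their union links the two chosen vertices.\<close>

definition segment :: "'a \<times> nat \<Rightarrow> 'a \<times> nat \<Rightarrow> 'a set" where
  "segment p p' = Q (snd p) (fst p) \<union> Q (snd p) (fst p')"

text \<open>Divided by \<open>T\<close>, this is the probability that a random independent set
  contains \<open>y\<close>.\<close>

definition hits where "hits y = card {t. t < T \<and> y \<in> I t}"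

lemma finite_Y: "finite Y"
  using finV by (simp add: Y_def)

lemma card_Y: "card Y = card V * T"
  by (simp add: Y_def card_cartesian_product)

lemma card_Y_pos: "card Y > 0"
  using card_Y Tpos finV neV by (simp add: card_gt_0_iff)

text \<open>Each of the two paths leads to a random vertex in a random system, so
  \<open>flow\<close> applies to each separately, whence the factor 2.\<close>

lemma segment_count:
  assumes "y \<in> V"
  shows "real (card {p \<in> Y \<times> Y. y \<in> segment (fst p) (snd p)}) \<le> (card Y)\<^sup>2 * (2 * \<kappa> * hits y / T)"
proof -
  let ?A = "{p\<in>Y. y \<in> Q (snd p) (fst p)}"
  let ?B = "{p \<in> Y \<times> Y. y \<in> Q (snd (fst p)) (fst (snd p))}"
  have finA: "finite ?A" using finite_Y by simp
  have cA: "card ?A = (\<Sum>t<T. card {v\<in>V. y \<in> Q t v})"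
  proof -
    have "?A = prod.swap ` (SIGMA t:{..<T}. {v\<in>V. y \<in> Q t v})" by (auto simp: Y_def image_iff)
    then have "card ?A = card (SIGMA t:{..<T}. {v\<in>V. y \<in> Q t v})"
      using card_image[of prod.swap] by (simp add: inj_swap inj_on_subset)
    also have "\<dots> = (\<Sum>t<T. card {v\<in>V. y \<in> Q t v})" by (rule card_SigmaI) (use finV in auto)
    finally show ?thesis .
  qed
  \<comment> \<open>Exchanging the two indices reduces the second path to the count for the
    first.\<close>
  have cB: "card ?B \<le> card (Y \<times> ?A)"
  proof (rule card_inj_on_le)
    let ?h = "\<lambda>p :: ('a \<times> nat) \<times> ('a \<times> nat). ((fst (fst p), snd (snd p)), (fst (snd p), snd (fst p)))"
    show "inj_on ?h ?B" by (rule inj_onI) (auto simp: prod_eq_iff)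
    show "?h ` ?B \<subseteq> Y \<times> ?A" by (auto simp: Y_def)
    show "finite (Y \<times> ?A)" using finite_Y finA by simp
  qed
  have "{p \<in> Y \<times> Y. y \<in> segment (fst p) (snd p)} \<subseteq> ?A \<times> Y \<union> ?B" by (auto simp: segment_def)
  then have "card {p \<in> Y \<times> Y. y \<in> segment (fst p) (snd p)} \<le> card (?A \<times> Y \<union> ?B)"
    by (rule card_mono[rotated]) (use finite_Y in simp)
  also have "\<dots> \<le> card (?A \<times> Y) + card ?B" by (rule card_Un_le)
  also have "\<dots> \<le> 2 * card Y * card ?A" using cB by (simp add: card_cartesian_product)
  finally have "real (card {p \<in> Y \<times> Y. y \<in> segment (fst p) (snd p)}) \<le> real (2 * card Y * card ?A)"
    by (rule of_nat_mono)
  also have "\<dots> = 2 * real (card Y) * real (card ?A)" by simp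
  also have "\<dots> \<le> 2 * real (card Y) * (\<kappa> * card V * hits y)"
    using flow[OF assms] unfolding cA hits_def by (intro mult_left_mono) auto
  also have "\<dots> = (card Y)\<^sup>2 * (2 * \<kappa> * hits y / T)"
    using Tpos by (simp add: card_Y power2_eq_square field_simps)
  finally show ?thesis .
qed

text \<open>A clique meets each independent set at most once, so the union has clique number at most
  \<open>s\<close> and \<open>low\<close> applies. A decomposition with small bags has a vertex of
  small degree.\<close>

lemma low_degree:
  assumes "finite F" "card F \<le> s" "\<And>e. e \<in> F \<Longrightarrow> \<tau> e < T" "W \<subseteq> (\<Union>e\<in>F. I (\<tau> e))" "W \<noteq> {}"
  shows "\<exists>v\<in>W. card {w\<in>W. w = v \<or> (v, w) \<in> R} \<le> D"
proof -
  have WV: "W \<subseteq> V" using assms(3,4) ind by blast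
  have finW: "finite W" by (rule finite_subset[OF WV finV])
  have "tdec R W (\<lambda>B. card B \<le> D)"
  proof (rule low[OF WV])
    fix K assume K: "K \<subseteq> W" "cliq R K"
    have finK: "finite K" by (rule finite_subset[OF K(1) finW])
    have "K = (\<Union>e\<in>F. K \<inter> I (\<tau> e))" using K(1) assms(4) by blast
    then have "card K \<le> (\<Sum>e\<in>F. card (K \<inter> I (\<tau> e)))"
      using card_UN_le[OF assms(1), of "\<lambda>e. K \<inter> I (\<tau> e)"] by simp
    also have "\<dots> \<le> of_nat (card F) * 1"
      by (rule sum_bounded_above) (use cliq_indep_card_le_1[OF K(2) _ finK] ind assms(3) in blast)
    finally show "card K \<le> 16 * s" using assms(2) by simp
  qed
  from tdec_low_degree[OF this assms(5)]
  obtain v B where v: "v \<in> W" "card B \<le> D" "B \<subseteq> W" "v \<in> B" "\<forall>w\<in>W. (v, w) \<in> R \<longrightarrow> w \<in> B" by blast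
  have "{w\<in>W. w = v \<or> (v, w) \<in> R} \<subseteq> B" using v by blast
  then have "card {w\<in>W. w = v \<or> (v, w) \<in> R} \<le> card B"
    by (rule card_mono[OF finite_subset[OF v(3) finW]])
  then show ?thesis using v(1,2) by (intro bexI[of _ v]) simp_all
qed

text \<open>Double counting: the product of the \<open>hits\<close> is the number of index tuples
  \<open>\<tau>\<close> with \<open>f e \<in> I (\<tau> e)\<close> for all \<open>e\<close>. For a
  fixed \<open>\<tau>\<close>, all such \<open>f\<close> take values in a union of \<open>s\<close>
  independent sets, where degeneracy bounds the number of weak cliques.\<close>

lemma weak_clique_weight:
  assumes "finite F" "card F = s"
  shows "(\<Sum>f\<in>{f \<in> PiE F (\<lambda>_. V). weak_clique R F f}. \<Prod>e\<in>F. hits (f e)) \<le> T ^ s * (card V * (s * D ^ (s - 1)))"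
proof -
  let ?A = "{f \<in> PiE F (\<lambda>_. V). weak_clique R F f}" and ?T = "PiE F (\<lambda>_. {..<T})"
  have neF: "F \<noteq> {}" using assms(2) spos by auto
  have finA: "finite ?A" using finite_PiE[OF assms(1), of "\<lambda>_. V"] finV by simp
  have finT: "finite ?T" by (rule finite_PiE[OF assms(1)]) simp
  have finA': "finite {f\<in>?A. P f}" for P by (rule finite_subset[OF _ finA]) blast
  have "(\<Sum>f\<in>?A. \<Prod>e\<in>F. hits (f e)) = (\<Sum>f\<in>?A. card (PiE F (\<lambda>e. {t. t < T \<and> f e \<in> I t})))"
    by (rule sum.cong[OF refl]) (simp add: card_PiE[OF assms(1)] hits_def)
  also have "\<dots> = card (SIGMA f:?A. PiE F (\<lambda>e. {t. t < T \<and> f e \<in> I t}))"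
    by (rule card_SigmaI[symmetric]) (use finA assms(1) in \<open>auto intro!: finite_PiE\<close>)
  also have "\<dots> \<le> card (SIGMA \<tau>:?T. {f\<in>?A. \<forall>e\<in>F. f e \<in> I (\<tau> e)})"
  proof (rule card_inj_on_le)
    show "inj_on prod.swap (SIGMA f:?A. PiE F (\<lambda>e. {t. t < T \<and> f e \<in> I t}))"
      using inj_swap inj_on_subset by blast
    show "prod.swap ` (SIGMA f:?A. PiE F (\<lambda>e. {t. t < T \<and> f e \<in> I t})) \<subseteq> (SIGMA \<tau>:?T. {f\<in>?A. \<forall>e\<in>F. f e \<in> I (\<tau> e)})"
      by (auto simp: PiE_iff)
    show "finite (SIGMA \<tau>:?T. {f\<in>?A. \<forall>e\<in>F. f e \<in> I (\<tau> e)})" by (rule finite_SigmaI[OF finT finA'])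
  qed
  also have "\<dots> = (\<Sum>\<tau>\<in>?T. card {f\<in>?A. \<forall>e\<in>F. f e \<in> I (\<tau> e)})"
    by (rule card_SigmaI[OF finT]) (intro ballI finA')
  also have "\<dots> \<le> of_nat (card ?T) * (card V * (s * D ^ (s - 1)))"
  proof (rule sum_bounded_above)
    fix \<tau> assume \<tau>: "\<tau> \<in> ?T"
    have \<tau>T: "\<tau> e < T" if "e \<in> F" for e using PiE_mem[OF \<tau> that] by simp
    let ?U = "\<Union>e\<in>F. I (\<tau> e)"
    have UV: "?U \<subseteq> V" using ind \<tau>T by blast
    have finU: "finite ?U" by (rule finite_subset[OF UV finV])
    have "{f\<in>?A. \<forall>e\<in>F. f e \<in> I (\<tau> e)} \<subseteq> {f \<in> PiE F (\<lambda>_. ?U). weak_clique R F f}"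
      by (auto simp: PiE_iff)
    then have "card {f\<in>?A. \<forall>e\<in>F. f e \<in> I (\<tau> e)} \<le> card {f \<in> PiE F (\<lambda>_. ?U). weak_clique R F f}"
      by (rule card_mono[rotated]) (use finite_PiE[OF assms(1), of "\<lambda>_. ?U"] finU in simp)
    also have "\<dots> \<le> card ?U * (card F * D ^ (card F - 1))"
    proof (rule card_weak_clique_le[OF assms(1) neF finU])
      show "\<exists>v\<in>W. card {w\<in>W. w = v \<or> (v, w) \<in> R} \<le> D" if "W \<subseteq> ?U" "W \<noteq> {}" for W
        by (rule low_degree[OF assms(1) _ \<tau>T that]) (simp add: assms(2))
    qed
    also have "\<dots> \<le> card V * (s * D ^ (s - 1))"
      unfolding assms(2) by (rule mult_le_mono1[OF card_mono[OF finV UV]])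
    finally show "card {f\<in>?A. \<forall>e\<in>F. f e \<in> I (\<tau> e)} \<le> card V * (s * D ^ (s - 1))" .
  qed
  also have "card ?T = T ^ s" using assms by (simp add: card_PiE)
  finally show ?thesis by simp
qed

text \<open>
  The edges in \<open>F0\<close> are pairwise disjoint, so their segments are sampled independently. A sample is
  bad if \<open>s\<close> of the segments contain vertices that pairwise coincide or are adjacent.
\<close>

definition bad_samples :: "'x set \<Rightarrow> ('e \<Rightarrow> 'x) \<Rightarrow> ('e \<Rightarrow> 'x) \<Rightarrow> 'e set \<Rightarrow> ('x \<Rightarrow> 'a \<times> nat) set" where
  "bad_samples X a b F0 = {\<psi> \<in> PiE X (\<lambda>_. Y). \<exists>F\<subseteq>F0. card F = s \<and>
     (\<exists>f \<in> PiE F (\<lambda>_. V). weak_clique R F f \<and> (\<forall>e\<in>F. f e \<in> segment (\<psi> (a e)) (\<psi> (b e))))}"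

text \<open>Union bound over the at most \<open>M ^ s\<close> sets \<open>F\<close> and all weak
  cliques \<open>f\<close>. Since \<open>F\<close> is a matching, each event has the product of the
  probabilities in \<open>segment_count\<close>, and \<open>weak_clique_weight\<close> sums these
  products.\<close>

lemma card_bad_samples_le:
  assumes "finite F0" "card F0 \<le> M" "finite X" "\<And>e. e \<in> F0 \<Longrightarrow> a e \<in> X \<and> b e \<in> X"
    "inj_on a F0" "inj_on b F0" "a ` F0 \<inter> b ` F0 = {}"
  shows "real (card (bad_samples X a b F0)) \<le> real (card Y) ^ card X * (real M ^ s * ((2 * \<kappa>) ^ s * (card V * (s * D ^ (s - 1)))))"
proof -
  let ?N = "real (card Y) ^ card X"
  let ?w = "?N * ((2 * \<kappa>) ^ s * (card V * (s * D ^ (s - 1))))"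
  let ?E = "\<lambda>F f. {\<psi> \<in> PiE X (\<lambda>_. Y). \<forall>e\<in>F. f e \<in> segment (\<psi> (a e)) (\<psi> (b e))}"
  let ?A = "\<lambda>F. {f \<in> PiE F (\<lambda>_. V). weak_clique R F f}"
  let ?Fs = "{F. F \<subseteq> F0 \<and> card F = s}"
  have Npos: "?N > 0" using card_Y_pos by simp
  have finP: "finite (PiE X (\<lambda>_. Y))" by (rule finite_PiE[OF assms(3)]) (rule finite_Y)
  have one: "real (card (?E F f)) \<le> ?N * (\<Prod>e\<in>F. 2 * \<kappa> * hits (f e) / T)"
    if F: "F \<subseteq> F0" and f: "f \<in> PiE F (\<lambda>_. V)" for F f
  proof -
    have finF: "finite F" by (rule finite_subset[OF F assms(1)])
    have "card (?E F f) * card Y ^ (2 * card F)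
        \<le> card Y ^ card X * (\<Prod>e\<in>F. card {p \<in> Y \<times> Y. f e \<in> segment (fst p) (snd p)})"
    proof (rule card_PiE_pairs[OF finF assms(3) finite_Y])
      show "a e \<in> X \<and> b e \<in> X" if "e \<in> F" for e using assms(4) F that by blast
      show "inj_on a F" "inj_on b F" using assms(5,6) F inj_on_subset by blast+
      show "a ` F \<inter> b ` F = {}" using assms(7) F by blast
    qed
    then have "real (card (?E F f)) * real (card Y) ^ (2 * card F)
        \<le> ?N * (\<Prod>e\<in>F. real (card {p \<in> Y \<times> Y. f e \<in> segment (fst p) (snd p)}))"
      by (simp only: of_nat_le_iff of_nat_mult[symmetric] of_nat_power[symmetric] of_nat_prod[symmetric])
    also have "\<dots> \<le> ?N * (\<Prod>e\<in>F. (card Y)\<^sup>2 * (2 * \<kappa> * hits (f e) / T))"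
      by (intro mult_left_mono prod_mono conjI segment_count) (use f in \<open>auto simp: PiE_iff\<close>)
    also have "\<dots> = ?N * (\<Prod>e\<in>F. 2 * \<kappa> * hits (f e) / T) * real (card Y) ^ (2 * card F)"
    proof -
      have "(\<Prod>e\<in>F. real ((card Y)\<^sup>2)) = real (card Y) ^ (2 * card F)"
        by (simp only: prod_constant power_mult of_nat_power)
      then show ?thesis unfolding prod.distrib by (simp only: mult_ac)
    qed
    finally show ?thesis using card_Y_pos by simp
  qed
  have two: "(\<Sum>f\<in>?A F. real (card (?E F f))) \<le> ?w" if F: "F \<subseteq> F0" "card F = s" for F
  proof -
    have finF: "finite F" by (rule finite_subset[OF F(1) assms(1)])
    have "(\<Sum>f\<in>?A F. real (card (?E F f))) \<le> (\<Sum>f\<in>?A F. ?N * (\<Prod>e\<in>F. 2 * \<kappa> * hits (f e) / T))"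
      by (rule sum_mono) (use one[OF F(1)] in simp)
    also have "\<dots> = ?N * ((2 * \<kappa> / T) ^ s * real (\<Sum>f\<in>?A F. \<Prod>e\<in>F. hits (f e)))"
    proof -
      have "(\<Prod>e\<in>F. 2 * \<kappa> * hits (f e) / T) = (2 * \<kappa> / T) ^ s * real (\<Prod>e\<in>F. hits (f e))" for f :: "_ \<Rightarrow> 'a"
      proof -
        have "(\<Prod>e\<in>F. 2 * \<kappa> * hits (f e) / T) = (\<Prod>e\<in>F. (2 * \<kappa> / T) * real (hits (f e)))" by simp
        also have "\<dots> = (2 * \<kappa> / T) ^ s * (\<Prod>e\<in>F. real (hits (f e)))"
          unfolding prod.distrib by (simp add: F(2))
        finally show ?thesis by simp
      qed
      then show ?thesis by (simp add: sum_distrib_left)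
    qed
    also have "\<dots> \<le> ?N * ((2 * \<kappa> / T) ^ s * real (T ^ s * (card V * (s * D ^ (s - 1)))))"
      using weak_clique_weight[OF finF F(2)] kpos Npos
      by (intro mult_left_mono of_nat_mono) auto
    also have "\<dots> = ?w" using Tpos by (simp add: power_divide)
    finally show ?thesis .
  qed
  have finFs: "finite ?Fs" using assms(1) by simp
  have cardFs: "card ?Fs \<le> M ^ s"
  proof (cases "s \<le> card F0")
    case True
    have "card ?Fs = card F0 choose s" by (rule n_subsets[OF assms(1)])
    also have "\<dots> \<le> card F0 ^ s" using True by (rule binomial_le_pow)
    also have "\<dots> \<le> M ^ s" by (rule power_mono[OF assms(2)]) simp
    finally show ?thesis .
  next
    case False
    have "card ?Fs = card F0 choose s" by (rule n_subsets[OF assms(1)])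
    then show ?thesis using False binomial_eq_0[of "card F0" s] by simp
  qed
  have finA: "finite (?A F)" if "F \<in> ?Fs" for F
  proof -
    have "finite F" using that assms(1) finite_subset by blast
    then have "finite (PiE F (\<lambda>_. V))" by (rule finite_PiE) (rule finV)
    then show ?thesis by simp
  qed
  have "bad_samples X a b F0 \<subseteq> (\<Union>F\<in>?Fs. \<Union>f\<in>?A F. ?E F f)"
    unfolding bad_samples_def by blast
  then have "card (bad_samples X a b F0) \<le> card (\<Union>F\<in>?Fs. \<Union>f\<in>?A F. ?E F f)"
    by (rule card_mono[rotated]) (use finFs finA finP in auto)
  also have "\<dots> \<le> (\<Sum>F\<in>?Fs. card (\<Union>f\<in>?A F. ?E F f))" by (rule card_UN_le[OF finFs])
  also have "\<dots> \<le> (\<Sum>F\<in>?Fs. \<Sum>f\<in>?A F. card (?E F f))"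
    by (rule sum_mono) (rule card_UN_le[OF finA])
  finally have "real (card (bad_samples X a b F0)) \<le> real (\<Sum>F\<in>?Fs. \<Sum>f\<in>?A F. card (?E F f))" by (rule of_nat_mono)
  also have "\<dots> = (\<Sum>F\<in>?Fs. \<Sum>f\<in>?A F. real (card (?E F f)))" by simp
  also have "\<dots> \<le> real (card ?Fs) * ?w"
    by (rule sum_bounded_above) (use two in simp)
  also have "\<dots> \<le> real (M ^ s) * ?w"
    using cardFs kpos by (intro mult_right_mono of_nat_mono) auto
  finally show ?thesis by (simp add: mult_ac)
qed

text \<open>The hypotheses give \<open>2 * \<kappa> * M * D \<le> 1/4\<close>, so the bad fraction
  is at most \<open>(1/4) ^ s * card V * s\<close>, below 1/4. A quarter is wanted because four
  matchings have to be avoided at once.\<close>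

lemma bad_samples_rare:
  assumes "finite F0" "card F0 \<le> M" "finite X" "\<And>e. e \<in> F0 \<Longrightarrow> a e \<in> X \<and> b e \<in> X"
    "inj_on a F0" "inj_on b F0" "a ` F0 \<inter> b ` F0 = {}"
    and "8 * \<kappa> * M * D \<le> 1" "4 * card V * s < 4 ^ s"
  shows "4 * card (bad_samples X a b F0) < card (PiE X (\<lambda>_. Y))"
proof -
  let ?N = "real (card Y) ^ card X"
  have Npos: "?N > 0" using card_Y_pos by simp
  have "real M ^ s * ((2 * \<kappa>) ^ s * (card V * (s * D ^ (s - 1)))) \<le> real M ^ s * ((2 * \<kappa>) ^ s * (card V * (s * D ^ s)))"
  proof -
    have "D ^ (s - 1) \<le> D ^ s" by (rule power_increasing) (use Dpos in auto)
    then have "card V * (s * D ^ (s - 1)) \<le> card V * (s * D ^ s)" by (intro mult_le_mono2)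
    then have "real (card V * (s * D ^ (s - 1))) \<le> real (card V * (s * D ^ s))" by (rule of_nat_mono)
    then show ?thesis using kpos by (intro mult_left_mono) simp_all
  qed
  also have "\<dots> = (2 * \<kappa> * M * D) ^ s * (card V * s)" by (simp add: power_mult_distrib mult_ac)
  also have "\<dots> \<le> (1/4) ^ s * (card V * s)"
    by (intro mult_right_mono power_mono) (use assms(8) kpos in auto)
  also have "\<dots> < 1/4"
  proof -
    have "real (4 * card V * s) < real (4 ^ s)" using assms(9) by (rule of_nat_less_iff[THEN iffD2])
    then show ?thesis by (simp add: power_divide field_simps)
  qed
  finally have "?N * (real M ^ s * ((2 * \<kappa>) ^ s * (card V * (s * D ^ (s - 1))))) < ?N * (1/4)"
    using Npos by (rule mult_strict_left_mono)
  then have "real (4 * card (bad_samples X a b F0)) < real (card Y ^ card X)"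
    using card_bad_samples_le[OF assms(1-7)] by simp
  then have "4 * card (bad_samples X a b F0) < card Y ^ card X" by (rule of_nat_less_iff[THEN iffD1])
  then show ?thesis by (simp add: card_PiE[OF assms(3)])
qed

text \<open>
  The edge \<open>(h, i, j)\<close> of the grid joins \<open>(i, j)\<close> to \<open>(i, j + 1)\<close> if \<open>h\<close> holds, and to
  \<open>(i + 1, j)\<close> otherwise. Sorting the edges by direction and parity yields four matchings.
\<close>

definition edge_tail :: "bool \<times> nat \<times> nat \<Rightarrow> nat \<times> nat" where
  "edge_tail e = snd e"

definition edge_head :: "bool \<times> nat \<times> nat \<Rightarrow> nat \<times> nat" where
  "edge_head e = (if fst e then (fst (snd e), Suc (snd (snd e))) else (Suc (fst (snd e)), snd (snd e)))"

definition edge_class :: "nat \<Rightarrow> bool \<times> bool \<Rightarrow> (bool \<times> nat \<times> nat) set" where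
  "edge_class q c = {e. fst e = fst c \<and> fst (snd e) < q \<and> snd (snd e) < q \<and>
     even (if fst c then snd (snd e) else fst (snd e)) = snd c}"

text \<open>Tails have coordinates below \<open>q\<close>, but heads reach \<open>q\<close>, hence
  the closed ranges.\<close>

definition grid :: "nat \<Rightarrow> (nat \<times> nat) set" where
  "grid q = {..q} \<times> {..q}"

lemma finite_grid: "finite (grid q)"
  by (simp add: grid_def)

lemma edge_class_subset: "edge_class q c \<subseteq> {fst c} \<times> {..<q} \<times> {..<q}"
  by (auto simp: edge_class_def)

lemma finite_edge_class: "finite (edge_class q c)"
  by (rule finite_subset[OF edge_class_subset]) simp

lemma card_edge_class: "card (edge_class q c) \<le> q * q"
  using card_mono[OF _ edge_class_subset[of q c]] by (simp add: card_cartesian_product)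

text \<open>In a class, the moving coordinate has one parity at all tails and the other at all
  heads.\<close>

lemma edge_class_disjoint: "edge_tail ` edge_class q c \<inter> edge_head ` edge_class q c = {}"
proof -
  have "edge_tail e \<noteq> edge_head e'" if e: "e \<in> edge_class q c" and e': "e' \<in> edge_class q c" for e e'
  proof
    assume "edge_tail e = edge_head e'"
    then have *: "fst (snd e) = fst (edge_head e')" "snd (snd e) = snd (edge_head e')" by (simp_all add: edge_tail_def)
    show False
    proof (cases "fst c")
      case True
      then have "snd (snd e) = Suc (snd (snd e'))" using * e' by (simp add: edge_class_def edge_head_def)
      then show False using e e' True by (simp add: edge_class_def)
    next
      case False
      then have "fst (snd e) = Suc (fst (snd e'))" using * e' by (simp add: edge_class_def edge_head_def)
      then show False using e e' False by (simp add: edge_class_def)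
    qed
  qed
  then show ?thesis by blast
qed

lemma inj_edge_tail: "inj_on edge_tail (edge_class q c)"
  by (rule inj_onI) (simp add: edge_class_def edge_tail_def prod_eq_iff)

lemma inj_edge_head: "inj_on edge_head (edge_class q c)"
  by (rule inj_onI) (simp add: edge_class_def edge_head_def prod_eq_iff split: if_splits)

lemma card_bool_pair: "card (UNIV :: (bool \<times> bool) set) = 4"
  by (simp add: card_cartesian_product UNIV_Times_UNIV[symmetric] del: UNIV_Times_UNIV)

lemma good_sample:
  assumes "8 * \<kappa> * real (q * q) * D \<le> 1" "4 * card V * s < 4 ^ s"
  shows "\<exists>\<psi> \<in> PiE (grid q) (\<lambda>_. Y). \<forall>c. \<psi> \<notin> bad_samples (grid q) edge_tail edge_head (edge_class q c)"
proof (rule ccontr)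
  let ?P = "PiE (grid q) (\<lambda>_. Y)" and ?B = "\<lambda>c. bad_samples (grid q) edge_tail edge_head (edge_class q c)"
  assume "\<not> ?thesis"
  then have sub: "?P \<subseteq> (\<Union>c\<in>UNIV. ?B c)" by blast
  have finB: "finite (?B c)" for c
  proof -
    have "finite ?P" by (rule finite_PiE[OF finite_grid]) (rule finite_Y)
    then show ?thesis by (rule finite_subset[rotated]) (auto simp: bad_samples_def)
  qed
  have small: "4 * card (?B c) < card ?P" for c
  proof (rule bad_samples_rare[OF finite_edge_class card_edge_class finite_grid _ inj_edge_tail inj_edge_head edge_class_disjoint assms])
    show "edge_tail e \<in> grid q \<and> edge_head e \<in> grid q" if "e \<in> edge_class q c" for e
      using that by (auto simp: edge_class_def edge_tail_def edge_head_def grid_def mem_Times_iff)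
  qed
  have "card ?P \<le> card (\<Union>c\<in>UNIV. ?B c)" by (rule card_mono[OF _ sub]) (simp add: finB)
  also have "\<dots> \<le> (\<Sum>c\<in>UNIV. card (?B c))" by (rule card_UN_le) simp
  finally have "4 * card ?P \<le> (\<Sum>c\<in>UNIV. 4 * card (?B c))" by (simp add: sum_distrib_left[symmetric])
  also have "\<dots> < (\<Sum>c\<in>(UNIV :: (bool \<times> bool) set). card ?P)"
    by (rule sum_strict_mono) (use small in simp_all)
  also have "\<dots> = 4 * card ?P" by (simp add: card_bool_pair)
  finally show False by simp
qed

text \<open>By pigeonhole, \<open>4 * s\<close> edges would put \<open>s\<close> into one of the
  four matchings and make the sample bad.\<close>

lemma few_edges:
  assumes good: "\<And>c. \<psi> \<notin> bad_samples (grid q) edge_tail edge_head (edge_class q c)" and \<psi>: "\<psi> \<in> PiE (grid q) (\<lambda>_. Y)"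
    and Z: "Z \<subseteq> UNIV \<times> {..<q} \<times> {..<q}" "weak_clique R Z f"
    and f: "\<And>e. e \<in> Z \<Longrightarrow> f e \<in> V \<and> f e \<in> segment (\<psi> (edge_tail e)) (\<psi> (edge_head e))"
  shows "card Z < 4 * s"
proof (rule ccontr)
  assume "\<not> ?thesis"
  then have big: "4 * s \<le> card Z" by simp
  have "Z = (\<Union>c\<in>UNIV. Z \<inter> edge_class q c)"
  proof
    show "Z \<subseteq> (\<Union>c\<in>UNIV. Z \<inter> edge_class q c)"
    proof
      fix e assume e: "e \<in> Z"
      obtain h i j where hij: "e = (h, i, j)" by (cases e) auto
      then have "i < q" "j < q" using Z(1) e by auto
      then have "e \<in> edge_class q (h, even (if h then j else i))" by (simp add: edge_class_def hij)
      then show "e \<in> (\<Union>c\<in>UNIV. Z \<inter> edge_class q c)" using e by blast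
    qed
  qed blast
  then have "card Z \<le> (\<Sum>c\<in>UNIV. card (Z \<inter> edge_class q c))"
    using card_UN_le[of "UNIV :: (bool \<times> bool) set" "\<lambda>c. Z \<inter> edge_class q c"] by simp
  moreover have "\<exists>c. s \<le> card (Z \<inter> edge_class q c)"
  proof (rule ccontr)
    assume "\<not> ?thesis"
    then have "card (Z \<inter> edge_class q c) < s" for c by (meson not_le)
    then have "(\<Sum>c\<in>UNIV. card (Z \<inter> edge_class q c)) < (\<Sum>c\<in>(UNIV :: (bool \<times> bool) set). s)"
      by (intro sum_strict_mono) simp_all
    then show False using calculation big by (simp add: card_bool_pair)
  qed
  then obtain c where "s \<le> card (Z \<inter> edge_class q c)" by blast
  then obtain F where F: "F \<subseteq> Z \<inter> edge_class q c" "card F = s" by (meson obtain_subset_with_card_n)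
  have "restrict f F \<in> PiE F (\<lambda>_. V)" using f F(1) by auto
  moreover have "weak_clique R F (restrict f F)"
    unfolding weak_clique_def
  proof (intro ballI)
    fix e e' assume "e \<in> F" "e' \<in> F"
    then show "restrict f F e = restrict f F e' \<or> (restrict f F e, restrict f F e') \<in> R"
      using Z(2) F(1) unfolding weak_clique_def by auto
  qed
  moreover have "\<forall>e\<in>F. restrict f F e \<in> segment (\<psi> (edge_tail e)) (\<psi> (edge_head e))" using f F(1) by auto
  moreover have "F \<subseteq> edge_class q c" using F(1) by blast
  ultimately have "\<psi> \<in> bad_samples (grid q) edge_tail edge_head (edge_class q c)"
    unfolding bad_samples_def using \<psi> F(2) by blast
  then show False using good by simp
qed

lemma Q_props:
  assumes "t < T" "v \<in> V"
  shows "v \<in> Q t v" "u t \<in> Q t v" "Q t v \<subseteq> V" "conn R (Q t v)"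
    "\<exists>I J. Q t v = I \<union> J \<and> indep R I \<and> indep R J"
  using ps[OF assms(1)] assms(2) unfolding path_system_def by blast+

lemma Q_clique:
  assumes "t < T" "v \<in> V" "cliq R K" "finite K"
  shows "card (K \<inter> Q t v) \<le> 2"
proof -
  obtain I J where IJ: "Q t v = I \<union> J" "indep R I" "indep R J" using Q_props(5)[OF assms(1,2)] by blast
  have "K \<inter> Q t v = (K \<inter> I) \<union> (K \<inter> J)" using IJ(1) by blast
  then have "card (K \<inter> Q t v) \<le> card (K \<inter> I) + card (K \<inter> J)" using card_Un_le by metis
  then show ?thesis
    using cliq_indep_card_le_1[OF assms(3) IJ(2) assms(4)] cliq_indep_card_le_1[OF assms(3) IJ(3) assms(4)] by simp
qed

lemma segment_props:
  assumes "p \<in> Y" "p' \<in> Y"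
  shows "fst p \<in> segment p p'" "fst p' \<in> segment p p'" "segment p p' \<subseteq> V" "conn R (segment p p')"
    and "\<And>K. cliq R K \<Longrightarrow> finite K \<Longrightarrow> card (K \<inter> segment p p') \<le> 4"
proof -
  have p: "snd p < T" "fst p \<in> V" "fst p' \<in> V" using assms by (auto simp: Y_def)
  show "fst p \<in> segment p p'" "fst p' \<in> segment p p'" "segment p p' \<subseteq> V"
    using Q_props(1,3)[OF p(1,2)] Q_props(1,3)[OF p(1,3)] unfolding segment_def by blast+
  show "conn R (segment p p')" unfolding segment_def
  proof (rule conn_Un[OF symR Q_props(4)[OF p(1,2)] Q_props(4)[OF p(1,3)]])
    show "touching R (Q (snd p) (fst p)) (Q (snd p) (fst p'))"
      unfolding touching_def using Q_props(2)[OF p(1,2)] Q_props(2)[OF p(1,3)] by (intro bexI[of _ "u (snd p)"] disjI1 refl)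
  qed
  \<comment> \<open>The 4 counts two paths, each covered by two independent sets.\<close>
  fix K assume K: "cliq R K" "finite K"
  have "K \<inter> segment p p' = (K \<inter> Q (snd p) (fst p)) \<union> (K \<inter> Q (snd p) (fst p'))" by (auto simp: segment_def)
  then have "card (K \<inter> segment p p') \<le> card (K \<inter> Q (snd p) (fst p)) + card (K \<inter> Q (snd p) (fst p'))"
    using card_Un_le by metis
  then show "card (K \<inter> segment p p') \<le> 4"
    using Q_clique[OF p(1,2) K] Q_clique[OF p(1,3) K] by simp
qed

text \<open>
  In a good sample every vertex lies on few segments and every clique meets few segments, so the
  union of the segments has treewidth less than \<open>D\<close>. But a bag of size at most \<open>D\<close> misses all
  segments of some row and some column, whereas the unions of a row and a column form a bramble.
\<close>

theorem routing_contradiction: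
  assumes "8 * \<kappa> * real ((4 * s * D) * (4 * s * D)) * D \<le> 1" "4 * card V * s < 4 ^ s"
  shows False
proof -
  let ?q = "4 * s * D"
  have qpos: "?q > 0" using spos Dpos by simp
  obtain \<psi> where \<psi>: "\<psi> \<in> PiE (grid ?q) (\<lambda>_. Y)" and good: "\<And>c. \<psi> \<notin> bad_samples (grid ?q) edge_tail edge_head (edge_class ?q c)"
    using good_sample[OF assms] by blast
  define S where "S e = segment (\<psi> (edge_tail e)) (\<psi> (edge_head e))" for e
  define E where "E = (UNIV :: bool set) \<times> {..<?q} \<times> {..<?q}"
  have \<psi>Y: "\<psi> (i, j) \<in> Y" if "i \<le> ?q" "j \<le> ?q" for i j
    by (rule PiE_mem[OF \<psi>]) (use that in \<open>simp add: grid_def\<close>)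
  have eY: "\<psi> (edge_tail e) \<in> Y \<and> \<psi> (edge_head e) \<in> Y" if "e \<in> E" for e
  proof -
    obtain h i j where e: "e = (h, i, j)" by (cases e) auto
    then have "i < ?q" "j < ?q" using that by (auto simp: E_def)
    then show ?thesis using \<psi>Y by (cases h) (simp_all add: e edge_tail_def edge_head_def)
  qed
  have S: "S e \<subseteq> V" "conn R (S e)" if "e \<in> E" for e
    unfolding S_def using segment_props(3,4) eY[OF that] by blast+
  have S4: "card (K \<inter> S e) \<le> 4" if "e \<in> E" "cliq R K" "finite K" for e K
    unfolding S_def using segment_props(5) eY[OF that(1)] that(2,3) by blast
  \<comment> \<open>\<open>h\<close> chooses between rows and columns: \<open>cell h i k\<close> is
    the \<open>k\<close>-th edge of line \<open>i\<close> and \<open>node h i k\<close> the vertex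
    sampled at its tail.\<close>
  define cell where "cell h i k = (if h then (True, i, k) else (False, k, i))" for h and i k :: nat
  define node where "node h i k = fst (\<psi> (if h then (i, k) else (k, i)))" for h and i k :: nat
  have cell: "cell h i k \<in> E" "node h i k \<in> S (cell h i k)" "node h i (Suc k) \<in> S (cell h i k)"
    if "i < ?q" "k < ?q" for h i k
  proof -
    show 1: "cell h i k \<in> E" using that by (simp add: cell_def E_def)
    have "fst (\<psi> (edge_tail (cell h i k))) \<in> S (cell h i k)" "fst (\<psi> (edge_head (cell h i k))) \<in> S (cell h i k)"
      unfolding S_def using segment_props(1,2) eY[OF 1] by blast+
    then show "node h i k \<in> S (cell h i k)" "node h i (Suc k) \<in> S (cell h i k)"
      by (cases h; simp add: node_def cell_def edge_tail_def edge_head_def)+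
  qed
  let ?W = "\<Union>e\<in>E. S e"
  have finE: "finite E" by (simp add: E_def)
  have WV: "?W \<subseteq> V" using S(1) by blast
  \<comment> \<open>A constant map is a weak clique, so the same bound limits the segments through a
    single vertex.\<close>
  have hit: "card {e\<in>E. y \<in> S e} < 4 * s" if "y \<in> V" for y
  proof (rule few_edges[OF good \<psi>, of _ "\<lambda>_. y"])
    show "{e\<in>E. y \<in> S e} \<subseteq> UNIV \<times> {..<?q} \<times> {..<?q}" by (auto simp: E_def)
    show "weak_clique R {e\<in>E. y \<in> S e} (\<lambda>_. y)" by (simp add: weak_clique_def)
  qed (use that in \<open>simp add: S_def\<close>)
  have "tdec R ?W (\<lambda>B. card B \<le> D)"
  proof (rule low[OF WV])
    fix K assume K: "K \<subseteq> ?W" "cliq R K"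
    have finK: "finite K" by (rule finite_subset[OF order_trans[OF K(1) WV] finV])
    have "\<forall>v\<in>K. \<exists>e. e \<in> E \<and> v \<in> S e" using K(1) by blast
    \<comment> \<open>Each clique vertex picks a segment through it, and each picked segment a
      representative \<open>f e\<close>. The representatives form a weak clique, so fewer than
      \<open>4 * s\<close> segments are picked, and each has at most 4 vertices of
      \<open>K\<close>.\<close>
    then obtain g where g: "\<forall>v\<in>K. g v \<in> E \<and> v \<in> S (g v)" by (rule bchoice[THEN exE])
    have "\<forall>e\<in>g ` K. \<exists>v. v \<in> K \<and> g v = e" by blast
    then obtain f where f: "\<forall>e\<in>g ` K. f e \<in> K \<and> g (f e) = e" by (rule bchoice[THEN exE])
    have "card (g ` K) < 4 * s"
    proof (rule few_edges[OF good \<psi>, of _ f])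
      show "g ` K \<subseteq> UNIV \<times> {..<?q} \<times> {..<?q}" using g by (auto simp: E_def)
      show "weak_clique R (g ` K) f" unfolding weak_clique_def
      proof (intro ballI)
        fix e e' assume "e \<in> g ` K" "e' \<in> g ` K"
        then have "f e \<in> K" "f e' \<in> K" using f by blast+
        then show "f e = f e' \<or> (f e, f e') \<in> R" using K(2) unfolding cliq_def by blast
      qed
      show "f e \<in> V \<and> f e \<in> segment (\<psi> (edge_tail e)) (\<psi> (edge_head e))" if e: "e \<in> g ` K" for e
      proof -
        have "f e \<in> K" "g (f e) = e" using f e by blast+
        then have "f e \<in> S e" "f e \<in> K" using g by force+
        then show ?thesis using K(1) WV unfolding S_def by blast
      qed
    qed
    moreover have "card K \<le> (\<Sum>e\<in>g ` K. card (K \<inter> S e))"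
    proof -
      have "K \<subseteq> (\<Union>e\<in>g ` K. K \<inter> S e)" using g by blast
      then have "card K \<le> card (\<Union>e\<in>g ` K. K \<inter> S e)" by (rule card_mono[rotated]) (use finK in simp)
      also have "\<dots> \<le> (\<Sum>e\<in>g ` K. card (K \<inter> S e))" by (rule card_UN_le) (use finK in simp)
      finally show ?thesis .
    qed
    moreover have "(\<Sum>e\<in>g ` K. card (K \<inter> S e)) \<le> of_nat (card (g ` K)) * 4"
      by (rule sum_bounded_above) (use g S4[OF _ K(2) finK] in blast)
    ultimately show "card K \<le> 16 * s" by simp
  qed
  moreover define line where "line h i = (\<Union>k<?q. S (cell h i k))" for h i
  have line: "line h i \<subseteq> ?W" "conn R (line h i)" "\<And>k. k \<le> ?q \<Longrightarrow> node h i k \<in> line h i" if i: "i < ?q" for h i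
  proof -
    show "line h i \<subseteq> ?W" unfolding line_def using cell(1)[OF i] by blast
    show "conn R (line h i)" unfolding line_def
    proof (rule conn_UN[OF symR _ qpos])
      show "conn R (S (cell h i k))" if "k < ?q" for k by (rule S(2)[OF cell(1)[OF i that]])
      show "touching R (S (cell h i k)) (S (cell h i (Suc k)))" if "Suc k < ?q" for k
        unfolding touching_def using cell(3)[OF i Suc_lessD[OF that]] cell(2)[OF i that] by blast
    qed
    show "node h i k \<in> line h i" if "k \<le> ?q" for k
    proof (cases "k < ?q")
      case True
      then show ?thesis using cell(2)[OF i] unfolding line_def by blast
    next
      case False
      then have k: "k = Suc (?q - 1)" "?q - 1 < ?q" using that qpos by simp_all
      have "node h i k \<in> S (cell h i (?q - 1))" using cell(3)[OF i k(2)] k(1) by simp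
      then show ?thesis using k(2) unfolding line_def by blast
    qed
  qed
  have cross: "node True i j \<in> line True i" "node True i j \<in> line False j" if "i < ?q" "j < ?q" for i j
    using line(3)[OF that(1), of j True] line(3)[OF that(2), of i False] that by (simp_all add: node_def)
  define \<B> where "\<B> = {line True i \<union> line False j | i j. i < ?q \<and> j < ?q}"
  have "\<exists>B. card B \<le> D \<and> B \<subseteq> ?W \<and> (\<forall>X\<in>\<B>. X \<inter> B \<noteq> {})"
  proof (rule tdec_bramble[OF \<open>tdec R ?W (\<lambda>B. card B \<le> D)\<close>])
    fix X assume "X \<in> \<B>"
    then obtain i j where ij: "X = line True i \<union> line False j" "i < ?q" "j < ?q" unfolding \<B>_def by blast
    have "touching R (line True i) (line False j)"
      unfolding touching_def using cross[OF ij(2,3)] by blast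
    then have "conn R X" unfolding ij(1) by (rule conn_Un[OF symR line(2)[OF ij(2)] line(2)[OF ij(3)]])
    then show "X \<subseteq> ?W \<and> conn R X" using line(1)[OF ij(2)] line(1)[OF ij(3)] ij(1) by simp
  next
    fix X X' assume "X \<in> \<B>" "X' \<in> \<B>"
    then obtain i j i' j' where ij: "X = line True i \<union> line False j" "i < ?q" "X' = line True i' \<union> line False j'" "j' < ?q"
      unfolding \<B>_def by blast
    \<comment> \<open>The row of one cross meets the column of the other.\<close>
    have "node True i j' \<in> X" "node True i j' \<in> X'" using cross[OF ij(2,4)] ij by simp_all
    then show "touching R X X'" unfolding touching_def by (intro bexI[of _ "node True i j'"] disjI1 refl)
  qed
  then obtain B where B: "card B \<le> D" "B \<subseteq> ?W" "\<forall>X\<in>\<B>. X \<inter> B \<noteq> {}" by (elim exE conjE)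
  have finB: "finite B" by (rule finite_subset[OF order_trans[OF B(2) WV] finV])
  define H where "H = {e\<in>E. S e \<inter> B \<noteq> {}}"
  \<comment> \<open>This explains \<open>?q = 4 * s * D\<close>: at most \<open>D\<close> bag
    vertices, each on fewer than \<open>4 * s\<close> segments, cannot hit all \<open>?q\<close>
    lines of a direction.\<close>
  have "card H < ?q"
  proof (cases "B = {}")
    case True
    then have "H = {}" by (simp add: H_def)
    then show ?thesis using qpos by simp
  next
    case False
    have "H = (\<Union>y\<in>B. {e\<in>E. y \<in> S e})" unfolding H_def by blast
    then have "card H \<le> (\<Sum>y\<in>B. card {e\<in>E. y \<in> S e})" using card_UN_le[OF finB] by simp
    also have "\<dots> < (\<Sum>y\<in>B. 4 * s)"
      by (rule sum_strict_mono[OF finB False]) (use hit B(2) WV in blast)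
    also have "\<dots> = card B * (4 * s)" by simp
    also have "\<dots> \<le> D * (4 * s)" by (rule mult_le_mono1[OF B(1)])
    finally show ?thesis by (simp add: mult_ac)
  qed
  have finH: "finite H" using finE by (simp add: H_def)
  have free: "\<exists>i<?q. i \<notin> f ` H" for f :: "_ \<Rightarrow> nat"
  proof (rule ccontr)
    assume "\<not> ?thesis"
    then have "{..<?q} \<subseteq> f ` H" by blast
    then have "card {..<?q} \<le> card (f ` H)" by (rule card_mono[rotated]) (use finH in simp)
    also have "\<dots> \<le> card H" by (rule card_image_le[OF finH])
    finally show False using \<open>card H < ?q\<close> by simp
  qed
  have miss: "\<exists>i<?q. line h i \<inter> B = {}" for h
  proof -
    define idx :: "bool \<times> nat \<times> nat \<Rightarrow> nat" where "idx e = (if fst e then fst (snd e) else snd (snd e))" for e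
    obtain i where i: "i < ?q" "i \<notin> idx ` H" using free[of idx] by blast
    have "S (cell h i k) \<inter> B = {}" if "k < ?q" for k
    proof -
      have "idx (cell h i k) = i" by (simp add: idx_def cell_def)
      then have "cell h i k \<notin> H" using i(2) imageI[of "cell h i k" H idx] by auto
      then show ?thesis using cell(1)[OF i(1) that] by (simp add: H_def)
    qed
    then have "line h i \<inter> B = {}" unfolding line_def by blast
    then show ?thesis using i(1) by blast
  qed
  obtain i j where ij: "i < ?q" "line True i \<inter> B = {}" "j < ?q" "line False j \<inter> B = {}"
    using miss[of True] miss[of False] by blast
  then have "(line True i \<union> line False j) \<inter> B = {}" by blast
  moreover have "line True i \<union> line False j \<in> \<B>" using ij(1,3) unfolding \<B>_def by blast
  ultimately show False using B(3) by blast
qed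

end

section \<open>Hereditary classes\<close>

lemma tdec_Int: "tdec (R \<inter> W \<times> W) W P \<longleftrightarrow> tdec R W P"
proof -
  have "(\<forall>u\<in>W. \<forall>v\<in>W. (u, v) \<in> R \<inter> W \<times> W \<longrightarrow> Z u v) \<longleftrightarrow> (\<forall>u\<in>W. \<forall>v\<in>W. (u, v) \<in> R \<longrightarrow> Z u v)" for Z
    by auto
  then show ?thesis unfolding tdec_def by presburger
qed

text \<open>Bernoulli's inequality for \<open>(1 + 1 / (K - 1)) ^ K\<close>. It means that
  \<open>K\<close> rounds of separation at least halve the size.\<close>

lemma double_power:
  assumes "K \<ge> 2"
  shows "2 * (K - 1) ^ K \<le> K ^ (K :: nat)"
proof -
  let ?x = "1 / real (K - 1)"
  have pos: "real (K - 1) > 0" using assms by simp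
  have K: "real K = real (K - 1) * (1 + ?x)"
    using pos assms by (simp add: field_simps of_nat_diff)
  have "2 \<le> 1 + real K * ?x" using pos assms by (simp add: field_simps of_nat_diff)
  also have "\<dots> \<le> (1 + ?x) ^ K"
  proof (rule Bernoulli_inequality)
    have "0 \<le> ?x" by (rule divide_nonneg_nonneg) simp_all
    then show "- 1 \<le> ?x" by (rule order_trans[rotated]) simp
  qed
  finally have "real (K - 1) ^ K * 2 \<le> real (K - 1) ^ K * (1 + ?x) ^ K"
    by (rule mult_left_mono) simp
  also have "\<dots> = real K ^ K" by (simp only: power_mult_distrib[symmetric] K[symmetric])
  finally have "real (2 * (K - 1) ^ K) \<le> real (K ^ K)" by (simp add: mult.commute)
  then show ?thesis by (simp only: of_nat_le_iff)
qed

text \<open>\<open>s = L + 3\<close> makes \<open>4 ^ s\<close> exceed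
  \<open>4 * card V * s\<close>. \<open>K - 1\<close> is the value at which the first hypothesis of
  \<open>routing_contradiction\<close> is an equality for
  \<open>\<kappa> = 2 * (6 * L + 7) / (K - 1)\<close>. The result is the separator bound
  \<open>K + 4 * L * K\<close> times \<open>K * (L + 1)\<close> rounds.\<close>

lemma alpha_decomposition:
  fixes R :: "('a \<times> 'a) set" and L D :: nat
  defines "s \<equiv> L + 3"
  defines "K \<equiv> 16 * (6 * L + 7) * ((4 * s * D) * (4 * s * D)) * D + 1"
  assumes "sym R" "\<And>x. (x, x) \<notin> R" "finite V0" "card V0 \<le> 2 ^ L" "D > 0"
    and low: "\<And>W. W \<subseteq> V0 \<Longrightarrow> (\<And>X. X \<subseteq> W \<Longrightarrow> cliq R X \<Longrightarrow> card X \<le> 16 * s) \<Longrightarrow> tdec R W (\<lambda>B. card B \<le> D)"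
  shows "tdec R V0 (alpha_le R (K * K * ((4 * L + 1) * (L + 1))))"
proof -
  let ?M = "(4 * s * D) * (4 * s * D)"
  have spos: "s > 0" by (simp add: s_def)
  have Mpos: "?M * D \<ge> 1" using spos assms(7) by simp
  have "4 \<le> 16 * (6 * L + 7) * (?M * D)" using Mpos by (intro order_trans[OF _ mult_le_mono2[OF Mpos]]) simp
  moreover have "K = 16 * (6 * L + 7) * (?M * D) + 1" unfolding K_def by (simp only: mult.assoc)
  ultimately have K4: "4 \<le> K" by (metis le_add1 order_trans)
  show ?thesis
  proof (cases "K < 2 ^ L")
    \<comment> \<open>If \<open>K \<ge> 2 ^ L\<close>, a single bag is small enough. Otherwise
      \<open>K * 2 ^ L < 2 ^ (2 * L)\<close>, which permits \<open>l = 2 * L\<close> in the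
      routing.\<close>
    case False
    have "alpha_le R (K * K * ((4 * L + 1) * (L + 1))) V0"
      unfolding alpha_le_def
    proof (intro allI impI)
      fix J assume "J \<subseteq> V0"
      then have "card J \<le> card V0" by (rule card_mono[OF assms(5)])
      also have "\<dots> \<le> K" using False assms(6) by simp
      also have "\<dots> \<le> K * (K * ((4 * L + 1) * (L + 1)))" using K4 by simp
      finally show "card J \<le> K * K * ((4 * L + 1) * (L + 1))" by (simp only: mult.assoc)
    qed
    then show ?thesis by (rule tdec_trivial)
  next
    case True
    have l: "K * 2 ^ L < 2 ^ (2 * L)"
      using True by (simp add: mult_2 power_add)
    have sep: "separable R V K (K + 4 * L * K)" if V: "V \<subseteq> V0" "conn R V" for V
    proof (rule ccontr)
      assume nosep: "\<not> ?thesis"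
      have finV: "finite V" by (rule finite_subset[OF V(1) assms(5)])
      have cV: "card V \<le> 2 ^ L" using card_mono[OF assms(5) V(1)] assms(6) by simp
      define \<kappa> where "\<kappa> = 2 * (real (3 * (2 * L) + 7) / real (K - 1))"
      have K1: "real (K - 1) = 16 * real (6 * L + 7) * real ?M * real D" by (simp add: K_def)
      have K1pos: "real (K - 1) > 0" using K4 by simp
      have "\<exists>T>0. \<exists>u Q I. (\<forall>t<T. path_system R V (u t) (Q t) \<and> I t \<subseteq> V \<and> indep R (I t)) \<and>
        (\<forall>y\<in>V. real (\<Sum>t<(T::nat). card {v\<in>V. y \<in> Q t v}) \<le> \<kappa> * card V * card {t. t < T \<and> y \<in> I t})"
        unfolding \<kappa>_def
        by (rule fractional_routing[OF assms(3,4) finV V(2) cV l K4 nosep])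
      then obtain T :: nat and u Q I where T: "T > 0" "\<forall>t<T. path_system R V (u t) (Q t) \<and> I t \<subseteq> V \<and> indep R (I t)"
        "\<forall>y\<in>V. real (\<Sum>t<T. card {v\<in>V. y \<in> Q t v}) \<le> \<kappa> * card V * card {t. t < T \<and> y \<in> I t}"
        by (elim exE conjE)
      interpret routing_family R V T u Q I \<kappa> D s
      proof
        show "V \<noteq> {}" using V(2) by (simp add: conn_def)
        show "\<kappa> > 0" using K1pos by (simp add: \<kappa>_def)
        show "tdec R W (\<lambda>B. card B \<le> D)"
          if "W \<subseteq> V" "\<And>X. X \<subseteq> W \<Longrightarrow> cliq R X \<Longrightarrow> card X \<le> 16 * s" for W
          by (rule low) (use that V(1) in auto)
      qed (use assms(3,7) finV T spos in auto)
      have "8 * \<kappa> * real ?M * D \<le> 1"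
      proof -
        have "8 * \<kappa> * real ?M * D = 16 * real (6 * L + 7) * real ?M * real D / real (K - 1)"
          unfolding \<kappa>_def by simp
        then show ?thesis using K1 K1pos by simp
      qed
      moreover have "4 * card V * s < 4 ^ s"
      proof -
        have "L < (2::nat) ^ L" by (rule less_exp)
        then have "s < 16 * 2 ^ L" unfolding s_def by linarith
        then have "4 * 2 ^ L * s < 4 * 2 ^ L * (16 * 2 ^ L)" by simp
        also have "\<dots> = 4 ^ s" by (simp add: s_def power_add power_mult_distrib[symmetric])
        finally have "4 * 2 ^ L * s < 4 ^ s" .
        moreover have "4 * card V * s \<le> 4 * 2 ^ L * s" using cV by simp
        ultimately show ?thesis by (rule le_less_trans[rotated])
      qed
      ultimately show False by (rule routing_contradiction)
    qed
    have "tdec R V0 (alpha_le R ((K + 4 * L * K) * (K * (L + 1))))"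
    proof (rule tdec_recursion[OF assms(3,5), where K = K])
      show "separable R V K (K + 4 * L * K)" if "V \<subseteq> V0" "conn R V" for V by (rule sep[OF that])
      show "K > 0" using K4 by simp
      show "V0 \<subseteq> V0" by simp
      have "card V0 * (K - 1) ^ (K * (L + 1)) \<le> 2 ^ L * (K - 1) ^ (K * (L + 1))"
        by (rule mult_le_mono1[OF assms(6)])
      also have "\<dots> < 2 ^ (L + 1) * (K - 1) ^ (K * (L + 1))" using K4 by simp
      also have "\<dots> = (2 * (K - 1) ^ K) ^ (L + 1)" by (simp only: power_mult_distrib power_mult)
      also have "\<dots> \<le> (K ^ K) ^ (L + 1)" by (rule power_mono[OF double_power]) (use K4 in auto)
      also have "\<dots> = K ^ (K * (L + 1))" by (simp only: power_mult)
      finally show "card V0 * (K - 1) ^ (K * (L + 1)) < K ^ (K * (L + 1))" .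
    qed
    moreover have "(K + 4 * L * K) * (K * (L + 1)) = K * K * ((4 * L + 1) * (L + 1))" by (simp add: algebra_simps)
    ultimately show ?thesis by (simp only:)
  qed
qed

section \<open>Estimates for logarithms and constants\<close>

lemma log2_ge: "n \<ge> 3 \<Longrightarrow> log 2 (real n) \<ge> 3/2"
proof -
  assume n: "n \<ge> 3"
  have "(3::real) = log 2 (2 ^ 3)" by (subst log_pow_cancel) simp_all
  also have "\<dots> \<le> log 2 (3 ^ 2)" by (simp del: log_pow_cancel)
  also have "\<dots> = 2 * log 2 3" by (subst log_nat_power) simp_all
  finally have "3/2 \<le> log 2 (3::real)" by simp
  also have "\<dots> \<le> log 2 (real n)" using n by simp
  finally show ?thesis .
qed

text \<open>Powers of \<open>y \<ge> 3/2\<close> exceed any constant. As \<open>3/2\<close> bounds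
  the logarithm from below on at least 3 vertices, leading factors can be moved into the
  exponent.\<close>

lemma absorb_constant:
  fixes y C :: real
  shows "\<exists>e>0. \<forall>y\<ge>3/2. C * y ^ k \<le> y ^ e"
proof -
  obtain m where m: "C < (3/2 :: real) ^ m" using real_arch_pow[of "3/2" C] by auto
  have "C * y ^ k \<le> y ^ (Suc m + k)" if y: "y \<ge> 3/2" for y :: real
  proof -
    have "C \<le> y ^ m" using m power_mono[OF y, of m] by simp
    also have "\<dots> \<le> y ^ Suc m" by (rule power_increasing) (use y in auto)
    finally have "C * y ^ k \<le> y ^ Suc m * y ^ k" by (rule mult_right_mono) (use y in simp)
    then show ?thesis by (simp only: power_add)
  qed
  then show ?thesis by (intro exI[of _ "Suc m + k"]) simp
qed

text \<open>With \<open>x = ln t\<close>, the left side is at most \<open>(6 * x) ^ c\<close>, since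
  \<open>1 / ln 2 \<le> 2\<close> and \<open>x \<ge> 1\<close>, and \<open>exp x\<close> outgrows
  it. A biclique with sides \<open>t\<close> then violates (ii).\<close>

lemma large_biclique:
  fixes c :: nat
  shows "\<exists>t\<ge>2. (2 * log 2 (real (2 * t))) ^ c < real t"
proof -
  have "((\<lambda>x. x ^ c / exp x) \<longlongrightarrow> (0 :: real)) at_top" by (rule tendsto_power_div_exp_0)
  then have "eventually (\<lambda>x. x ^ c / exp x < (1 / 6 ^ c :: real)) at_top"
    by (rule order_tendstoD(2)) simp
  then obtain x0 where x0: "\<And>x. x \<ge> x0 \<Longrightarrow> x ^ c / exp x < (1 / 6 ^ c :: real)"
    by (auto simp: eventually_at_top_linorder)
  define t where "t = nat \<lceil>exp (max 1 x0)\<rceil>"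
  have t: "real t \<ge> exp (max 1 x0)" unfolding t_def by linarith
  have "exp (max 1 x0) \<ge> exp 1" by simp
  moreover have "exp 1 \<ge> (2 :: real)" using exp_ge_add_one_self[of 1] by simp
  ultimately have t2: "real t \<ge> 2" using t by linarith
  have "max 1 x0 \<le> ln (real t)" using t t2 by (subst ln_ge_iff) auto
  then have x: "ln (real t) \<ge> 1" "ln (real t) \<ge> x0" by simp_all
  have "log 2 (real (2 * t)) = 1 + ln (real t) / ln 2" using t2 by (simp add: log_def ln_mult add_divide_distrib)
  also have "\<dots> \<le> 1 + 2 * ln (real t)"
  proof -
    have "ln (real t) * 1 \<le> ln (real t) * (2 * ln 2)"
    proof (rule mult_left_mono)
      have "ln (exp (1/2)) \<le> ln (2 :: real)" by (subst ln_le_cancel_iff) (use exp_half_le2 in auto)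
      then show "1 \<le> 2 * ln (2 :: real)" by simp
    qed (use x(1) in simp)
    then show ?thesis by (simp add: field_simps)
  qed
  finally have "2 * log 2 (real (2 * t)) \<le> 6 * ln (real t)" using x(1) by linarith
  moreover have "0 \<le> 2 * log 2 (real (2 * t))" using t2 by simp
  ultimately have "(2 * log 2 (real (2 * t))) ^ c \<le> (6 * ln (real t)) ^ c" by (rule power_mono)
  also have "\<dots> < real t"
    using x0[OF x(2)] t2 by (simp add: power_mult_distrib field_simps)
  finally show ?thesis using t2 by (intro exI[of _ t]) simp
qed

lemma biclique_clique_le:
  assumes "indep R A" "indep R B" "finite K" "K \<subseteq> A \<union> B" "cliq R K"
  shows "card K \<le> 2"
proof -
  have "K = (K \<inter> A) \<union> (K \<inter> B)" using assms(4) by blast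
  then have "card K \<le> card (K \<inter> A) + card (K \<inter> B)" using card_Un_le by metis
  then show ?thesis
    using cliq_indep_card_le_1[OF assms(5,1,3)] cliq_indep_card_le_1[OF assms(5,2,3)] by simp
qed

section \<open>The three implications\<close>

locale hereditary_class =
  fixes \<C> :: "('a, 'b) pre_digraph set"
  assumes graphs: "\<And>G. G \<in> \<C> \<Longrightarrow> graph G" and hered: "hereditary \<C>"
begin

lemma graph_facts:
  assumes "G \<in> \<C>"
  shows "sym (arcs_ends G)" "(x, x) \<notin> arcs_ends G" "finite (verts G)" "arcs_ends G \<subseteq> verts G \<times> verts G"
proof -
  interpret graph G by (rule graphs[OF assms])
  show "sym (arcs_ends G)" using sym_arcs by (simp add: symmetric_def)
  show "(x, x) \<notin> arcs_ends G" using adj_not_same by blast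
  show "finite (verts G)" by simp
  show "arcs_ends G \<subseteq> verts G \<times> verts G" using adj_in_verts by fast
qed

lemma induced_in_class:
  assumes "G \<in> \<C>" "W \<subseteq> verts G"
  shows "G \<restriction> W \<in> \<C>"
proof -
  interpret graph G by (rule graphs[OF assms(1)])
  show ?thesis using hered assms(1) induced_induce[OF assms(2)] unfolding hereditary_def by blast
qed

lemma clique_induce_iff: "clique (G \<restriction> W) K \<longleftrightarrow> K \<subseteq> W \<and> cliq (arcs_ends G) K"
  unfolding clique_def cliq_def arcs_ends_induce induce_subgraph_verts by blast

lemma clique_number_induce_le:
  assumes "G \<in> \<C>" "W \<subseteq> verts G" "\<And>K. K \<subseteq> W \<Longrightarrow> cliq (arcs_ends G) K \<Longrightarrow> card K \<le> k"
  shows "clique_number (G \<restriction> W) \<le> k"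
  by (rule clique_number_le[OF graphs[OF induced_in_class[OF assms(1,2)]]])
    (use assms(3) in \<open>simp add: clique_induce_iff\<close>)

lemma cliq_card_le:
  assumes "G \<in> \<C>" "K \<subseteq> verts G" "cliq (arcs_ends G) K"
  shows "card K \<le> clique_number G"
  by (rule clique_number_ge[OF graphs[OF assms(1)]]) (use assms(2,3) in \<open>auto simp: clique_def cliq_def\<close>)

lemma clique_number_pos:
  assumes "G \<in> \<C>" "verts G \<noteq> {}"
  shows "clique_number G \<ge> 1"
proof -
  obtain v where "v \<in> verts G" using assms(2) by blast
  then have "card {v} \<le> clique_number G" by (intro cliq_card_le[OF assms(1)]) (auto simp: cliq_def)
  then show ?thesis by simp
qed

text \<open>Conditions (ii) and (iii) are instances for the two choices of \<open>f\<close>.\<close>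

definition poly_omega_log :: "(('a, 'b) pre_digraph \<Rightarrow> nat) \<Rightarrow> nat \<Rightarrow> bool" where
  "poly_omega_log f c \<longleftrightarrow> (\<forall>G\<in>\<C>. card (verts G) \<ge> 3 \<longrightarrow>
     real (f G) \<le> (real (clique_number G) * log 2 (real (card (verts G)))) ^ c)"

lemma poly_omega_logD:
  "poly_omega_log f c \<Longrightarrow> G \<in> \<C> \<Longrightarrow> card (verts G) \<ge> 3 \<Longrightarrow>
     real (f G) \<le> (real (clique_number G) * log 2 (real (card (verts G)))) ^ c"
  by (simp add: poly_omega_log_def)

lemma omega_log_ge:
  assumes "G \<in> \<C>" "card (verts G) \<ge> 3"
  shows "log 2 (real (card (verts G))) \<ge> 3/2"
    "real (clique_number G) * log 2 (real (card (verts G))) \<ge> log 2 (real (card (verts G)))"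
    "real (clique_number G) * log 2 (real (card (verts G))) \<ge> real (clique_number G)"
    "real (clique_number G) \<ge> 1"
proof -
  show l: "log 2 (real (card (verts G))) \<ge> 3/2" by (rule log2_ge[OF assms(2)])
  have "verts G \<noteq> {}" using assms(2) by auto
  then show w: "real (clique_number G) \<ge> 1" using clique_number_pos[OF assms(1)] by simp
  show "real (clique_number G) * log 2 (real (card (verts G))) \<ge> log 2 (real (card (verts G)))"
    using mult_right_mono[OF w, of "log 2 (real (card (verts G)))"] l by simp
  show "real (clique_number G) * log 2 (real (card (verts G))) \<ge> real (clique_number G)"
    using mult_left_mono[of 1 "log 2 (real (card (verts G)))" "real (clique_number G)"] l by simp
qed

lemma polylog_imp_poly_omega_log:
  assumes "\<forall>G\<in>\<C>. card (verts G) \<ge> 3 \<longrightarrow>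
    real (tree_independence_number G) \<le> log 2 (real (card (verts G))) ^ c"
  shows "poly_omega_log tree_independence_number c"
  unfolding poly_omega_log_def
proof (intro ballI impI)
  fix G assume G: "G \<in> \<C>" "card (verts G) \<ge> 3"
  have "real (tree_independence_number G) \<le> log 2 (real (card (verts G))) ^ c" using assms G by blast
  also have "\<dots> \<le> (real (clique_number G) * log 2 (real (card (verts G)))) ^ c"
    by (rule power_mono) (use omega_log_ge[OF G] in simp_all)
  finally show "real (tree_independence_number G) \<le> (real (clique_number G) * log 2 (real (card (verts G)))) ^ c" .
qed

lemma excluded_biclique:
  assumes "poly_omega_log tree_independence_number c"
  shows "\<exists>t. \<forall>G\<in>\<C>. \<forall>A B. A \<subseteq> verts G \<longrightarrow> B \<subseteq> verts G \<longrightarrow> indep (arcs_ends G) A \<longrightarrow> indep (arcs_ends G) B \<longrightarrow>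
    card A = t \<longrightarrow> card B = t \<longrightarrow> \<not> A \<times> B \<subseteq> arcs_ends G"
proof -
  obtain t where t: "t \<ge> 2" "(2 * log 2 (real (2 * t))) ^ c < real t" using large_biclique by blast
  have False if G: "G \<in> \<C>" and A: "A \<subseteq> verts G" "indep (arcs_ends G) A" "card A = t"
    and B: "B \<subseteq> verts G" "indep (arcs_ends G) B" "card B = t" and AB: "A \<times> B \<subseteq> arcs_ends G" for G A B
  proof -
    let ?R = "arcs_ends G" and ?W = "A \<union> B"
    let ?H = "G \<restriction> ?W"
    have W: "?W \<subseteq> verts G" using A(1) B(1) by simp
    have fin: "finite A" "finite B" using finite_subset[OF A(1)] finite_subset[OF B(1)] graph_facts(3)[OF G] by auto
    have "A \<inter> B = {}" using AB graph_facts(2)[OF G] by blast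
    then have cW: "card (verts ?H) = 2 * t" using card_Un_disjoint[OF fin] A(3) B(3) by simp
    have H: "?H \<in> \<C>" by (rule induced_in_class[OF G W])
    have "tdec (arcs_ends ?H) (verts ?H) (alpha_le (arcs_ends ?H) (tree_independence_number ?H))"
      by (rule tree_independence_number_imp_tdec[OF graphs[OF H]])
    then have "tdec ?R ?W (alpha_le (arcs_ends ?H) (tree_independence_number ?H))"
      by (simp add: arcs_ends_induce tdec_Int)
    then have "tdec ?R ?W (alpha_le ?R (tree_independence_number ?H))"
    proof (rule tdec_mono)
      fix C assume "C \<subseteq> ?W" and al: "alpha_le (arcs_ends ?H) (tree_independence_number ?H) C"
      show "alpha_le ?R (tree_independence_number ?H) C"
        using al unfolding alpha_le_def indep_def arcs_ends_induce by blast
    qed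
    from tdec_biclique[OF this graph_facts(1)[OF G] AB A(2) B(2)]
    have "t \<le> tree_independence_number ?H" using A(3) B(3) by simp
    then have "real t \<le> real (tree_independence_number ?H)" by simp
    also have "\<dots> \<le> (real (clique_number ?H) * log 2 (real (card (verts ?H)))) ^ c"
      by (rule poly_omega_logD[OF assms H]) (use cW t(1) in linarith)
    also have "\<dots> \<le> (2 * log 2 (real (2 * t))) ^ c"
    proof (rule power_mono)
      have "clique_number ?H \<le> 2"
      proof (rule clique_number_induce_le[OF G W])
        fix K assume K: "K \<subseteq> ?W" "cliq ?R K"
        have "finite K" by (rule finite_subset[OF K(1)]) (use fin in simp)
        then show "card K \<le> 2" by (rule biclique_clique_le[OF A(2) B(2) _ K])
      qed
      then show "real (clique_number ?H) * log 2 (real (card (verts ?H))) \<le> 2 * log 2 (real (2 * t))"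
        unfolding cW using t(1) by (intro mult_right_mono) auto
      show "0 \<le> real (clique_number ?H) * log 2 (real (card (verts ?H)))"
        unfolding cW using t(1) by (intro mult_nonneg_nonneg) auto
    qed
    finally show False using t(2) by simp
  qed
  then show ?thesis by blast
qed

lemma treeindep_imp_treewidth:
  assumes "poly_omega_log tree_independence_number c"
  shows "\<exists>c'>0. poly_omega_log treewidth c'"
proof -
  obtain t where t: "\<forall>G\<in>\<C>. \<forall>A B. A \<subseteq> verts G \<longrightarrow> B \<subseteq> verts G \<longrightarrow> indep (arcs_ends G) A \<longrightarrow> indep (arcs_ends G) B \<longrightarrow>
    card A = t \<longrightarrow> card B = t \<longrightarrow> \<not> A \<times> B \<subseteq> arcs_ends G"
    using excluded_biclique[OF assms] by (rule exE)
  \<comment> \<open>With \<open>N \<le> (2 * y) ^ t\<close>, the two summands of the bag size have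
    exponents \<open>c + t\<close> and \<open>(c + t) * t + t\<close>; \<open>?e\<close> dominates
    both.\<close>
  let ?e = "(c + t) * t + c + t"
  obtain e where e: "e > 0" "\<forall>y\<ge>3/2. 2 * 2 ^ ?e * y ^ ?e \<le> (y :: real) ^ e" using absorb_constant by blast
  have "real (treewidth G) \<le> (real (clique_number G) * log 2 (real (card (verts G)))) ^ e"
    if G: "G \<in> \<C>" "card (verts G) \<ge> 3" for G
  proof -
    let ?R = "arcs_ends G" and ?a = "tree_independence_number G" and ?w = "clique_number G"
    define y where "y = real ?w * log 2 (real (card (verts G)))"
    define N where "N = Suc ?w ^ t"
    have y: "y \<ge> 3/2" "real ?w \<le> y" using omega_log_ge[OF G] unfolding y_def by linarith+
    have a: "real ?a \<le> y ^ c" using assms G unfolding poly_omega_log_def y_def by blast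
    have "tdec ?R (verts G) (alpha_le ?R ?a)" by (rule tree_independence_number_imp_tdec[OF graphs[OF G(1)]])
    then have "tdec ?R (verts G) (\<lambda>B. card B \<le> Suc (?a * N + (?a * N) ^ t * N))"
    proof (rule tdec_mono)
      fix B assume B: "B \<subseteq> verts G" "alpha_le ?R ?a B"
      have "card B \<le> ?a * Suc ?w ^ t + (?a * Suc ?w ^ t) ^ t * Suc ?w ^ t"
      proof (rule erdos_hajnal_bipartite[OF _ graph_facts(1,2)[OF G(1)] B(2)])
        show "finite B" by (rule finite_subset[OF B(1) graph_facts(3)[OF G(1)]])
        show "card K \<le> ?w" if "K \<subseteq> B" "cliq ?R K" for K
          by (rule cliq_card_le[OF G(1)]) (use that B(1) in auto)
        show "\<not> X \<times> Z \<subseteq> ?R" if "X \<subseteq> B" "Z \<subseteq> B" "indep ?R X" "indep ?R Z" "card X = t" "card Z = t" for X Z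
          using t[rule_format, OF G(1), of X Z] that B(1) by simp
      qed
      then show "card B \<le> Suc (?a * N + (?a * N) ^ t * N)" unfolding N_def by simp
    qed
    then have "treewidth G \<le> ?a * N + (?a * N) ^ t * N" by (rule tdec_imp_treewidth[OF graphs[OF G(1)]])
    then have "real (treewidth G) \<le> real (?a * N + (?a * N) ^ t * N)" by (rule of_nat_mono)
    also have "\<dots> = real ?a * real N + (real ?a * real N) ^ t * real N" by simp
    also have "\<dots> \<le> (2 * y) ^ ?e + (2 * y) ^ ?e"
    proof -
      have y2: "2 * y \<ge> 1" using y by simp
      have N: "real N \<le> (2 * y) ^ t"
        unfolding N_def of_nat_power using y omega_log_ge(4)[OF G] by (intro power_mono) auto
      have "y ^ c \<le> (2 * y) ^ c" using y by (intro power_mono) auto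
      then have "real ?a \<le> (2 * y) ^ c" using a by linarith
      then have aN: "real ?a * real N \<le> (2 * y) ^ (c + t)"
        unfolding power_add using N y by (intro mult_mono) auto
      also have "\<dots> \<le> (2 * y) ^ ?e" by (rule power_increasing) (use y2 in auto)
      finally have 1: "real ?a * real N \<le> (2 * y) ^ ?e" .
      have "(real ?a * real N) ^ t \<le> ((2 * y) ^ (c + t)) ^ t" by (rule power_mono[OF aN]) simp
      then have "(real ?a * real N) ^ t * real N \<le> ((2 * y) ^ (c + t)) ^ t * (2 * y) ^ t"
        using N y by (intro mult_mono) auto
      also have "\<dots> = (2 * y) ^ ((c + t) * t + t)" by (simp only: power_mult power_add)
      also have "\<dots> \<le> (2 * y) ^ ?e" by (rule power_increasing) (use y2 in auto)
      finally show ?thesis using 1 by linarith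
    qed
    also have "\<dots> = 2 * 2 ^ ?e * y ^ ?e" by (simp add: power_mult_distrib)
    also have "\<dots> \<le> y ^ e" using e(2) y(1) by blast
    finally show ?thesis unfolding y_def .
  qed
  then show ?thesis using e(1) unfolding poly_omega_log_def by blast
qed

lemma treewidth_imp_polylog:
  assumes "poly_omega_log treewidth c"
  shows "\<exists>c'>0. \<forall>G\<in>\<C>. card (verts G) \<ge> 3 \<longrightarrow>
    real (tree_independence_number G) \<le> log 2 (real (card (verts G))) ^ c'"
proof -
  \<comment> \<open>\<open>53249\<close> is \<open>16 * 13 * 16 * 16 + 1\<close> from bounding
    \<open>K\<close>; 10 bounds \<open>(4 * L + 1) * (L + 1)\<close> by \<open>10 * L ^ 2\<close>;
    \<open>2 ^ 8\<close> comes from \<open>L \<le> 2 * y\<close>, and the last factor from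
    \<open>D \<le> 3 * (128 * y ^ 2) ^ c\<close>.\<close>
  define C :: real where "C = 10 * 53249\<^sup>2 * 2 ^ 8 * (3 * 128 ^ c) ^ 6"
  obtain e where e: "e > 0" "\<forall>y\<ge>3/2. C * y ^ (8 + 12 * c) \<le> (y :: real) ^ e" using absorb_constant by blast
  have "real (tree_independence_number G) \<le> log 2 (real (card (verts G))) ^ e"
    if G: "G \<in> \<C>" "card (verts G) \<ge> 3" for G
  proof -
    let ?R = "arcs_ends G" and ?n = "card (verts G)"
    define y where "y = log 2 (real ?n)"
    define L where "L = nat \<lceil>y\<rceil>"
    define s where "s = L + 3"
    \<comment> \<open>The value of (iii) at clique number \<open>16 * s\<close>. The added 2 covers
      the step from treewidth to bag size and leaves room for graphs with at most two
      vertices.\<close>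
    define D where "D = nat \<lfloor>(16 * real s * y) ^ c\<rfloor> + 2"
    define K where "K = 16 * (6 * L + 7) * ((4 * s * D) * (4 * s * D)) * D + 1"
    have y: "y \<ge> 3/2" using omega_log_ge(1)[OF G] by (simp add: y_def)
    have L: "y \<le> real L" "real L \<le> 2 * y" "L \<ge> 1" using y unfolding L_def by linarith+
    have n: "?n \<le> 2 ^ L"
    proof -
      have "real ?n = 2 powr y" using G(2) by (simp add: y_def)
      also have "\<dots> \<le> 2 powr real L" using L(1) by simp
      also have "\<dots> = real (2 ^ L)" by (simp add: powr_realpow)
      finally show ?thesis by (simp only: of_nat_le_iff)
    qed
    have sy: "16 * real s * y \<ge> 0" using y by simp
    have "tdec ?R (verts G) (alpha_le ?R (K * K * ((4 * L + 1) * (L + 1))))"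
      unfolding K_def s_def
    proof (rule alpha_decomposition[OF graph_facts(1,2,3)[OF G(1)] n])
      show "D > 0" by (simp add: D_def)
      fix W assume W: "W \<subseteq> verts G" and om: "\<And>X. X \<subseteq> W \<Longrightarrow> cliq ?R X \<Longrightarrow> card X \<le> 16 * (L + 3)"
      show "tdec ?R W (\<lambda>B. card B \<le> D)"
      proof (cases "card W \<ge> 3")
        \<comment> \<open>(iii) is silent below three vertices; a single bag does.\<close>
        case False
        then show ?thesis by (intro tdec_trivial) (simp add: D_def)
      next
        case True
        let ?H = "G \<restriction> W"
        have H: "?H \<in> \<C>" by (rule induced_in_class[OF G(1) W])
        have "real (treewidth ?H) \<le> (real (clique_number ?H) * log 2 (real (card W))) ^ c"
          using poly_omega_logD[OF assms H] True by simp
        also have "\<dots> \<le> (16 * real s * y) ^ c"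
        proof (rule power_mono)
          have "clique_number ?H \<le> 16 * s" unfolding s_def by (rule clique_number_induce_le[OF G(1) W om])
          then have "real (clique_number ?H) \<le> real (16 * s)" by (rule of_nat_mono)
          moreover have "card W \<le> ?n" by (rule card_mono[OF graph_facts(3)[OF G(1)] W])
          then have "log 2 (real (card W)) \<le> y" unfolding y_def using True by simp
          ultimately show "real (clique_number ?H) * log 2 (real (card W)) \<le> 16 * real s * y"
            using True by (intro mult_mono) auto
          show "0 \<le> real (clique_number ?H) * log 2 (real (card W))" using True by simp
        qed
        finally have "int (treewidth ?H) \<le> \<lfloor>(16 * real s * y) ^ c\<rfloor>" by (simp add: le_floor_iff)
        then have le: "Suc (treewidth ?H) \<le> D" unfolding D_def by linarith
        have "tdec (arcs_ends ?H) (verts ?H) (\<lambda>B. card B \<le> Suc (treewidth ?H))"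
          by (rule treewidth_imp_tdec[OF graphs[OF H]])
        then have "tdec ?R W (\<lambda>B. card B \<le> Suc (treewidth ?H))" by (simp add: arcs_ends_induce tdec_Int)
        then show ?thesis by (rule tdec_mono) (use le in simp)
      qed
    qed
    then have "tree_independence_number G \<le> K * K * ((4 * L + 1) * (L + 1))"
      by (rule tdec_imp_tree_independence_number[OF graphs[OF G(1)]])
    also have "\<dots> \<le> (53249 * (L ^ 3 * D ^ 3)) * (53249 * (L ^ 3 * D ^ 3)) * ((5 * L) * (2 * L))"
    proof -
      have D1: "D \<ge> 1" by (simp add: D_def)
      have "4 * s * D \<le> 16 * (L * D)" using L(3) by (simp add: s_def)
      then have sq: "(4 * s * D) * (4 * s * D) \<le> (16 * (L * D)) * (16 * (L * D))"
        using mult_le_mono by blast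
      have "6 * L + 7 \<le> 13 * L" using L(3) by simp
      from mult_le_mono[OF mult_le_mono[OF mult_le_mono[OF order_refl this] sq] order_refl]
      have "16 * (6 * L + 7) * ((4 * s * D) * (4 * s * D)) * D \<le> 16 * (13 * L) * ((16 * (L * D)) * (16 * (L * D))) * D" .
      also have "\<dots> = 53248 * (L ^ 3 * D ^ 3)" by (simp add: power3_eq_cube)
      finally have "K \<le> 53248 * (L ^ 3 * D ^ 3) + 1" by (simp add: K_def)
      moreover have "1 \<le> L ^ 3 * D ^ 3" using L(3) D1 by simp
      ultimately have "K \<le> 53249 * (L ^ 3 * D ^ 3)" by linarith
      then show ?thesis using L(3) by (intro mult_le_mono) auto
    qed
    also have "\<dots> = 10 * 53249\<^sup>2 * (L ^ 8 * D ^ 6)"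
    proof -
      have gen: "(a * (b * d)) * (a * (b * d)) * ((5 * L) * (2 * L)) = 10 * a\<^sup>2 * ((b * b * L\<^sup>2) * (d * d))"
        for a b d :: nat
        by (simp add: power2_eq_square mult_ac)
      have "L ^ 8 = L ^ 3 * L ^ 3 * L\<^sup>2" "D ^ 6 = D ^ 3 * D ^ 3" by (simp_all flip: power_add)
      then show ?thesis unfolding gen by (simp only:)
    qed
    finally have "real (tree_independence_number G) \<le> real (10 * 53249\<^sup>2 * (L ^ 8 * D ^ 6))" by (rule of_nat_mono)
    also have "\<dots> = 10 * 53249\<^sup>2 * (real L ^ 8 * real D ^ 6)" by simp
    also have "\<dots> \<le> 10 * 53249\<^sup>2 * ((2 * y) ^ 8 * (3 * (128 * y\<^sup>2) ^ c) ^ 6)"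
    proof -
      have "real L ^ 8 \<le> (2 * y) ^ 8" by (rule power_mono[OF L(2)]) simp
      moreover have "real D \<le> 3 * (128 * y\<^sup>2) ^ c"
      proof -
        have "real s \<le> 8 * y" using L(2) y unfolding s_def by simp
        then have "16 * real s * y \<le> 16 * (8 * y) * y" using y by (intro mult_right_mono) auto
        also have "\<dots> = 128 * y\<^sup>2" by (simp add: power2_eq_square)
        finally have "(16 * real s * y) ^ c \<le> (128 * y\<^sup>2) ^ c" by (rule power_mono) (rule sy)
        moreover have "real D \<le> (16 * real s * y) ^ c + 2"
        proof -
          have "0 \<le> (16 * real s * y) ^ c" by (rule zero_le_power[OF sy])
          then show ?thesis unfolding D_def by linarith
        qed
        moreover have "1 \<le> (128 * y\<^sup>2) ^ c"
        proof (rule one_le_power)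
          have "1 * 1 \<le> y * y" using y by (intro mult_mono) auto
          then show "1 \<le> 128 * y\<^sup>2" by (simp add: power2_eq_square)
        qed
        ultimately show ?thesis by linarith
      qed
      then have "real D ^ 6 \<le> (3 * (128 * y\<^sup>2) ^ c) ^ 6" by (rule power_mono) simp
      ultimately show ?thesis by (intro mult_left_mono mult_mono) auto
    qed
    also have "\<dots> = C * y ^ (8 + 12 * c)"
    proof -
      have "((128 * y\<^sup>2) ^ c) ^ 6 = (128 ^ c) ^ 6 * y ^ (12 * c)"
        by (simp add: power_mult_distrib power_mult[symmetric] mult.commute)
      then show ?thesis unfolding C_def by (simp only: power_mult_distrib power_add mult_ac)
    qed
    also have "\<dots> \<le> y ^ e" using e(2) y by blast
    finally show ?thesis unfolding y_def .
  qed
  then show ?thesis using e(1) by blast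
qed

end

theorem theorem1p1:
  fixes \<C> :: "('a, 'b) pre_digraph set"
  assumes graphs: "\<And>G. G \<in> \<C> \<Longrightarrow> graph G"
    and hereditary: "hereditary \<C>"
  shows
    "((\<exists>c\<^sub>1>0. \<forall>G\<in>\<C>. card (verts G) \<ge> 3 \<longrightarrow>
          real (tree_independence_number G) \<le> log 2 (real (card (verts G))) ^ c\<^sub>1)
      \<longleftrightarrow>
      (\<exists>c\<^sub>2>0. \<forall>G\<in>\<C>. card (verts G) \<ge> 3 \<longrightarrow>
          real (tree_independence_number G)
            \<le> (real (clique_number G) * log 2 (real (card (verts G)))) ^ c\<^sub>2))
     \<and>
     ((\<exists>c\<^sub>2>0. \<forall>G\<in>\<C>. card (verts G) \<ge> 3 \<longrightarrow>
          real (tree_independence_number G)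
            \<le> (real (clique_number G) * log 2 (real (card (verts G)))) ^ c\<^sub>2)
      \<longleftrightarrow>
      (\<exists>c\<^sub>3>0. \<forall>G\<in>\<C>. card (verts G) \<ge> 3 \<longrightarrow>
          real (treewidth G)
            \<le> (real (clique_number G) * log 2 (real (card (verts G)))) ^ c\<^sub>3))"
proof -
  interpret hereditary_class \<C> by (intro hereditary_class.intro graphs hereditary)
  let ?i = "\<exists>c>0. \<forall>G\<in>\<C>. card (verts G) \<ge> 3 \<longrightarrow>
      real (tree_independence_number G) \<le> log 2 (real (card (verts G))) ^ c"
  let ?ii = "\<exists>c>0. poly_omega_log tree_independence_number c" and ?iii = "\<exists>c>0. poly_omega_log treewidth c"
  have 1: "?ii" if "?i" using that polylog_imp_poly_omega_log by blast
  have 2: "?iii" if "?ii" using that treeindep_imp_treewidth by blast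
  have 3: "?i" if "?iii" using that treewidth_imp_polylog by blast
  from 1 2 3 have "(?i \<longleftrightarrow> ?ii) \<and> (?ii \<longleftrightarrow> ?iii)" by argo
  then show ?thesis unfolding poly_omega_log_def .
qed

end
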